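(* Let $d\in\{2,3\}$, $t_n\ge t_0$, let $\widetilde{\boldsymbol{f}}\in L^1(t_0,t_n;L^2(\Omega)^d)$ be a forcing function, and let $\boldsymbol{u}_h(t_0)\in\boldsymbol{W}_h\subset\boldsymbol{H}_0(\mathrm{div};\Omega)$ be an initial condition. Let $\nu_h>0$, $\zeta\ge 0$ and $\eta>2C_{\mathrm{tr}}^2N_\partial$. Then there is a constant $C>0$, independent of $h$, namely the coercivity constant of $a_h$ (i.e. $a_h(\boldsymbol{w}_h,\boldsymbol{w}_h)\ge C\|\boldsymbol{w}_h\|_{\mathrm{sym}}^2$ for all $\boldsymbol{w}_h\in\boldsymbol{W}_h$), such that every solution $(\widetilde{p}_h,\boldsymbol{u}_h)$, with values in $Q_h\times\boldsymbol{W}_h$ and initial value $\boldsymbol{u}_h(t_0)$, of the semi-discrete mixed method $$b_h(\boldsymbol{u}_h,q_h)=0\quad\forall q_h\in Q_h,$$ $$(\partial_t\boldsymbol{u}_h,\boldsymbol{w}_h)+c_h(\boldsymbol{u}_h;\boldsymbol{u}_h,\boldsymbol{w}_h)+\nu_h\,a_h(\boldsymbol{u}_h,\boldsymbol{w}_h)-b_h(\boldsymbol{w}_h,\widetilde{p}_h)=(\widetilde{\boldsymbol{f}},\boldsymbol{w}_h)\quad\forall\boldsymbol{w}_h\in\boldsymbol{W}_h$$ on $(t_0,t_n)$ satisfies $$\frac12\|\boldsymbol{u}_h(t_n)\|_{L^2(\Omega)}^2+\int_{t_0}^{t_n}\Big(|\boldsymbol{u}_h(s)|_{\boldsymbol{u}_h(s)}^2+\nu_h\,C\,\|\boldsymbol{u}_h(s)\|_{\mathrm{sym}}^2\Big)ds\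 \le\ \|\boldsymbol{u}_h(t_0)\|_{L^2(\Omega)}^2+\frac32\,\|\widetilde{\boldsymbol{f}}\|_{L^1(t_0,t_n;L^2(\Omega))}^2,$$ where $\|\widetilde{\boldsymbol{f}}\|_{L^1(t_0,t_n;L^2(\Omega))}=\int_{t_0}^{t_n}\|\widetilde{\boldsymbol{f}}(s)\|_{L^2(\Omega)}\,ds$.
   Context: Domain and mesh. $\Omega\subset\mathbb{R}^d$ is a bounded polygonal/polyhedral domain. $(\mathcal{T}_h)_h$ is a shape-regular family of finite meshes of $\Omega$ into non-overlapping simplices $K$ (diameter $h_K$), conforming to $\Omega$ and without hanging nodes. $\mathcal{F}_h$ is the set of all faces (edges if $d=2$); $\mathcal{F}_h^i$ is the set of interior faces, each shared by exactly two elements, and $\mathcal{F}_h^{\partial}$ is the set of faces contained in $\partial\Omega$. For a face $F$, $h_F$ is its diameter, and $\boldsymbol{n}_F$ is a fixed unit normal pointing from the $+$ side to the $-$ side (outward if $F\subset\partial\Omega$). On $F\in\mathcal{F}_h^i$, $[\![\phi]\!]=\phi_+-\phi_-$ and $\{\!\{\phi\}\!\}=\frac12(\phi_++\phi_-)$; on $F\in\mathcal{F}_h^{\partial}$, $[\![\phi]\!]=\phi=\{\!\{\phi\}\!\}$. Spaces. $\boldsymbol{H}_0(\mathrm{div};\Omega)=\{\boldsymbol{w}\in L^2(\Omega)^d:\nabla\cdot\boldsymbol{w}\in L^2(\Omega),\ \boldsymbol{w}\cdot\boldsymbol{n}|_{\partial\Omega}=0\}$; $L^2_*(\Omega)$ is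 the space of $L^2$ functions of zero mean. $\boldsymbol{W}_h\subset\boldsymbol{H}_0(\mathrm{div};\Omega)$ and $Q_h\subset L^2_*(\Omega)$ are finite element spaces of functions that are polynomial on each $K\in\mathcal{T}_h$, the components of elements of $\boldsymbol{W}_h$ having degree at most $m$ on each $K$, with $m$ independent of $h$. Forms. $(\cdot,\cdot)$ is the $L^2(\Omega)$ inner product; $\nabla_h,\nabla_h\cdot$ are the elementwise gradient and divergence; $(\boldsymbol{\beta}\cdot\nabla_h\boldsymbol{v})_i=\sum_j\beta_j\partial_jv_i$; $\mathbb{I}$ is the $d\times d$ identity; ":" is the Frobenius product; $\mathcal{D}_h(\boldsymbol{w})=\nabla_h\boldsymbol{w}+\nabla_h\boldsymbol{w}^T-\frac23(\nabla_h\cdot\boldsymbol{w})\mathbb{I}$. For $\boldsymbol{\beta}_h,\boldsymbol{v}_h,\boldsymbol{w}_h\in\boldsymbol{W}_h$, $q_h\in Q_h$: $$b_h(\boldsymbol{v}_h,q_h)=\int_\Omega(\nabla\cdot\boldsymbol{v}_h)\,q_h\,dV,$$ $$\begin{aligned}c_h(\boldsymbol{\beta}_h;\boldsymbol{v}_h,\boldsymbol{w}_h)=\;&\int_\Omega(\boldsymbol{\beta}_h\cdot\nabla_h\boldsymbol{v}_h)\cdot\boldsymbol{w}_h\,dV+\frac12\int_\Omega(\nabla\cdot\boldsymbol{\beta}_h)\boldsymbol{v}_h\cdot\boldsymbol{w}_h\,dV\\&-\sum_{F\in\mathcal{F}_h^i}\int_F(\boldsymbol{\beta}_h\cdot\boldsymbol{n}_F)[\![\boldsymbol{v}_h]\!]\cdot\{\!\{\boldsymbol{w}_h\}\!\}\,dA+\zeta\sum_{F\in\mathcal{F}_h^i}\int_F|\boldsymbol{\beta}_h\cdot\boldsymbol{n}_F|[\![\boldsymbol{v}_h]\!]\cdot[\![\boldsymbol{w}_h]\!]\,dA,\end{aligned}$$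 $$\begin{aligned}a_h(\boldsymbol{v}_h,\boldsymbol{w}_h)=\;&\int_\Omega\mathcal{D}_h(\boldsymbol{v}_h):\nabla_h\boldsymbol{w}_h\,dV-\sum_{F\in\mathcal{F}_h}\int_F[\![\boldsymbol{v}_h]\!]\cdot\{\!\{\mathcal{D}_h(\boldsymbol{w}_h)\}\!\}\boldsymbol{n}_F\,dA\\&-\sum_{F\in\mathcal{F}_h}\int_F[\![\boldsymbol{w}_h]\!]\cdot\{\!\{\mathcal{D}_h(\boldsymbol{v}_h)\}\!\}\boldsymbol{n}_F\,dA+\sum_{F\in\mathcal{F}_h}\frac{\eta}{h_F}\int_F[\![\boldsymbol{v}_h]\!]\cdot[\![\boldsymbol{w}_h]\!]\,dA.\end{aligned}$$ Norms. $\|\boldsymbol{w}\|_{\mathrm{sym}}=\Big(\|\mathcal{D}_h(\boldsymbol{w})\|_{L^2(\Omega)}^2+\sum_{F\in\mathcal{F}_h}\frac1{h_F}\int_F|[\![\boldsymbol{w}]\!]|^2dA\Big)^{1/2}$ and $|\boldsymbol{w}_h|_{\boldsymbol{\beta}_h}=\Big(\zeta\sum_{F\in\mathcal{F}_h^i}\int_F|\boldsymbol{\beta}_h\cdot\boldsymbol{n}_F|\,|[\![\boldsymbol{w}_h]\!]|^2dA\Big)^{1/2}$. Constants. $N_\partial$ is the maximum number of faces of a mesh element, and $C_{\mathrm{tr}}$ is the ($h$-independent) constant of the discrete trace inequality $h_K^{1/2}\|q\|_{L^2(F)}\le C_{\mathrm{tr}}\|q\|_{L^2(K)}$, valid for all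 $h$, all $K\in\mathcal{T}_h$, all faces $F$ of $K$ and all polynomials $q$ of degree at most $m$. $\nu_h$ is the (constant) viscosity coefficient; $\eta,\zeta$ are user-chosen parameters independent of $h$. A solution means: $\boldsymbol{u}_h:[t_0,t_n]\to\boldsymbol{W}_h$ is absolutely continuous, $\widetilde{p}_h(t)\in Q_h$, and the two equations hold for almost every $t\in(t_0,t_n)$. *)

theory Defs
  imports "HOL-Analysis.Analysis"
begin

text \<open>
  Elements of \<open>L\<^sup>2\<close> are represented by functions, and every volume integral is taken with respect to
  the completed measure \<^term>\<open>lebesgue\<close>. The values of a representative on a null set, such as the
  mesh skeleton, therefore never matter.
\<close>

section \<open>Lebesgue spaces\<close>

definition L2 :: "(real ^ 'd) set \<Rightarrow> (real ^ 'd \<Rightarrow> 'b::euclidean_space) \<Rightarrow> bool" where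
  "L2 \<Omega> v \<longleftrightarrow> set_borel_measurable lebesgue \<Omega> v \<and> set_integrable lebesgue \<Omega> (\<lambda>x. (norm (v x))\<^sup>2)"

definition L2_inner ::
  "(real ^ 'd) set \<Rightarrow> (real ^ 'd \<Rightarrow> 'b::euclidean_space) \<Rightarrow> (real ^ 'd \<Rightarrow> 'b) \<Rightarrow> real" where
  "L2_inner \<Omega> v w = (LINT x:\<Omega>|lebesgue. v x \<bullet> w x)"

definition L2_norm :: "(real ^ 'd) set \<Rightarrow> (real ^ 'd \<Rightarrow> 'b::euclidean_space) \<Rightarrow> real" where
  "L2_norm \<Omega> v = sqrt (LINT x:\<Omega>|lebesgue. (norm (v x))\<^sup>2)"

definition L2_zero_mean :: "(real ^ 'd) set \<Rightarrow> (real ^ 'd \<Rightarrow> real) set" where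
  "L2_zero_mean \<Omega> = {q. L2 \<Omega> q \<and> (LINT x:\<Omega>|lebesgue. q x) = 0}"

text \<open>
  The Bochner space \<open>L\<^sup>1(I; L\<^sup>2(\<Omega>))\<close>: strong measurability is approximation, for almost every time,
  by \<open>L\<^sup>2\<close>-valued simple functions.
\<close>

definition L2_simple ::
  "(real ^ 'd) set \<Rightarrow> (real \<Rightarrow> real ^ 'd \<Rightarrow> 'b::euclidean_space) \<Rightarrow> bool" where
  "L2_simple \<Omega> s \<longleftrightarrow>
     (\<exists>(n::nat) A g. (\<forall>i<n. A i \<in> sets lebesgue \<and> L2 \<Omega> (g i)) \<and>
        (\<forall>t x. s t x = (\<Sum>i<n. indicat_real (A i) t *\<^sub>R g i x)))"

definition L1_L2 ::
  "real set \<Rightarrow> (real ^ 'd) set \<Rightarrow> (real \<Rightarrow> real ^ 'd \<Rightarrow> 'b::euclidean_space) \<Rightarrow> bool" where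
  "L1_L2 I \<Omega> f \<longleftrightarrow>
     (AE t in lebesgue. t \<in> I \<longrightarrow> L2 \<Omega> (f t)) \<and>
     (\<exists>s. (\<forall>k::nat. L2_simple \<Omega> (s k)) \<and>
        (AE t in lebesgue. t \<in> I \<longrightarrow> (\<lambda>k. L2_norm \<Omega> (\<lambda>x. s k t x - f t x)) \<longlonglongrightarrow> 0)) \<and>
     set_integrable lebesgue I (\<lambda>t. L2_norm \<Omega> (f t))"

definition L1_L2_norm ::
  "real set \<Rightarrow> (real ^ 'd) set \<Rightarrow> (real \<Rightarrow> real ^ 'd \<Rightarrow> 'b::euclidean_space) \<Rightarrow> real" where
  "L1_L2_norm I \<Omega> f = (LINT t:I|lebesgue. L2_norm \<Omega> (f t))"

section \<open>Weak divergence\<close>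

definition C1_with_gradient :: "(real ^ 'd \<Rightarrow> real) \<Rightarrow> (real ^ 'd \<Rightarrow> real ^ 'd) \<Rightarrow> bool" where
  "C1_with_gradient \<phi> G \<longleftrightarrow> (\<forall>x. GDERIV \<phi> x :> G x) \<and> continuous_on UNIV G"

text \<open>
  Testing with \<open>C\<^sup>1\<close> instead of \<open>C\<^sup>\<infinity>\<close> functions gives the same weak divergence, by mollification.
\<close>

definition is_weak_div ::
  "(real ^ 'd) set \<Rightarrow> (real ^ 'd \<Rightarrow> real ^ 'd) \<Rightarrow> (real ^ 'd \<Rightarrow> real) \<Rightarrow> bool" where
  "is_weak_div \<Omega> w g \<longleftrightarrow> L2 \<Omega> g \<and>
     (\<forall>\<phi> G. C1_with_gradient \<phi> G \<and> compact (closure {x. \<phi> x \<noteq> 0}) \<and> closure {x. \<phi> x \<noteq> 0} \<subseteq> \<Omega> \<longrightarrow>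
        (LINT x:\<Omega>|lebesgue. w x \<bullet> G x) = - (LINT x:\<Omega>|lebesgue. g x * \<phi> x))"

text \<open>The weak divergence is unique up to a null set of \<open>\<Omega>\<close>.\<close>

definition weak_div :: "(real ^ 'd) set \<Rightarrow> (real ^ 'd \<Rightarrow> real ^ 'd) \<Rightarrow> real ^ 'd \<Rightarrow> real" where
  "weak_div \<Omega> w = (SOME g. is_weak_div \<Omega> w g)"

text \<open>
  The normal trace of \<open>w\<close> is the functional \<open>\<phi> \<mapsto> \<integral>\<^sub>\<Omega> w \<cdot> \<nabla>\<phi> + (\<nabla> \<cdot> w) \<phi>\<close>, tested with functions that
  need not vanish on the boundary.
\<close>

definition H0_div :: "(real ^ 'd) set \<Rightarrow> (real ^ 'd \<Rightarrow> real ^ 'd) set" where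
  "H0_div \<Omega> = {w. L2 \<Omega> w \<and> (\<exists>g. is_weak_div \<Omega> w g \<and>
     (\<forall>\<phi> G. C1_with_gradient \<phi> G \<longrightarrow> (LINT x:\<Omega>|lebesgue. w x \<bullet> G x + g x * \<phi> x) = 0))}"

section \<open>Domain and mesh\<close>

text \<open>
  A bounded polyhedral domain is the (connected) interior of a polyhedron, so that it has no slits.
\<close>

definition polyhedral_domain :: "(real ^ 'd) set \<Rightarrow> bool" where
  "polyhedral_domain \<Omega> \<longleftrightarrow> \<Omega> \<noteq> {} \<and> connected \<Omega> \<and>
     (\<exists>P. finite P \<and> (\<forall>S\<in>P. polytope S) \<and> \<Omega> = interior (\<Union>P))"

definition mesh_faces :: "(real ^ 'd) set set \<Rightarrow> (real ^ 'd) set set" where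
  "mesh_faces T = {F. \<exists>K\<in>T. F facet_of K}"

definition interior_faces :: "(real ^ 'd) set \<Rightarrow> (real ^ 'd) set set \<Rightarrow> (real ^ 'd) set set" where
  "interior_faces \<Omega> T = {F \<in> mesh_faces T. \<not> F \<subseteq> frontier \<Omega>}"

text \<open>
  \<^const>\<open>triangulation\<close> makes any two elements meet in a common face (possibly empty): elements do not
  overlap and there are no hanging nodes.
\<close>

definition simplicial_mesh :: "(real ^ 'd) set \<Rightarrow> (real ^ 'd) set set \<Rightarrow> bool" where
  "simplicial_mesh \<Omega> T \<longleftrightarrow>
     triangulation T \<and> (\<forall>K\<in>T. int CARD('d) simplex K) \<and> \<Union>T = closure \<Omega> \<and>
     (\<forall>F\<in>mesh_faces T. card {K \<in> T. F facet_of K} = (if F \<subseteq> frontier \<Omega> then 1 else 2))"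

definition shape_regular :: "'h set \<Rightarrow> ('h \<Rightarrow> (real ^ 'd) set set) \<Rightarrow> bool" where
  "shape_regular H T \<longleftrightarrow>
     (\<exists>\<sigma>>0. \<forall>h\<in>H. \<forall>K\<in>T h. \<exists>x r. r > 0 \<and> ball x r \<subseteq> K \<and> diameter K \<le> \<sigma> * r)"

definition max_faces :: "'h set \<Rightarrow> ('h \<Rightarrow> (real ^ 'd) set set) \<Rightarrow> nat" where
  "max_faces H T = Sup {card {F. F facet_of K} | K. K \<in> (\<Union>h\<in>H. T h)}"

text \<open>
  An orientation picks for each face the element on its \<open>+\<close> side; the normal of the face is then the
  unit normal pointing out of that element.
\<close>

definition orientation ::
  "(real ^ 'd) set set \<Rightarrow> ((real ^ 'd) set \<Rightarrow> (real ^ 'd) set) \<Rightarrow> bool" where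
  "orientation T ori \<longleftrightarrow> (\<forall>F\<in>mesh_faces T. ori F \<in> T \<and> F facet_of ori F)"

definition minus_element ::
  "(real ^ 'd) set set \<Rightarrow> ((real ^ 'd) set \<Rightarrow> (real ^ 'd) set) \<Rightarrow> (real ^ 'd) set \<Rightarrow> (real ^ 'd) set" where
  "minus_element T ori F = (THE K. K \<in> T \<and> F facet_of K \<and> K \<noteq> ori F)"

definition outer_normal :: "(real ^ 'd) set \<Rightarrow> (real ^ 'd) set \<Rightarrow> real ^ 'd" where
  "outer_normal K F = (THE n. norm n = 1 \<and> (\<forall>x\<in>F. \<forall>y\<in>F. n \<bullet> (y - x) = 0) \<and>
     (\<forall>x\<in>F. \<forall>y\<in>K. n \<bullet> (y - x) \<le> 0))"

text \<open>
  Surface measure on a subset \<open>F\<close> of a hyperplane: the surface measure of \<open>A \<subseteq> F\<close> is the volume of the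
  right prism over \<open>A\<close> of height 1, which extends by 1/2 to either side of the hyperplane.
  \<^term>\<open>closest_point (affine hull F)\<close> is the orthogonal projection onto the hyperplane.
\<close>

definition surface_measure :: "(real ^ 'd) set \<Rightarrow> (real ^ 'd) measure" where
  "surface_measure F =
     distr (restrict_space lborel {y. closest_point (affine hull F) y \<in> F \<and>
                                      dist y (closest_point (affine hull F) y) \<le> 1 / 2})
           (restrict_space borel F) (closest_point (affine hull F))"

section \<open>Finite element spaces\<close>

definition poly_deg_le :: "nat \<Rightarrow> (real ^ 'd \<Rightarrow> real) \<Rightarrow> bool" where
  "poly_deg_le m p \<longleftrightarrow>
     (\<exists>c. \<forall>x. p x = (\<Sum>\<alpha> | (\<Sum>i\<in>UNIV. \<alpha> i) \<le> m. c \<alpha> * (\<Prod>i\<in>UNIV. (x $ i) ^ \<alpha> i)))"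

text \<open>Polynomial inside each element; the values on the element boundaries are irrelevant.\<close>

definition pw_poly :: "(real ^ 'd) set set \<Rightarrow> nat \<Rightarrow> (real ^ 'd \<Rightarrow> real) \<Rightarrow> bool" where
  "pw_poly T m v \<longleftrightarrow> (\<forall>K\<in>T. \<exists>p. poly_deg_le m p \<and> (\<forall>x\<in>interior K. v x = p x))"

definition fun_subspace :: "('a \<Rightarrow> 'b::real_vector) set \<Rightarrow> bool" where
  "fun_subspace V \<longleftrightarrow> (\<lambda>x. 0) \<in> V \<and> (\<forall>v\<in>V. \<forall>w\<in>V. (\<lambda>x. v x + w x) \<in> V) \<and>
     (\<forall>c. \<forall>v\<in>V. (\<lambda>x. c *\<^sub>R v x) \<in> V)"

definition velocity_space ::
  "(real ^ 'd) set \<Rightarrow> (real ^ 'd) set set \<Rightarrow> nat \<Rightarrow> (real ^ 'd \<Rightarrow> real ^ 'd) set \<Rightarrow> bool" where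
  "velocity_space \<Omega> T m W \<longleftrightarrow>
     fun_subspace W \<and> W \<subseteq> H0_div \<Omega> \<and> (\<forall>w\<in>W. \<forall>i. pw_poly T m (\<lambda>x. w x $ i))"

definition pressure_space ::
  "(real ^ 'd) set \<Rightarrow> (real ^ 'd) set set \<Rightarrow> (real ^ 'd \<Rightarrow> real) set \<Rightarrow> bool" where
  "pressure_space \<Omega> T Q \<longleftrightarrow>
     fun_subspace Q \<and> Q \<subseteq> L2_zero_mean \<Omega> \<and> (\<exists>k. \<forall>q\<in>Q. pw_poly T k q)"

definition discrete_trace_inequality ::
  "'h set \<Rightarrow> ('h \<Rightarrow> (real ^ 'd) set set) \<Rightarrow> nat \<Rightarrow> real \<Rightarrow> bool" where
  "discrete_trace_inequality H T m C \<longleftrightarrow>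
     (\<forall>h\<in>H. \<forall>K\<in>T h. \<forall>F. \<forall>q. F facet_of K \<and> poly_deg_le m q \<longrightarrow>
        sqrt (diameter K) * sqrt (LINT x|surface_measure F. (q x)\<^sup>2) \<le> C * L2_norm K q)"

section \<open>Jumps and averages\<close>

definition trace_from :: "(real ^ 'd) set \<Rightarrow> (real ^ 'd \<Rightarrow> 'b::t2_space) \<Rightarrow> real ^ 'd \<Rightarrow> 'b" where
  "trace_from K \<phi> x = Lim (at x within interior K) \<phi>"

definition jump ::
  "(real ^ 'd) set \<Rightarrow> (real ^ 'd) set set \<Rightarrow> ((real ^ 'd) set \<Rightarrow> (real ^ 'd) set) \<Rightarrow>
   (real ^ 'd) set \<Rightarrow> (real ^ 'd \<Rightarrow> 'b::real_normed_vector) \<Rightarrow> real ^ 'd \<Rightarrow> 'b" where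
  "jump \<Omega> T ori F \<phi> x =
     (if F \<subseteq> frontier \<Omega> then trace_from (ori F) \<phi> x
      else trace_from (ori F) \<phi> x - trace_from (minus_element T ori F) \<phi> x)"

definition avg ::
  "(real ^ 'd) set \<Rightarrow> (real ^ 'd) set set \<Rightarrow> ((real ^ 'd) set \<Rightarrow> (real ^ 'd) set) \<Rightarrow>
   (real ^ 'd) set \<Rightarrow> (real ^ 'd \<Rightarrow> 'b::real_normed_vector) \<Rightarrow> real ^ 'd \<Rightarrow> 'b" where
  "avg \<Omega> T ori F \<phi> x =
     (if F \<subseteq> frontier \<Omega> then trace_from (ori F) \<phi> x
      else (1 / 2) *\<^sub>R (trace_from (ori F) \<phi> x + trace_from (minus_element T ori F) \<phi> x))"

definition face_normal :: "((real ^ 'd) set \<Rightarrow> (real ^ 'd) set) \<Rightarrow> (real ^ 'd) set \<Rightarrow> real ^ 'd" where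
  "face_normal ori F = outer_normal (ori F) F"

text \<open>
  Fields in \<^const>\<open>H0_div\<close> have the same normal component on both sides of a face; it is taken from
  the \<open>+\<close> side.
\<close>

definition normal_component ::
  "((real ^ 'd) set \<Rightarrow> (real ^ 'd) set) \<Rightarrow> (real ^ 'd) set \<Rightarrow> (real ^ 'd \<Rightarrow> real ^ 'd) \<Rightarrow>
   real ^ 'd \<Rightarrow> real" where
  "normal_component ori F \<beta> x = trace_from (ori F) \<beta> x \<bullet> face_normal ori F"

section \<open>Forms and norms\<close>

text \<open>
  \<open>grad_h w x $ i $ j\<close> is the derivative of \<open>w\<^sub>i\<close> in direction \<open>j\<close>. It is meaningful inside the elements, and
  this suffices both for volume integrals and for \<^const>\<open>trace_from\<close>.
\<close>

definition grad_h :: "(real ^ 'd \<Rightarrow> real ^ 'd) \<Rightarrow> real ^ 'd \<Rightarrow> real ^ 'd ^ 'd" where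
  "grad_h w x = jacobian w (at x)"

definition sym_grad_h :: "(real ^ 'd \<Rightarrow> real ^ 'd) \<Rightarrow> real ^ 'd \<Rightarrow> real ^ 'd ^ 'd" where
  "sym_grad_h w x =
     grad_h w x + transpose (grad_h w x) - ((2 / 3) * trace (grad_h w x)) *\<^sub>R mat 1"

definition b_form ::
  "(real ^ 'd) set \<Rightarrow> (real ^ 'd \<Rightarrow> real ^ 'd) \<Rightarrow> (real ^ 'd \<Rightarrow> real) \<Rightarrow> real" where
  "b_form \<Omega> v q = (LINT x:\<Omega>|lebesgue. weak_div \<Omega> v x * q x)"

definition c_form ::
  "(real ^ 'd) set \<Rightarrow> (real ^ 'd) set set \<Rightarrow> ((real ^ 'd) set \<Rightarrow> (real ^ 'd) set) \<Rightarrow> real \<Rightarrow>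
   (real ^ 'd \<Rightarrow> real ^ 'd) \<Rightarrow> (real ^ 'd \<Rightarrow> real ^ 'd) \<Rightarrow> (real ^ 'd \<Rightarrow> real ^ 'd) \<Rightarrow> real" where
  "c_form \<Omega> T ori \<zeta> \<beta> v w =
     (LINT x:\<Omega>|lebesgue. (grad_h v x *v \<beta> x) \<bullet> w x)
     + 1 / 2 * (LINT x:\<Omega>|lebesgue. weak_div \<Omega> \<beta> x * (v x \<bullet> w x))
     - (\<Sum>F\<in>interior_faces \<Omega> T. LINT x|surface_measure F.
          normal_component ori F \<beta> x * (jump \<Omega> T ori F v x \<bullet> avg \<Omega> T ori F w x))
     + \<zeta> * (\<Sum>F\<in>interior_faces \<Omega> T. LINT x|surface_measure F.
          \<bar>normal_component ori F \<beta> x\<bar> * (jump \<Omega> T ori F v x \<bullet> jump \<Omega> T ori F w x))"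

text \<open>On matrices, the inner product \<open>\<bullet>\<close> is the Frobenius product and \<^const>\<open>norm\<close> the Frobenius norm.\<close>

definition a_form ::
  "(real ^ 'd) set \<Rightarrow> (real ^ 'd) set set \<Rightarrow> ((real ^ 'd) set \<Rightarrow> (real ^ 'd) set) \<Rightarrow> real \<Rightarrow>
   (real ^ 'd \<Rightarrow> real ^ 'd) \<Rightarrow> (real ^ 'd \<Rightarrow> real ^ 'd) \<Rightarrow> real" where
  "a_form \<Omega> T ori \<eta> v w =
     (LINT x:\<Omega>|lebesgue. sym_grad_h v x \<bullet> grad_h w x)
     - (\<Sum>F\<in>mesh_faces T. LINT x|surface_measure F.
          jump \<Omega> T ori F v x \<bullet> (avg \<Omega> T ori F (sym_grad_h w) x *v face_normal ori F))
     - (\<Sum>F\<in>mesh_faces T. LINT x|surface_measure F.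
          jump \<Omega> T ori F w x \<bullet> (avg \<Omega> T ori F (sym_grad_h v) x *v face_normal ori F))
     + (\<Sum>F\<in>mesh_faces T. \<eta> / diameter F * (LINT x|surface_measure F.
          jump \<Omega> T ori F v x \<bullet> jump \<Omega> T ori F w x))"

definition sym_norm ::
  "(real ^ 'd) set \<Rightarrow> (real ^ 'd) set set \<Rightarrow> ((real ^ 'd) set \<Rightarrow> (real ^ 'd) set) \<Rightarrow>
   (real ^ 'd \<Rightarrow> real ^ 'd) \<Rightarrow> real" where
  "sym_norm \<Omega> T ori w =
     sqrt ((L2_norm \<Omega> (sym_grad_h w))\<^sup>2
       + (\<Sum>F\<in>mesh_faces T. 1 / diameter F *
            (LINT x|surface_measure F. (norm (jump \<Omega> T ori F w x))\<^sup>2)))"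

definition upwind_seminorm ::
  "(real ^ 'd) set \<Rightarrow> (real ^ 'd) set set \<Rightarrow> ((real ^ 'd) set \<Rightarrow> (real ^ 'd) set) \<Rightarrow> real \<Rightarrow>
   (real ^ 'd \<Rightarrow> real ^ 'd) \<Rightarrow> (real ^ 'd \<Rightarrow> real ^ 'd) \<Rightarrow> real" where
  "upwind_seminorm \<Omega> T ori \<zeta> \<beta> w =
     sqrt (\<zeta> * (\<Sum>F\<in>interior_faces \<Omega> T. LINT x|surface_measure F.
       \<bar>normal_component ori F \<beta> x\<bar> * (norm (jump \<Omega> T ori F w x))\<^sup>2))"

section \<open>The semi-discrete method\<close>

definition L2_absolutely_continuous ::
  "(real ^ 'd) set \<Rightarrow> real \<Rightarrow> real \<Rightarrow> (real \<Rightarrow> real ^ 'd \<Rightarrow> 'b::euclidean_space) \<Rightarrow> bool" where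
  "L2_absolutely_continuous \<Omega> t0 tn u \<longleftrightarrow>
     (\<forall>\<epsilon>>0. \<exists>\<delta>>0. \<forall>(n::nat) a b.
        (\<forall>i<n. t0 \<le> a i \<and> a i \<le> b i \<and> b i \<le> tn) \<and>
        (\<forall>i<n. \<forall>j<n. i \<noteq> j \<longrightarrow> {a i<..<b i} \<inter> {a j<..<b j} = {}) \<and>
        (\<Sum>i<n. b i - a i) < \<delta>
        \<longrightarrow> (\<Sum>i<n. L2_norm \<Omega> (\<lambda>x. u (b i) x - u (a i) x)) < \<epsilon>)"

definition has_L2_derivative ::
  "(real ^ 'd) set \<Rightarrow> (real \<Rightarrow> real ^ 'd \<Rightarrow> 'b::euclidean_space) \<Rightarrow> (real ^ 'd \<Rightarrow> 'b) \<Rightarrow> real \<Rightarrow> bool" where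
  "has_L2_derivative \<Omega> u D t \<longleftrightarrow>
     ((\<lambda>s. L2_norm \<Omega> (\<lambda>x. (1 / (s - t)) *\<^sub>R (u s x - u t x) - D x)) \<longlongrightarrow> 0) (at t)"

definition semidiscrete_solution ::
  "(real ^ 'd) set \<Rightarrow> (real ^ 'd) set set \<Rightarrow> ((real ^ 'd) set \<Rightarrow> (real ^ 'd) set) \<Rightarrow>
   (real ^ 'd \<Rightarrow> real ^ 'd) set \<Rightarrow> (real ^ 'd \<Rightarrow> real) set \<Rightarrow> real \<Rightarrow> real \<Rightarrow> real \<Rightarrow> real \<Rightarrow> real \<Rightarrow>
   (real \<Rightarrow> real ^ 'd \<Rightarrow> real ^ 'd) \<Rightarrow> (real ^ 'd \<Rightarrow> real ^ 'd) \<Rightarrow>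
   (real \<Rightarrow> real ^ 'd \<Rightarrow> real) \<Rightarrow> (real \<Rightarrow> real ^ 'd \<Rightarrow> real ^ 'd) \<Rightarrow> bool" where
  "semidiscrete_solution \<Omega> T ori W Q \<nu> \<eta> \<zeta> t0 tn f u0 p u \<longleftrightarrow>
     (\<forall>t\<in>{t0..tn}. u t \<in> W) \<and> u t0 = u0 \<and> L2_absolutely_continuous \<Omega> t0 tn u \<and>
     (AE t in lebesgue. t \<in> {t0<..<tn} \<longrightarrow>
        p t \<in> Q \<and>
        (\<forall>q\<in>Q. b_form \<Omega> (u t) q = 0) \<and>
        (\<exists>D\<in>W. has_L2_derivative \<Omega> u D t \<and>
           (\<forall>w\<in>W. L2_inner \<Omega> D w + c_form \<Omega> T ori \<zeta> (u t) (u t) w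
                   + \<nu> * a_form \<Omega> T ori \<eta> (u t) w - b_form \<Omega> w (p t)
                 = L2_inner \<Omega> (f t) w)))"

end

theory Submission
  imports Defs
begin

text \<open>
  Testing the momentum equation with \<open>u\<close> removes the pressure, turns the convective form into
  \<open>|u|\<^sub>u\<^sup>2\<close> and gives \<open>(\<parallel>u\<parallel>\<^sup>2/2)' + |u|\<^sub>u\<^sup>2 + \<nu> C \<parallel>u\<parallel>\<^sub>s\<^sub>y\<^sub>m\<^sup>2 \<le> \<parallel>f\<parallel> \<parallel>u\<parallel>\<close> for almost every time. Dividing by
  \<open>(\<parallel>u\<parallel>\<^sup>2 + \<delta>\<^sup>2)\<^sup>1\<^sup>/\<^sup>2\<close> and letting \<open>\<delta> \<rightarrow> 0\<close> bounds \<open>\<parallel>u\<parallel>\<close> by \<open>\<parallel>u\<^sub>0\<parallel> + \<parallel>f\<parallel>\<^sub>L\<^sub>1\<close>; inserting this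
  in the integrated inequality and using Young's inequality gives the claim.

  The identity \<open>c\<^sub>h(\<beta>; w, w) = |w|\<^sub>\<beta>\<^sup>2\<close> needs neither the divergence theorem on simplices nor the continuity
  of normal components as separate facts. The defining property of \<open>H\<^sub>0(div)\<close> is tested, element by
  element, with \<open>|w|\<^sup>2/2\<close> times a \<open>C\<^sup>1\<close> cut-off function which decreases from 1 to 0 in a thin strip along
  each facet. The strip is put on that side of the facet from which the normal component of \<open>\<beta>\<close> is to be
  taken: the \<open>+\<close> side for interior faces, and outside \<open>\<Omega>\<close> for boundary faces.

  Coercivity follows from \<open>D(w) : \<nabla>w \<ge> |D(w)|\<^sup>2/2\<close>, which holds for \<open>d \<le> 3\<close>, and from Young's inequality
  with a parameter \<open>\<epsilon>\<close> such that \<open>1/\<eta> < \<epsilon> < 1/(2 C\<^sub>t\<^sub>r\<^sup>2 N)\<close>, which exists by the assumption on \<open>\<eta>\<close>.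
\<close>

section \<open>The space \<open>L\<^sup>2\<close>\<close>

text \<open>The forcing is only integrable in time, so all identities hold for almost every time,
  and norms have to be recovered from derivatives that exist almost everywhere. Absolute continuity
  makes this possible; the fundamental theorem is proved for it with gauge integrals, where a
  derivative need not be known to be measurable. Two features of the definitions shape the spatial
  part. \<open>weak_div\<close> picks some weak divergence, while the trace condition in
  \<open>H0_div\<close> speaks of a possibly different one, so the two must be identified on each
  element. Face integrals are volume integrals over prisms, so a thin strip along a facet can be
  compared with them by Fubini's theorem alone. Finally, the dissipation has to be integrable in
  time. It contains traces and gradients, whereas u is continuous in time only in L^2; on each
  element polynomials are therefore recovered from finitely many L^2 products, through which their
  values and derivatives inherit the continuity.\<close>

lemma L2_add:
  fixes v w :: "real ^ 'd \<Rightarrow> 'b::euclidean_space"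
  assumes "L2 \<Omega> v" "L2 \<Omega> w"
  shows "L2 \<Omega> (\<lambda>x. v x + w x)"
proof -
  have m: "set_borel_measurable lebesgue \<Omega> (\<lambda>x. v x + w x)"
    using assms unfolding L2_def set_borel_measurable_def
    by (auto simp: scaleR_add_right intro!: borel_measurable_add)
  have i: "set_integrable lebesgue \<Omega> (\<lambda>x. 2 * (norm (v x))\<^sup>2 + 2 * (norm (w x))\<^sup>2)"
    using assms unfolding L2_def by (intro set_integral_add) auto
  have "set_integrable lebesgue \<Omega> (\<lambda>x. (norm (v x + w x))\<^sup>2)"
  proof (rule set_integrable_bound[OF i])
    have "(\<lambda>x. (norm (indicator \<Omega> x *\<^sub>R (v x + w x)))\<^sup>2) \<in> borel_measurable lebesgue"
      using m unfolding set_borel_measurable_def by measurable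
    also have "(\<lambda>x. (norm (indicator \<Omega> x *\<^sub>R (v x + w x)))\<^sup>2) =
        (\<lambda>x. indicator \<Omega> x *\<^sub>R (norm (v x + w x))\<^sup>2)"
      by (auto simp: indicator_def)
    finally show "set_borel_measurable lebesgue \<Omega> (\<lambda>x. (norm (v x + w x))\<^sup>2)"
      unfolding set_borel_measurable_def .
    have "(norm (a + b))\<^sup>2 \<le> 2 * (norm a)\<^sup>2 + 2 * (norm b)\<^sup>2" for a b :: 'b
    proof -
      have "(norm (a + b))\<^sup>2 \<le> (norm a + norm b)\<^sup>2"
        by (intro power_mono norm_triangle_ineq) auto
      also have "\<dots> \<le> 2 * (norm a)\<^sup>2 + 2 * (norm b)\<^sup>2"
        using zero_le_power2[of "norm a - norm b"] by (simp add: power2_eq_square algebra_simps)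
      finally show ?thesis .
    qed
    then show "AE x in lebesgue. x \<in> \<Omega> \<longrightarrow>
        norm ((norm (v x + w x))\<^sup>2) \<le> norm (2 * (norm (v x))\<^sup>2 + 2 * (norm (w x))\<^sup>2)"
      by auto
  qed
  with m show ?thesis unfolding L2_def by blast
qed

lemma L2_scaleR:
  fixes v :: "real ^ 'd \<Rightarrow> 'b::euclidean_space"
  assumes "L2 \<Omega> v"
  shows "L2 \<Omega> (\<lambda>x. c *\<^sub>R v x)"
proof -
  have "(\<lambda>x. c *\<^sub>R (indicator \<Omega> x *\<^sub>R v x)) \<in> borel_measurable lebesgue"
    by (rule borel_measurable_const_scaleR)
      (use assms in \<open>simp add: L2_def set_borel_measurable_def\<close>)
  then have "set_borel_measurable lebesgue \<Omega> (\<lambda>x. c *\<^sub>R v x)"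
    unfolding set_borel_measurable_def by (simp add: mult.commute)
  moreover have "set_integrable lebesgue \<Omega> (\<lambda>x. c\<^sup>2 * (norm (v x))\<^sup>2)"
    using assms unfolding L2_def by auto
  ultimately show ?thesis unfolding L2_def by (simp add: power_mult_distrib)
qed

lemma L2_diff:
  fixes v w :: "real ^ 'd \<Rightarrow> 'b::euclidean_space"
  assumes "L2 \<Omega> v" "L2 \<Omega> w"
  shows "L2 \<Omega> (\<lambda>x. v x - w x)"
  using L2_add[OF assms(1) L2_scaleR[OF assms(2), of "-1"]] by simp

lemma set_borel_measurable_inner:
  fixes v w :: "'a \<Rightarrow> 'b::euclidean_space"
  assumes "set_borel_measurable M \<Omega> v" "set_borel_measurable M \<Omega> w"
  shows "set_borel_measurable M \<Omega> (\<lambda>x. v x \<bullet> w x)"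
proof -
  have "(\<lambda>x. (indicator \<Omega> x *\<^sub>R v x) \<bullet> (indicator \<Omega> x *\<^sub>R w x)) \<in> borel_measurable M"
    using assms unfolding set_borel_measurable_def by measurable
  also have "(\<lambda>x. (indicator \<Omega> x *\<^sub>R v x) \<bullet> (indicator \<Omega> x *\<^sub>R w x)) =
      (\<lambda>x. indicator \<Omega> x *\<^sub>R (v x \<bullet> w x))"
    by (auto simp: indicator_def)
  finally show ?thesis unfolding set_borel_measurable_def .
qed

lemma L2_subset:
  assumes "L2 A v" "B \<in> sets lebesgue" "B \<subseteq> A"
  shows "L2 B v"
  using assms unfolding L2_def by (auto intro: set_integrable_subset set_borel_measurable_subset)

lemma L2_inner_integrable:
  fixes v w :: "real ^ 'd \<Rightarrow> 'b::euclidean_space"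
  assumes "L2 \<Omega> v" "L2 \<Omega> w"
  shows "set_integrable lebesgue \<Omega> (\<lambda>x. v x \<bullet> w x)"
proof (rule set_integrable_bound)
  show "set_integrable lebesgue \<Omega> (\<lambda>x. (norm (v x))\<^sup>2 + (norm (w x))\<^sup>2)"
    using assms unfolding L2_def by (intro set_integral_add) auto
  show "set_borel_measurable lebesgue \<Omega> (\<lambda>x. v x \<bullet> w x)"
    using assms unfolding L2_def by (intro set_borel_measurable_inner) auto
  have "\<bar>a \<bullet> b\<bar> \<le> (norm a)\<^sup>2 + (norm b)\<^sup>2" for a b :: 'b
  proof -
    have "0 \<le> norm a * norm b" "2 * norm a * norm b \<le> (norm a)\<^sup>2 + (norm b)\<^sup>2"
      by (simp_all add: sum_squares_bound)
    with Cauchy_Schwarz_ineq2[of a b] show ?thesis by linarith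
  qed
  then show "AE x in lebesgue. x \<in> \<Omega> \<longrightarrow> norm (v x \<bullet> w x) \<le> norm ((norm (v x))\<^sup>2 + (norm (w x))\<^sup>2)"
    by auto
qed

lemma L2_norm_nonneg [simp]: "0 \<le> L2_norm \<Omega> v"
  unfolding L2_norm_def set_lebesgue_integral_def by (auto intro!: integral_nonneg_AE)

lemma L2_component:
  fixes v :: "real ^ 'd \<Rightarrow> real ^ 'd"
  assumes "L2 A v" 
  shows "L2 A (\<lambda>x. v x $ i)" "L2_norm A (\<lambda>x. v x $ i) \<le> L2_norm A v"
proof -
  have "(\<lambda>x. (indicator A x *\<^sub>R v x) \<bullet> axis i 1) \<in> borel_measurable lebesgue"
    using assms unfolding L2_def set_borel_measurable_def
    by (intro borel_measurable_inner) auto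
  then have m: "set_borel_measurable lebesgue A (\<lambda>x. v x $ i)"
    unfolding set_borel_measurable_def inner_axis by simp
  have le: "(norm (v x $ i))\<^sup>2 \<le> (norm (v x))\<^sup>2" for x
    using component_le_norm_cart[of "v x" i] by (intro power_mono) auto
  have "set_integrable lebesgue A (\<lambda>x. (norm (v x $ i))\<^sup>2)"
  proof (rule set_integrable_bound)
    show "set_integrable lebesgue A (\<lambda>x. (norm (v x))\<^sup>2)" using assms by (simp add: L2_def)
    show "set_borel_measurable lebesgue A (\<lambda>x. (norm (v x $ i))\<^sup>2)"
      using set_borel_measurable_inner[OF m m] by (simp add: power2_eq_square)
  qed (use le in auto)
  with m show L: "L2 A (\<lambda>x. v x $ i)" by (simp add: L2_def)
  show "L2_norm A (\<lambda>x. v x $ i) \<le> L2_norm A v"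
    unfolding L2_norm_def set_lebesgue_integral_def
    using assms L le
    by (intro real_sqrt_le_mono integral_mono) (auto simp: L2_def set_integrable_def indicator_def)
qed

lemma L2_inner_self_nonneg: "0 \<le> L2_inner \<Omega> v v"
  unfolding L2_inner_def set_lebesgue_integral_def by (auto intro!: integral_nonneg_AE)

lemma L2_norm_power2: "(L2_norm \<Omega> v)\<^sup>2 = L2_inner \<Omega> v v"
  using L2_inner_self_nonneg[of \<Omega> v]
  by (simp add: L2_norm_def L2_inner_def dot_square_norm)

lemma L2_inner_commute: "L2_inner \<Omega> v w = L2_inner \<Omega> w v"
  by (simp add: L2_inner_def inner_commute)

lemma L2_inner_add_left:
  assumes "L2 \<Omega> u" "L2 \<Omega> v" "L2 \<Omega> w"
  shows "L2_inner \<Omega> (\<lambda>x. u x + v x) w = L2_inner \<Omega> u w + L2_inner \<Omega> v w"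
  using set_integral_add(2)[OF L2_inner_integrable[OF assms(1,3)] L2_inner_integrable[OF assms(2,3)]]
  by (simp add: L2_inner_def inner_add_left)

lemma L2_inner_diff_left:
  assumes "L2 \<Omega> u" "L2 \<Omega> v" "L2 \<Omega> w"
  shows "L2_inner \<Omega> (\<lambda>x. u x - v x) w = L2_inner \<Omega> u w - L2_inner \<Omega> v w"
  using set_integral_diff(2)[OF L2_inner_integrable[OF assms(1,3)] L2_inner_integrable[OF assms(2,3)]]
  by (simp add: L2_inner_def inner_diff_left)

lemma L2_inner_scaleR_left: "L2_inner \<Omega> (\<lambda>x. c *\<^sub>R v x) w = c * L2_inner \<Omega> v w"
  by (simp add: L2_inner_def)

lemma L2_inner_scaleR_right: "L2_inner \<Omega> v (\<lambda>x. c *\<^sub>R w x) = c * L2_inner \<Omega> v w"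
  by (simp add: L2_inner_def)

lemma L2_inner_add_right:
  assumes "L2 \<Omega> u" "L2 \<Omega> v" "L2 \<Omega> w"
  shows "L2_inner \<Omega> w (\<lambda>x. u x + v x) = L2_inner \<Omega> w u + L2_inner \<Omega> w v"
  using L2_inner_add_left[OF assms] by (simp add: L2_inner_commute)

lemma L2_inner_diff_right:
  assumes "L2 \<Omega> u" "L2 \<Omega> v" "L2 \<Omega> w"
  shows "L2_inner \<Omega> w (\<lambda>x. u x - v x) = L2_inner \<Omega> w u - L2_inner \<Omega> w v"
  using L2_inner_diff_left[OF assms] by (simp add: L2_inner_commute)

text \<open>The form is only semi-definite on functions, so normalising a vector is not an option;
  instead the nonnegativity of (a v - b w, a v - b w) is exploited for suitable numbers a and
  b.\<close>

lemma L2_Cauchy_Schwarz: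
  assumes v: "L2 \<Omega> v" and w: "L2 \<Omega> w"
  shows "\<bar>L2_inner \<Omega> v w\<bar> \<le> L2_norm \<Omega> v * L2_norm \<Omega> w"
proof -
  have q: "0 \<le> a\<^sup>2 * L2_inner \<Omega> v v - 2 * a * b * L2_inner \<Omega> v w + b\<^sup>2 * L2_inner \<Omega> w w" for a b
    using L2_inner_self_nonneg[of \<Omega> "\<lambda>x. a *\<^sub>R v x - b *\<^sub>R w x"]
    by (simp add: L2_inner_diff_left L2_inner_diff_right L2_inner_scaleR_left L2_inner_scaleR_right
        L2_diff L2_scaleR v w L2_inner_commute[of \<Omega> w v] power2_eq_square algebra_simps)
  define A B I where "A = L2_inner \<Omega> v v" and "B = L2_inner \<Omega> w w" and "I = L2_inner \<Omega> v w"
  have AB: "A \<ge> 0" "B \<ge> 0" by (simp_all add: A_def B_def L2_inner_self_nonneg)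
  have "I\<^sup>2 \<le> A * B"
  proof (cases "B = 0")
    case True
    have "I = 0"
    proof (rule ccontr)
      assume "I \<noteq> 0"
      \<comment> \<open>With \<open>B = 0\<close> the quadratic expression is affine in b, and this
        b makes it equal to -A - 2.\<close>
      have "0 \<le> A - 2 * ((A + 1) / I) * I" using q[of 1 "(A + 1) / I"] True
        by (simp add: A_def B_def I_def)
      with \<open>I \<noteq> 0\<close> AB show False by simp
    qed
    with True show ?thesis by simp
  next
    case False
    \<comment> \<open>The choice a = B, b = I turns the quadratic expression into this
      product.\<close>
    have "0 \<le> B * (A * B - I\<^sup>2)"
      using q[of B I] by (simp add: A_def B_def I_def power2_eq_square algebra_simps)
    with False AB show ?thesis by (simp add: zero_le_mult_iff)
  qed
  then have "\<bar>I\<bar>\<^sup>2 \<le> (L2_norm \<Omega> v * L2_norm \<Omega> w)\<^sup>2"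
    by (simp add: A_def B_def power_mult_distrib L2_norm_power2)
  then show ?thesis unfolding I_def by (rule power2_le_imp_le) simp
qed

lemma L2_norm_triangle:
  assumes v: "L2 \<Omega> v" and w: "L2 \<Omega> w"
  shows "L2_norm \<Omega> (\<lambda>x. v x + w x) \<le> L2_norm \<Omega> v + L2_norm \<Omega> w"
proof (rule power2_le_imp_le)
  have "(L2_norm \<Omega> (\<lambda>x. v x + w x))\<^sup>2 =
      (L2_norm \<Omega> v)\<^sup>2 + 2 * L2_inner \<Omega> v w + (L2_norm \<Omega> w)\<^sup>2"
    by (simp add: L2_norm_power2 L2_inner_add_left L2_inner_add_right L2_add v w
        L2_inner_commute[of \<Omega> w v])
  also have "\<dots> \<le> (L2_norm \<Omega> v + L2_norm \<Omega> w)\<^sup>2"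
    using L2_Cauchy_Schwarz[OF v w] by (simp add: power2_eq_square algebra_simps)
  finally show "(L2_norm \<Omega> (\<lambda>x. v x + w x))\<^sup>2 \<le> (L2_norm \<Omega> v + L2_norm \<Omega> w)\<^sup>2" .
qed simp

lemma L2_norm_minus_commute: "L2_norm \<Omega> (\<lambda>x. v x - w x) = L2_norm \<Omega> (\<lambda>x. w x - v x)"
  by (simp add: L2_norm_def norm_minus_commute)

text \<open>Lets the scalar norm inherit absolute continuity and limits from the function
  itself.\<close>

lemma L2_norm_triangle3:
  assumes v: "L2 \<Omega> v" and w: "L2 \<Omega> w"
  shows "\<bar>L2_norm \<Omega> v - L2_norm \<Omega> w\<bar> \<le> L2_norm \<Omega> (\<lambda>x. v x - w x)"
  using L2_norm_triangle[OF w L2_diff[OF v w]] L2_norm_triangle[OF v L2_diff[OF w v]]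
    L2_norm_minus_commute[of \<Omega> v w] by simp

text \<open>
  The difference quotient of \<open>\<parallel>u\<parallel>\<^sup>2\<close> is \<open>2 (q s, u t) + (s - t) \<parallel>q s\<parallel>\<^sup>2\<close>, where \<open>q\<close> is that of \<open>u\<close>.
\<close>

lemma has_L2_derivative_power2_norm:
  fixes u :: "real \<Rightarrow> real ^ 'd \<Rightarrow> 'b::euclidean_space"
  assumes t: "t \<in> {t0<..<tn}" and u: "\<And>s. s \<in> {t0..tn} \<Longrightarrow> L2 \<Omega> (u s)" and D: "L2 \<Omega> D"
    and der: "has_L2_derivative \<Omega> u D t"
  shows "((\<lambda>s. (L2_norm \<Omega> (u s))\<^sup>2) has_real_derivative 2 * L2_inner \<Omega> D (u t)) (at t)"
proof -
  define q where "q s = (\<lambda>x. (1 / (s - t)) *\<^sub>R (u s x - u t x))" for s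
  have ut: "L2 \<Omega> (u t)" using u t by simp
  have ev: "\<forall>\<^sub>F s in at t. s \<in> {t0<..<tn} \<and> s \<noteq> t"
    using t by (intro eventually_conj eventually_at_topological[THEN iffD2])
      (auto intro!: exI[of _ "{t0<..<tn}"])
  have lim: "((\<lambda>s. L2_norm \<Omega> (\<lambda>x. q s x - D x)) \<longlongrightarrow> 0) (at t)"
    using der by (simp add: has_L2_derivative_def q_def)
  have Lq: "L2 \<Omega> (q s)" if "s \<in> {t0<..<tn}" for s
    unfolding q_def using that by (intro L2_scaleR L2_diff u ut) auto
  have lim1: "((\<lambda>s. L2_inner \<Omega> (q s) (u t)) \<longlongrightarrow> L2_inner \<Omega> D (u t)) (at t)"
  proof (rule LIM_zero_cancel, rule Lim_null_comparison)
    show "\<forall>\<^sub>F s in at t. norm (L2_inner \<Omega> (q s) (u t) - L2_inner \<Omega> D (u t)) \<le>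
        L2_norm \<Omega> (\<lambda>x. q s x - D x) * L2_norm \<Omega> (u t)"
      using ev
    proof eventually_elim
      case (elim s)
      then show ?case
        using L2_Cauchy_Schwarz[OF L2_diff[OF Lq D] ut, of s] L2_inner_diff_left[OF Lq D ut, of s]
        by simp
    qed
    show "((\<lambda>s. L2_norm \<Omega> (\<lambda>x. q s x - D x) * L2_norm \<Omega> (u t)) \<longlongrightarrow> 0) (at t)"
      using tendsto_mult_left_zero[OF lim] .
  qed
  \<comment> \<open>Since the norms of the quotients converge, the term carrying the extra factor s
    - t disappears in the limit.\<close>
  have lim2: "((\<lambda>s. L2_norm \<Omega> (q s)) \<longlongrightarrow> L2_norm \<Omega> D) (at t)"
  proof (rule LIM_zero_cancel, rule Lim_null_comparison[OF _ lim])
    show "\<forall>\<^sub>F s in at t. norm (L2_norm \<Omega> (q s) - L2_norm \<Omega> D) \<le> L2_norm \<Omega> (\<lambda>x. q s x - D x)"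
      using ev by eventually_elim (simp add: L2_norm_triangle3 Lq D)
  qed
  have "((\<lambda>s. 2 * L2_inner \<Omega> (q s) (u t) + (s - t) * (L2_norm \<Omega> (q s))\<^sup>2) \<longlongrightarrow>
      2 * L2_inner \<Omega> D (u t) + (t - t) * (L2_norm \<Omega> D)\<^sup>2) (at t)"
    by (intro tendsto_intros lim1 lim2)
  moreover have "\<forall>\<^sub>F s in at t. 2 * L2_inner \<Omega> (q s) (u t) + (s - t) * (L2_norm \<Omega> (q s))\<^sup>2 =
      ((L2_norm \<Omega> (u s))\<^sup>2 - (L2_norm \<Omega> (u t))\<^sup>2) / (s - t)"
    using ev
  proof eventually_elim
    case (elim s)
    then have us: "L2 \<Omega> (u s)" using u by simp
    have "L2_inner \<Omega> (q s) (u t) = (L2_inner \<Omega> (u s) (u t) - L2_inner \<Omega> (u t) (u t)) / (s - t)"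
      by (simp add: q_def L2_inner_scaleR_left L2_inner_diff_left us ut del: scaleR_diff_right)
    moreover have "(L2_norm \<Omega> (q s))\<^sup>2 = (L2_inner \<Omega> (u s) (u s) - 2 * L2_inner \<Omega> (u s) (u t)
        + L2_inner \<Omega> (u t) (u t)) / (s - t)\<^sup>2"
      unfolding L2_norm_power2 by (simp add: q_def L2_inner_scaleR_left L2_inner_scaleR_right
          L2_inner_diff_left L2_inner_diff_right us ut L2_diff L2_inner_commute[of \<Omega> "u t" "u s"]
          power2_eq_square del: scaleR_diff_right)
    \<comment> \<open>X, Y and Z stand for (u s, u t), (u t, u t) and (u s, u s), and r for s -
      t.\<close>
    moreover have "2 * ((X - Y) / r) + r * ((Z - 2 * X + Y) / r\<^sup>2) = (Z - Y) / r"
      if "r \<noteq> 0" for X Y Z r :: real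
      using that by (simp add: field_simps power2_eq_square)
    ultimately show ?case using elim unfolding L2_norm_power2 by simp
  qed
  ultimately have "((\<lambda>s. ((L2_norm \<Omega> (u s))\<^sup>2 - (L2_norm \<Omega> (u t))\<^sup>2) / (s - t)) \<longlongrightarrow>
      2 * L2_inner \<Omega> D (u t)) (at t)"
    by (simp add: tendsto_cong)
  then show ?thesis by (simp add: has_field_derivative_iff)
qed

section \<open>Absolutely continuous functions\<close>

text \<open>The clause of absolute continuity for one fixed pair of \<open>\<epsilon>\<close> and
  \<open>\<delta>\<close>, kept separate so that the same \<open>\<delta>\<close> can be handed from
  one function to another.\<close>

definition variation_le :: "real \<Rightarrow> real \<Rightarrow> (real \<Rightarrow> real) \<Rightarrow> real \<Rightarrow> real \<Rightarrow> bool" where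
  "variation_le a b g \<epsilon> \<delta> \<longleftrightarrow>
     (\<forall>(n::nat) \<alpha> \<beta>.
        (\<forall>i<n. a \<le> \<alpha> i \<and> \<alpha> i \<le> \<beta> i \<and> \<beta> i \<le> b) \<and>
        (\<forall>i<n. \<forall>j<n. i \<noteq> j \<longrightarrow> {\<alpha> i<..<\<beta> i} \<inter> {\<alpha> j<..<\<beta> j} = {}) \<and>
        (\<Sum>i<n. \<beta> i - \<alpha> i) < \<delta>
        \<longrightarrow> (\<Sum>i<n. \<bar>g (\<beta> i) - g (\<alpha> i)\<bar>) < \<epsilon>)"

definition abs_continuous :: "real \<Rightarrow> real \<Rightarrow> (real \<Rightarrow> real) \<Rightarrow> bool" where
  "abs_continuous a b g \<longleftrightarrow> (\<forall>\<epsilon>>0. \<exists>\<delta>>0. variation_le a b g \<epsilon> \<delta>)"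

lemma variation_leI:
  assumes "\<And>(n::nat) \<alpha> \<beta>. (\<And>i. i < n \<Longrightarrow> a \<le> \<alpha> i \<and> \<alpha> i \<le> \<beta> i \<and> \<beta> i \<le> b) \<Longrightarrow>
     (\<And>i j. i < n \<Longrightarrow> j < n \<Longrightarrow> i \<noteq> j \<Longrightarrow> {\<alpha> i<..<\<beta> i} \<inter> {\<alpha> j<..<\<beta> j} = {}) \<Longrightarrow>
     (\<Sum>i<n. \<beta> i - \<alpha> i) < \<delta> \<Longrightarrow> (\<Sum>i<n. \<bar>g (\<beta> i) - g (\<alpha> i)\<bar>) < \<epsilon>"
  shows "variation_le a b g \<epsilon> \<delta>"
  unfolding variation_le_def
proof (intro allI impI, elim conjE)
  fix n :: nat and \<alpha> \<beta>
  assume "\<forall>i<n. a \<le> \<alpha> i \<and> \<alpha> i \<le> \<beta> i \<and> \<beta> i \<le> b"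
    "\<forall>i<n. \<forall>j<n. i \<noteq> j \<longrightarrow> {\<alpha> i<..<\<beta> i} \<inter> {\<alpha> j<..<\<beta> j} = {}" "(\<Sum>i<n. \<beta> i - \<alpha> i) < \<delta>"
  then show "(\<Sum>i<n. \<bar>g (\<beta> i) - g (\<alpha> i)\<bar>) < \<epsilon>" using assms[of n \<alpha> \<beta>] by blast
qed

text \<open>Reindexing along a bijection frees the family of intervals from being numbered; a tagged
  division, which is a set of pairs, can then serve as the index set.\<close>

lemma variation_leD:
  assumes v: "variation_le a b g \<epsilon> \<delta>" and fin: "finite I"
    and ab: "\<And>i. i \<in> I \<Longrightarrow> a \<le> \<alpha> i \<and> \<alpha> i \<le> \<beta> i \<and> \<beta> i \<le> b"
    and disj: "\<And>i j. i \<in> I \<Longrightarrow> j \<in> I \<Longrightarrow> i \<noteq> j \<Longrightarrow> {\<alpha> i<..<\<beta> i} \<inter> {\<alpha> j<..<\<beta> j} = {}"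
    and small: "(\<Sum>i\<in>I. \<beta> i - \<alpha> i) < \<delta>"
  shows "(\<Sum>i\<in>I. \<bar>g (\<beta> i) - g (\<alpha> i)\<bar>) < \<epsilon>"
proof -
  obtain h where h: "bij_betw h {..<card I} I"
    using ex_bij_betw_nat_finite[OF fin] by (auto simp: atLeast0LessThan)
  have re: "(\<Sum>i<card I. f (h i)) = sum f I" for f :: "_ \<Rightarrow> real"
    using sum.reindex_bij_betw[OF h] .
  have hI: "h i \<in> I" if "i < card I" for i using h that by (auto simp: bij_betw_def)
  have hj: "h i \<noteq> h j" if "i < card I" "j < card I" "i \<noteq> j" for i j
    using h that by (auto simp: bij_betw_def inj_on_def)
  have "(\<Sum>i<card I. \<bar>g (\<beta> (h i)) - g (\<alpha> (h i))\<bar>) < \<epsilon>"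
  proof (rule v[unfolded variation_le_def, rule_format], intro conjI allI impI)
    show "(\<Sum>i<card I. \<beta> (h i) - \<alpha> (h i)) < \<delta>" using small re[of "\<lambda>i. \<beta> i - \<alpha> i"] by simp
  next
    fix i j assume "i < card I" "j < card I" "i \<noteq> j"
    then show "{\<alpha> (h i)<..<\<beta> (h i)} \<inter> {\<alpha> (h j)<..<\<beta> (h j)} = {}"
      by (intro disj hI hj)
  qed (use ab hI in auto)
  then show ?thesis using re[of "\<lambda>i. \<bar>g (\<beta> i) - g (\<alpha> i)\<bar>"] by simp
qed

lemma abs_continuous_subinterval:
  assumes g: "abs_continuous a b g" and "b' \<le> b"
  shows "abs_continuous a b' g"
proof -
  have "variation_le a b' g \<epsilon> \<delta>" if v: "variation_le a b g \<epsilon> \<delta>" for \<epsilon> \<delta>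
  proof (rule variation_leI)
    fix n :: nat and \<alpha> \<beta>
    assume A: "\<And>i. i < n \<Longrightarrow> a \<le> \<alpha> i \<and> \<alpha> i \<le> \<beta> i \<and> \<beta> i \<le> b'"
      "\<And>i j. i < n \<Longrightarrow> j < n \<Longrightarrow> i \<noteq> j \<Longrightarrow> {\<alpha> i<..<\<beta> i} \<inter> {\<alpha> j<..<\<beta> j} = {}"
      "(\<Sum>i<n. \<beta> i - \<alpha> i) < \<delta>"
    show "(\<Sum>i<n. \<bar>g (\<beta> i) - g (\<alpha> i)\<bar>) < \<epsilon>"
    proof (rule variation_leD[OF v finite_lessThan])
      show "a \<le> \<alpha> i \<and> \<alpha> i \<le> \<beta> i \<and> \<beta> i \<le> b" if "i \<in> {..<n}" for i
        using A(1)[of i] that assms(2) by simp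
    qed (use A in auto)
  qed
  with g show ?thesis unfolding abs_continuous_def by blast
qed

text \<open>Serves both for sqrt(y^2 + d^2), which is 1-Lipschitz in y, and for y^2, which is
  Lipschitz in y as long as y stays bounded.\<close>

lemma abs_continuous_dominated:
  assumes g: "abs_continuous a b g" and L: "L \<ge> 0"
    and dom: "\<And>s t. s \<in> {a..b} \<Longrightarrow> t \<in> {a..b} \<Longrightarrow> \<bar>f s - f t\<bar> \<le> L * \<bar>g s - g t\<bar>"
  shows "abs_continuous a b f"
proof -
  \<comment> \<open>Dividing by \<open>L + 1\<close> covers \<open>L = 0\<close> and keeps the final
    inequality strict.\<close>
  have "variation_le a b f \<epsilon> \<delta>" if v: "variation_le a b g (\<epsilon> / (L + 1)) \<delta>" and "\<epsilon> > 0" for \<epsilon> \<delta>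
  proof (rule variation_leI)
    fix n :: nat and \<alpha> \<beta>
    assume A: "\<And>i. i < n \<Longrightarrow> a \<le> \<alpha> i \<and> \<alpha> i \<le> \<beta> i \<and> \<beta> i \<le> b"
      "\<And>i j. i < n \<Longrightarrow> j < n \<Longrightarrow> i \<noteq> j \<Longrightarrow> {\<alpha> i<..<\<beta> i} \<inter> {\<alpha> j<..<\<beta> j} = {}"
      "(\<Sum>i<n. \<beta> i - \<alpha> i) < \<delta>"
    have S: "(\<Sum>i<n. \<bar>g (\<beta> i) - g (\<alpha> i)\<bar>) < \<epsilon> / (L + 1)"
      by (rule variation_leD[OF v finite_lessThan]) (use A in auto)
    have "(\<Sum>i<n. \<bar>f (\<beta> i) - f (\<alpha> i)\<bar>) \<le> (\<Sum>i<n. L * \<bar>g (\<beta> i) - g (\<alpha> i)\<bar>)"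
    proof (rule sum_mono)
      fix i assume "i \<in> {..<n}"
      then have "a \<le> \<alpha> i \<and> \<alpha> i \<le> \<beta> i \<and> \<beta> i \<le> b" using A by blast
      then show "\<bar>f (\<beta> i) - f (\<alpha> i)\<bar> \<le> L * \<bar>g (\<beta> i) - g (\<alpha> i)\<bar>" by (intro dom) auto
    qed
    also have "\<dots> = L * (\<Sum>i<n. \<bar>g (\<beta> i) - g (\<alpha> i)\<bar>)" by (simp add: sum_distrib_left)
    also have "\<dots> \<le> L * (\<epsilon> / (L + 1))" using S L by (intro mult_left_mono) auto
    also have "\<dots> < \<epsilon>" using L \<open>\<epsilon> > 0\<close> by (simp add: field_simps)
    finally show "(\<Sum>i<n. \<bar>f (\<beta> i) - f (\<alpha> i)\<bar>) < \<epsilon>" .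
  qed
  moreover have "\<exists>\<delta>>0. variation_le a b g (\<epsilon> / (L + 1)) \<delta>" if "\<epsilon> > 0" for \<epsilon>
    using g that L unfolding abs_continuous_def by simp
  ultimately show ?thesis unfolding abs_continuous_def by meson
qed

text \<open>Disjointness turns the sum of the lengths into the measure of a union, and this union
  lies in \<open>U\<close>.\<close>

lemma sum_lengths_le:
  fixes \<alpha> \<beta> :: "'i \<Rightarrow> real"
  assumes I: "finite I" "\<And>i. i \<in> I \<Longrightarrow> \<alpha> i \<le> \<beta> i \<and> {\<alpha> i<..<\<beta> i} \<subseteq> U"
    "\<And>i j. i \<in> I \<Longrightarrow> j \<in> I \<Longrightarrow> i \<noteq> j \<Longrightarrow> {\<alpha> i<..<\<beta> i} \<inter> {\<alpha> j<..<\<beta> j} = {}"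
    and U: "U \<in> sets lebesgue" "emeasure lebesgue U < ennreal \<delta>"
  shows "(\<Sum>i\<in>I. \<beta> i - \<alpha> i) < \<delta>"
proof -
  have "ennreal (\<Sum>i\<in>I. \<beta> i - \<alpha> i) = (\<Sum>i\<in>I. emeasure lebesgue {\<alpha> i<..<\<beta> i})"
    using I(2) by (subst sum_ennreal[symmetric]) auto
  also have "\<dots> = emeasure lebesgue (\<Union>i\<in>I. {\<alpha> i<..<\<beta> i})"
    using I by (intro sum_emeasure) (auto simp: disjoint_family_on_def)
  also have "\<dots> \<le> emeasure lebesgue U" using I(2) U(1) by (intro emeasure_mono) auto
  also note U(2)
  finally show ?thesis
    using I(2) by (subst (asm) ennreal_less_iff) (auto intro!: sum_nonneg)
qed

text \<open>The tags in the exceptional null set contribute little by absolute continuity, the others by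
  the straddle estimate.\<close>

lemma abs_continuous_has_integral_derivative:
  fixes g :: "real \<Rightarrow> real"
  assumes ab: "a \<le> b" and g: "abs_continuous a b g" and N: "negligible N"
    and der: "\<And>t. t \<in> {a<..<b} - N \<Longrightarrow> (g has_real_derivative g' t) (at t)"
  shows "(g' has_integral (g b - g a)) {a..b}"
proof -
  \<comment> \<open>The end points join the exceptional set because a two-sided derivative is
    assumed only in the open interval.\<close>
  define M where "M = N \<union> {a, b}"
  have M: "negligible M" unfolding M_def using N by auto
  \<comment> \<open>On \<open>M\<close> the values of \<open>g'\<close> carry no information; with
    the value 0 only the increments of \<open>g\<close> remain to be estimated there.\<close>
  define f where "f t = (if t \<in> M then 0 else g' t)" for t
  have "(f has_integral (g b - g a)) (cbox a b)"
    unfolding has_integral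
  proof (intro allI impI)
    fix e :: real assume e: "e > 0"
    obtain \<delta> where \<delta>: "\<delta> > 0" and AC: "variation_le a b g (e / 2) \<delta>"
      using g e unfolding abs_continuous_def by (meson half_gt_zero)
    have Ms: "M \<in> sets lebesgue" "emeasure lebesgue M = 0"
      using M by (auto simp: negligible_iff_null_sets null_sets_def)
    \<comment> \<open>The gauge at tags in \<open>M\<close> stays inside this open set, so the
      intervals with such tags have total length below the \<open>\<delta>\<close> of absolute
      continuity.\<close>
    obtain U where U: "open U" "M \<subseteq> U" "U - M \<in> lmeasurable" "emeasure lebesgue (U - M) < ennreal \<delta>"
      using sets_lebesgue_outer_open[OF Ms(1) \<delta>] by metis
    have Us: "U \<in> sets lebesgue" using U(1) by (simp add: borel_open)
    have "emeasure lebesgue U = emeasure lebesgue (U - M)"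
      using U Ms Us by (subst emeasure_Diff_null_set) (auto simp: null_sets_def)
    with U have Um: "emeasure lebesgue U < ennreal \<delta>" by simp
    \<comment> \<open>Chosen such that \<open>e' * (b - a)\<close> is at most \<open>e / 2\<close>;
      the 1 in the denominator covers \<open>a = b\<close>.\<close>
    define e' where "e' = e / (2 * (b - a) + 1)"
    have e': "e' > 0" using e ab by (simp add: e'_def)
    have "\<exists>d>0. (x \<in> M \<longrightarrow> ball x d \<subseteq> U) \<and>
      (x \<in> {a..b} - M \<longrightarrow> (\<forall>y. \<bar>y - x\<bar> < d \<longrightarrow> \<bar>g y - g x - g' x * (y - x)\<bar> \<le> e' * \<bar>y - x\<bar>))" for x
    proof (cases "x \<in> M")
      case True
      then show ?thesis using U by (meson DiffD2 open_contains_ball subsetD)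
    next
      case False
      show ?thesis
      proof (cases "x \<in> {a..b}")
        case True
        with False have "x \<in> {a<..<b} - N" by (auto simp: M_def)
        then have "(g has_derivative (\<lambda>h. g' x * h)) (at x)"
          using der by (simp add: has_field_derivative_def)
        then obtain d where "d > 0" "\<And>y. norm (y - x) < d \<Longrightarrow>
            norm (g y - g x - g' x * (y - x)) \<le> e' * norm (y - x)"
          unfolding has_derivative_at_alt using e' by blast
        then show ?thesis using False by (intro exI[of _ d]) auto
      next
        case False2: False
        show ?thesis using False False2 by (intro exI[of _ 1]) auto
      qed
    qed
    then obtain d where d: "\<And>x. d x > 0" "\<And>x. x \<in> M \<Longrightarrow> ball x (d x) \<subseteq> U"
      "\<And>x y. x \<in> {a..b} - M \<Longrightarrow> \<bar>y - x\<bar> < d x \<Longrightarrow>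
          \<bar>g y - g x - g' x * (y - x)\<bar> \<le> e' * \<bar>y - x\<bar>"
      by metis
    show "\<exists>\<gamma>. gauge \<gamma> \<and> (\<forall>\<D>. \<D> tagged_division_of cbox a b \<and> \<gamma> fine \<D> \<longrightarrow>
        norm ((\<Sum>(x, k)\<in>\<D>. measure lborel k *\<^sub>R f x) - (g b - g a)) < e)"
    proof (intro exI[of _ "\<lambda>x. ball x (d x)"] conjI allI impI)
      show "gauge (\<lambda>x. ball x (d x))" using d(1) by (auto simp: gauge_def)
      fix \<D> assume "\<D> tagged_division_of cbox a b \<and> (\<lambda>x. ball x (d x)) fine \<D>"
      then have td: "\<D> tagged_division_of {a..b}" and fine: "(\<lambda>x. ball x (d x)) fine \<D>" by auto
      have fin: "finite \<D>" using td by blast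
      have iv: "k = {Inf k..Sup k} \<and> Inf k \<le> x \<and> x \<le> Sup k \<and> a \<le> Inf k \<and> Sup k \<le> b \<and>
          measure lborel k = Sup k - Inf k \<and> {Inf k..Sup k} \<subseteq> ball x (d x) \<and>
          Inf k \<in> ball x (d x) \<and> Sup k \<in> ball x (d x) \<and>
          interior k = {Inf k<..<Sup k} \<and> x \<in> {a..b}" if xk: "(x, k) \<in> \<D>" for x k
      proof -
        obtain u v where k: "k = cbox u v" using tagged_division_ofD(4)[OF td xk] by blast
        have x: "x \<in> k" "k \<subseteq> {a..b}" using tagged_division_ofD(2,3)[OF td that] by auto
        have "k \<subseteq> ball x (d x)" using fine that by (auto simp: fine_def)
        have uv: "u \<le> v" using x k by auto
        then have IS: "Inf k = u" "Sup k = v" by (simp_all add: k)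
        have "interior k = {u<..<v}" "measure lborel k = v - u" "k = {u..v}"
          using uv by (simp_all add: k)
        moreover have "u \<in> ball x (d x)" "v \<in> ball x (d x)"
          using uv \<open>k \<subseteq> ball x (d x)\<close> by (auto simp: k simp del: mem_ball)
        ultimately show ?thesis using x uv \<open>k \<subseteq> ball x (d x)\<close>
          unfolding IS by simp
      qed
      have "(\<Sum>(x, k)\<in>\<D>. g (Sup k) - g (Inf k)) = g b - g a"
        using additive_tagged_division_1[OF ab td, of g] .
      then have "norm ((\<Sum>(x, k)\<in>\<D>. measure lborel k *\<^sub>R f x) - (g b - g a)) =
          \<bar>\<Sum>(x, k)\<in>\<D>. measure lborel k * f x - (g (Sup k) - g (Inf k))\<bar>"
        by (simp add: sum_subtractf case_prod_unfold)
      also have "\<dots> \<le> (\<Sum>(x, k)\<in>\<D>. \<bar>measure lborel k * f x - (g (Sup k) - g (Inf k))\<bar>)"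
        using sum_abs by (simp add: case_prod_unfold)
      also have "\<dots> \<le> (\<Sum>(x, k)\<in>\<D>. e' * measure lborel k + (if x \<in> M then \<bar>g (Sup k) - g (Inf k)\<bar> else 0))"
      proof (rule sum_mono, clarify)
        fix x k assume xk: "(x, k) \<in> \<D>"
        note i = iv[OF xk]
        show "\<bar>measure lborel k * f x - (g (Sup k) - g (Inf k))\<bar> \<le>
            e' * measure lborel k + (if x \<in> M then \<bar>g (Sup k) - g (Inf k)\<bar> else 0)"
        proof (cases "x \<in> M")
          case True
          then show ?thesis using i e' abs_minus_commute[of "g (Sup k)"] by (simp add: f_def)
        next
          case False
          have "Sup k \<in> ball x (d x)" "Inf k \<in> ball x (d x)" using i by blast+
          then have "\<bar>Sup k - x\<bar> < d x" "\<bar>Inf k - x\<bar> < d x"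
            by (auto simp: dist_real_def abs_minus_commute)
          from this[THEN d(3)[rotated]] False i
          have "\<bar>g (Sup k) - g x - g' x * (Sup k - x)\<bar> \<le> e' * \<bar>Sup k - x\<bar>"
            "\<bar>g (Inf k) - g x - g' x * (Inf k - x)\<bar> \<le> e' * \<bar>Inf k - x\<bar>" by auto
          \<comment> \<open>The tag lies in its interval, so the errors on its two sides add up to
            \<open>e'\<close> times exactly the length.\<close>
          moreover have "\<bar>Sup k - x\<bar> = Sup k - x" "\<bar>Inf k - x\<bar> = x - Inf k" using i by auto
          moreover have "measure lborel k * f x - (g (Sup k) - g (Inf k)) =
              (g (Inf k) - g x - g' x * (Inf k - x)) - (g (Sup k) - g x - g' x * (Sup k - x))"
            using False i by (simp add: f_def left_diff_distrib mult.commute[of "g' x"])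
          moreover have "e' * measure lborel k = e' * (Sup k - x) + e' * (x - Inf k)"
            using i by (simp add: right_diff_distrib)
          ultimately show ?thesis using False by simp
        qed
      qed
      also have "\<dots> = e' * (\<Sum>(x, k)\<in>\<D>. measure lborel k) +
          (\<Sum>(x, k)\<in>\<D>. if x \<in> M then \<bar>g (Sup k) - g (Inf k)\<bar> else 0)"
        by (simp add: sum.distrib case_prod_unfold sum_distrib_left)
      also have "(\<Sum>(x, k)\<in>\<D>. measure lborel k) = b - a"
        using additive_content_tagged_division[of \<D> a b] td ab by simp
      also have "(\<Sum>(x, k)\<in>\<D>. if x \<in> M then \<bar>g (Sup k) - g (Inf k)\<bar> else 0) =
          (\<Sum>i\<in>{i\<in>\<D>. fst i \<in> M}. \<bar>g (Sup (snd i)) - g (Inf (snd i))\<bar>)"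
        using fin by (simp add: sum.inter_filter case_prod_unfold)
      also have "\<dots> < e / 2"
      proof (rule variation_leD[OF AC])
        have disj: "{Inf (snd i)<..<Sup (snd i)} \<inter> {Inf (snd j)<..<Sup (snd j)} = {}"
          if "i \<in> \<D>" "j \<in> \<D>" "i \<noteq> j" for i j
          using tagged_division_ofD(5)[OF td, of "fst i" "snd i" "fst j" "snd j"]
            iv[of "fst i" "snd i"] iv[of "fst j" "snd j"] that
          by (metis prod.collapse)
        then show "\<And>i j. i \<in> {i \<in> \<D>. fst i \<in> M} \<Longrightarrow> j \<in> {i \<in> \<D>. fst i \<in> M} \<Longrightarrow> i \<noteq> j \<Longrightarrow>
          {Inf (snd i)<..<Sup (snd i)} \<inter> {Inf (snd j)<..<Sup (snd j)} = {}" by blast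
        show "(\<Sum>i\<in>{i \<in> \<D>. fst i \<in> M}. Sup (snd i) - Inf (snd i)) < \<delta>"
        proof (rule sum_lengths_le[OF _ _ _ Us Um])
          fix i assume "i \<in> {i \<in> \<D>. fst i \<in> M}"
          then show "Inf (snd i) \<le> Sup (snd i) \<and> {Inf (snd i)<..<Sup (snd i)} \<subseteq> U"
            using iv[of "fst i" "snd i"] d(2)[of "fst i"]
              greaterThanLessThan_subseteq_atLeastAtMost_iff[of "Inf (snd i)" "Sup (snd i)"]
            by (simp, meson order.trans order_refl)
        qed (use fin disj in auto)
      qed (use fin iv in fastforce)+
      finally have "norm ((\<Sum>(x, k)\<in>\<D>. measure lborel k *\<^sub>R f x) - (g b - g a)) < e' * (b - a) + e / 2"
        by simp
      also have "e' * (b - a) \<le> e / 2"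
        using e ab by (simp add: e'_def field_simps)
      finally show "norm ((\<Sum>(x, k)\<in>\<D>. measure lborel k *\<^sub>R f x) - (g b - g a)) < e" by simp
    qed
  qed
  then have "(f has_integral (g b - g a)) {a..b}" by simp
  then show ?thesis
    by (rule has_integral_spike[OF M, rotated]) (simp add: f_def)
qed

text \<open>Only the majorant is known to be Lebesgue integrable. The derivative is integrated in
  the gauge sense, and both integrals are compared in that sense.\<close>

lemma abs_continuous_increment_le:
  fixes g k :: "real \<Rightarrow> real"
  assumes ab: "a \<le> b" and g: "abs_continuous a b g"
    and der: "AE t in lebesgue. t \<in> {a<..<b} \<longrightarrow>
      (\<exists>g'. (g has_real_derivative g') (at t) \<and> g' \<le> k t)"
    and k: "set_integrable lebesgue {a..b} k"
  shows "g b - g a \<le> (LINT t:{a..b}|lebesgue. k t)"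
proof -
  obtain N where N: "N \<in> null_sets lebesgue"
    "\<And>t. t \<in> space lebesgue - N \<Longrightarrow>
      t \<in> {a<..<b} \<longrightarrow> (\<exists>g'. (g has_real_derivative g') (at t) \<and> g' \<le> k t)"
    using AE_E3[OF der] by metis
  then have "\<forall>t. \<exists>g'. t \<in> {a<..<b} - N \<longrightarrow> (g has_real_derivative g') (at t) \<and> g' \<le> k t" by auto
  then obtain g' where g': "\<And>t. t \<in> {a<..<b} - N \<Longrightarrow> (g has_real_derivative g' t) (at t) \<and> g' t \<le> k t"
    by metis
  have negl: "negligible N" using N by (simp add: negligible_iff_null_sets)
  have 1: "(g' has_integral (g b - g a)) {a..b}"
    using abs_continuous_has_integral_derivative[OF ab g negl, of g'] g' by blast
  define M where "M = N \<union> {a, b}"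
  have M: "negligible M" using negl by (simp add: M_def)
  have "(k has_integral (LINT t:{a..b}|lebesgue. k t)) {a..b}"
    using has_integral_set_lebesgue[OF k] .
  \<comment> \<open>On the exceptional set the majorant is replaced by \<open>g'\<close> itself,
    which makes the comparison valid at every point.\<close>
  then have 2: "((\<lambda>t. if t \<in> M then g' t else k t) has_integral (LINT t:{a..b}|lebesgue. k t)) {a..b}"
    by (rule has_integral_spike[OF M, rotated]) simp
  show ?thesis
    by (rule has_integral_le[OF 1 2]) (use g' in \<open>auto simp: M_def\<close>)
qed

text \<open>To be read with y the norm of the solution, \<open>\<phi>\<close> the norm of the
  forcing, \<open>R\<close> the dissipation and e the product of the time derivative with the
  solution. The hypothesis speaks of y^2 because the square is what is known to be
  differentiable.\<close>

lemma energy_estimate: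
  fixes y \<phi> R :: "real \<Rightarrow> real"
  assumes t: "t0 \<le> tn" and y: "abs_continuous t0 tn y" and y0: "\<And>t. 0 \<le> y t"
    and der: "AE t in lebesgue. t \<in> {t0<..<tn} \<longrightarrow>
      (\<exists>e. ((\<lambda>s. (y s)\<^sup>2) has_real_derivative 2 * e) (at t) \<and> e + R t \<le> \<phi> t * y t)"
    and \<phi>: "set_integrable lebesgue {t0..tn} \<phi>" "\<And>t. 0 \<le> \<phi> t"
    and R: "set_integrable lebesgue {t0..tn} R" "\<And>t. 0 \<le> R t"
  shows "1 / 2 * (y tn)\<^sup>2 + (LINT t:{t0..tn}|lebesgue. R t) \<le>
    (y t0)\<^sup>2 + 3 / 2 * (LINT t:{t0..tn}|lebesgue. \<phi> t)\<^sup>2"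
proof -
  define F where "F = (LINT t:{t0..tn}|lebesgue. \<phi> t)"
  have F: "0 \<le> F"
    unfolding F_def set_lebesgue_integral_def using \<phi>(2) by (auto intro!: integral_nonneg_AE)
  define B where "B = y t0 + F"
  have B: "0 \<le> B" using F y0 by (simp add: B_def)
  have bound: "y \<tau> \<le> B" if \<tau>: "\<tau> \<in> {t0..tn}" for \<tau>
  proof (rule field_le_epsilon)
    fix \<delta> :: real assume \<delta>: "\<delta> > 0"
    \<comment> \<open>\<open>y\<close> may fail to be differentiable at its zeros; \<open>z\<close>
      is differentiable wherever the square of \<open>y\<close> is, because its radicand stays
      positive.\<close>
    define z where "z s = sqrt ((y s)\<^sup>2 + \<delta>\<^sup>2)" for s
    have zpos: "z s > 0" for s using \<delta> by (simp add: z_def add_nonneg_pos)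
    have yz: "y s \<le> z s" for s using y0[of s] by (simp add: z_def real_le_rsqrt)
    \<comment> \<open>\<open>z s\<close> is the Euclidean norm of the pair
      \<open>(y s, \<delta>)\<close>, so this is the reverse triangle inequality in the
      plane.\<close>
    have "\<bar>z s - z t\<bar> \<le> 1 * \<bar>y s - y t\<bar>" for s t
      using norm_triangle_ineq3[of "(y s, \<delta>)" "(y t, \<delta>)"] by (simp add: z_def norm_Pair)
    then have "abs_continuous t0 tn z" by (intro abs_continuous_dominated[OF y, of 1]) auto
    then have z: "abs_continuous t0 \<tau> z" by (rule abs_continuous_subinterval) (use \<tau> in simp)
    have \<phi>\<tau>: "set_integrable lebesgue {t0..\<tau>} \<phi>"
      by (rule set_integrable_subset[OF \<phi>(1)]) (use \<tau> in auto)
    have "z \<tau> - z t0 \<le> (LINT t:{t0..\<tau>}|lebesgue. \<phi> t)"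
    proof (rule abs_continuous_increment_le[OF _ z _ \<phi>\<tau>])
      show "AE t in lebesgue. t \<in> {t0<..<\<tau>} \<longrightarrow> (\<exists>g'. (z has_real_derivative g') (at t) \<and> g' \<le> \<phi> t)"
        using der
      proof eventually_elim
        case (elim t)
        show ?case
        proof
          assume "t \<in> {t0<..<\<tau>}"
          then obtain e where e: "((\<lambda>s. (y s)\<^sup>2) has_real_derivative 2 * e) (at t)"
            "e + R t \<le> \<phi> t * y t"
            using elim \<tau> by auto
          have "((\<lambda>s. (y s)\<^sup>2 + \<delta>\<^sup>2) has_real_derivative 2 * e) (at t)"
            using DERIV_add[OF e(1) DERIV_const] by simp
          then have "(z has_real_derivative (inverse (z t) / 2) * (2 * e)) (at t)"
            unfolding z_def using zpos[of t]
            by (intro DERIV_chain2[OF DERIV_real_sqrt]) (simp_all add: z_def)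
          moreover have "e \<le> \<phi> t * z t"
            using e(2) R(2)[of t] mult_left_mono[OF yz[of t] \<phi>(2)[of t]] by linarith
          then have "e / z t \<le> \<phi> t" using zpos[of t] by (simp add: field_simps)
          ultimately show "\<exists>g'. (z has_real_derivative g') (at t) \<and> g' \<le> \<phi> t"
            by (intro exI[of _ "e / z t"]) (simp add: field_simps)
        qed
      qed
    qed (use \<tau> in auto)
    also have "\<dots> \<le> F"
      unfolding F_def set_lebesgue_integral_def
      by (rule integral_mono)
        (use \<phi> \<phi>\<tau> \<tau> in \<open>auto simp: set_integrable_def indicator_def\<close>)
    finally have "z \<tau> \<le> z t0 + F" by simp
    moreover have "z t0 \<le> y t0 + \<delta>"
      using y0[of t0] \<delta> by (simp add: z_def real_le_lsqrt power2_sum)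
    ultimately show "y \<tau> \<le> B + \<delta>" using yz[of \<tau>] by (simp add: B_def)
  qed
  \<comment> \<open>The pointwise bound on \<open>y\<close> makes squaring Lipschitz on its
    range.\<close>
  have "abs_continuous t0 tn (\<lambda>s. (y s)\<^sup>2)"
  proof (rule abs_continuous_dominated[OF y, of "2 * B"])
    fix s t assume "s \<in> {t0..tn}" "t \<in> {t0..tn}"
    then have "\<bar>y s + y t\<bar> \<le> 2 * B" using bound[of s] bound[of t] y0[of s] y0[of t] by simp
    then have "\<bar>y s + y t\<bar> * \<bar>y s - y t\<bar> \<le> 2 * B * \<bar>y s - y t\<bar>" by (rule mult_right_mono) simp
    then show "\<bar>(y s)\<^sup>2 - (y t)\<^sup>2\<bar> \<le> 2 * B * \<bar>y s - y t\<bar>"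
      by (simp add: square_diff_square_factored power2_eq_square abs_mult)
  qed (use B in simp)
  moreover have "AE t in lebesgue. t \<in> {t0<..<tn} \<longrightarrow>
      (\<exists>g'. ((\<lambda>s. (y s)\<^sup>2) has_real_derivative g') (at t) \<and> g' \<le> 2 * (\<phi> t * B) - 2 * R t)"
    using der
  proof eventually_elim
    case (elim t)
    show ?case
    proof
      assume t: "t \<in> {t0<..<tn}"
      then obtain e where e: "((\<lambda>s. (y s)\<^sup>2) has_real_derivative 2 * e) (at t)"
        "e + R t \<le> \<phi> t * y t"
        using elim by auto
      have "\<phi> t * y t \<le> \<phi> t * B" using t by (intro mult_left_mono bound \<phi>(2)) auto
      with e show "\<exists>g'. ((\<lambda>s. (y s)\<^sup>2) has_real_derivative g') (at t) \<and> g' \<le> 2 * (\<phi> t * B) - 2 * R t"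
        by (intro exI[of _ "2 * e"]) simp
    qed
  qed
  ultimately have "(y tn)\<^sup>2 - (y t0)\<^sup>2 \<le> (LINT t:{t0..tn}|lebesgue. 2 * (\<phi> t * B) - 2 * R t)"
    using \<phi> R t by (intro abs_continuous_increment_le) auto
  also have "\<dots> = 2 * (F * B) - 2 * (LINT t:{t0..tn}|lebesgue. R t)"
    using \<phi> R by (subst set_integral_diff) (auto simp: F_def)
  finally have "1 / 2 * (y tn)\<^sup>2 + (LINT t:{t0..tn}|lebesgue. R t) \<le> 1 / 2 * (y t0)\<^sup>2 + F * B" by simp
  \<comment> \<open>Since \<open>B = y t0 + F\<close>, the only mixed term is
    \<open>y t0 * F\<close>, which is at most half the sum of the squares; this yields the constants
    1 and 3/2.\<close>
  also have "\<dots> \<le> (y t0)\<^sup>2 + 3 / 2 * F\<^sup>2"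
    using zero_le_power2[of "y t0 - F"] by (simp add: B_def power2_eq_square algebra_simps)
  finally show ?thesis unfolding F_def .
qed

section \<open>From L^2-valued functions of time to scalar ones\<close>

lemma L2_absolutely_continuous_norm:
  assumes u: "L2_absolutely_continuous \<Omega> t0 tn u" and L: "\<And>t. t \<in> {t0..tn} \<Longrightarrow> L2 \<Omega> (u t)"
  shows "abs_continuous t0 tn (\<lambda>t. L2_norm \<Omega> (u t))"
  unfolding abs_continuous_def
proof (intro allI impI)
  fix \<epsilon> :: real assume "\<epsilon> > 0"
  then obtain \<delta> where "\<delta> > 0" and \<delta>: "\<forall>(n::nat) a b.
        (\<forall>i<n. t0 \<le> a i \<and> a i \<le> b i \<and> b i \<le> tn) \<and>
        (\<forall>i<n. \<forall>j<n. i \<noteq> j \<longrightarrow> {a i<..<b i} \<inter> {a j<..<b j} = {}) \<and>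
        (\<Sum>i<n. b i - a i) < \<delta>
        \<longrightarrow> (\<Sum>i<n. L2_norm \<Omega> (\<lambda>x. u (b i) x - u (a i) x)) < \<epsilon>"
    using u[unfolded L2_absolutely_continuous_def, rule_format, OF \<open>\<epsilon> > 0\<close>] by (elim exE conjE)
  have "variation_le t0 tn (\<lambda>t. L2_norm \<Omega> (u t)) \<epsilon> \<delta>"
  proof (rule variation_leI)
    fix n :: nat and a b
    assume A: "\<And>i. i < n \<Longrightarrow> t0 \<le> a i \<and> a i \<le> b i \<and> b i \<le> tn"
      "\<And>i j. i < n \<Longrightarrow> j < n \<Longrightarrow> i \<noteq> j \<Longrightarrow> {a i<..<b i} \<inter> {a j<..<b j} = {}"
      "(\<Sum>i<n. b i - a i) < \<delta>"
    have "(\<Sum>i<n. \<bar>L2_norm \<Omega> (u (b i)) - L2_norm \<Omega> (u (a i))\<bar>) \<le>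
        (\<Sum>i<n. L2_norm \<Omega> (\<lambda>x. u (b i) x - u (a i) x))"
    proof (rule sum_mono)
      fix i assume "i \<in> {..<n}"
      then have "t0 \<le> a i \<and> a i \<le> b i \<and> b i \<le> tn" using A(1) by simp
      then show "\<bar>L2_norm \<Omega> (u (b i)) - L2_norm \<Omega> (u (a i))\<bar> \<le> L2_norm \<Omega> (\<lambda>x. u (b i) x - u (a i) x)"
        by (intro L2_norm_triangle3 L) auto
    qed
    also have "\<dots> < \<epsilon>" using A by (intro \<delta>[rule_format]) simp
    finally show "(\<Sum>i<n. \<bar>L2_norm \<Omega> (u (b i)) - L2_norm \<Omega> (u (a i))\<bar>) < \<epsilon>" .
  qed
  with \<open>\<delta> > 0\<close> show "\<exists>\<delta>>0. variation_le t0 tn (\<lambda>t. L2_norm \<Omega> (u t)) \<epsilon> \<delta>" by blast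
qed

lemma L2_absolutely_continuous_tendsto:
  assumes u: "L2_absolutely_continuous \<Omega> t0 tn u" and s: "s \<in> {t0..tn}"
  shows "((\<lambda>t. L2_norm \<Omega> (\<lambda>x. u t x - u s x)) \<longlongrightarrow> 0) (at s within {t0..tn})"
proof (rule tendstoI)
  fix \<epsilon> :: real assume "\<epsilon> > 0"
  then obtain \<delta> where "\<delta> > 0" and \<delta>: "\<forall>(n::nat) a b.
        (\<forall>i<n. t0 \<le> a i \<and> a i \<le> b i \<and> b i \<le> tn) \<and>
        (\<forall>i<n. \<forall>j<n. i \<noteq> j \<longrightarrow> {a i<..<b i} \<inter> {a j<..<b j} = {}) \<and>
        (\<Sum>i<n. b i - a i) < \<delta>
        \<longrightarrow> (\<Sum>i<n. L2_norm \<Omega> (\<lambda>x. u (b i) x - u (a i) x)) < \<epsilon>"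
    using u[unfolded L2_absolutely_continuous_def, rule_format, OF \<open>\<epsilon> > 0\<close>] by (elim exE conjE)
  have "L2_norm \<Omega> (\<lambda>x. u t x - u s x) < \<epsilon>" if t: "t \<in> {t0..tn}" "dist t s < \<delta>" for t
    \<comment> \<open>A single interval with ends \<open>min s t\<close> and \<open>max s t\<close>
      serves as the family.\<close>
    using \<delta>[rule_format, of 1 "\<lambda>_. min s t" "\<lambda>_. max s t"] s t L2_norm_minus_commute[of \<Omega> "u s" "u t"]
    by (cases "s \<le> t") (auto simp: dist_real_def min_def max_def)
  then show "\<forall>\<^sub>F t in at s within {t0..tn}. dist (L2_norm \<Omega> (\<lambda>x. u t x - u s x)) 0 < \<epsilon>"
    using \<open>\<delta> > 0\<close> by (auto simp: eventually_at dist_real_def intro!: exI[of _ \<delta>])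
qed

section \<open>Polynomials\<close>

text \<open>Sums over infinite index sets are 0 by convention, so the sum in
  \<open>poly_deg_le\<close> means what it should only because of this finiteness.\<close>

lemma finite_multiindices: "finite {\<alpha> :: 'd::finite \<Rightarrow> nat. (\<Sum>i\<in>UNIV. \<alpha> i) \<le> m}"
proof (rule finite_subset)
  show "{\<alpha> :: 'd \<Rightarrow> nat. (\<Sum>i\<in>UNIV. \<alpha> i) \<le> m} \<subseteq>
      {\<alpha>. \<forall>i. (i \<in> UNIV \<longrightarrow> \<alpha> i \<in> {..m}) \<and> (i \<notin> UNIV \<longrightarrow> \<alpha> i = 0)}"
  proof (clarify, intro conjI impI)
    fix \<alpha> :: "'d \<Rightarrow> nat" and i assume "(\<Sum>i\<in>UNIV. \<alpha> i) \<le> m"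
    then show "\<alpha> i \<in> {..m}" using member_le_sum[of i UNIV \<alpha>] by simp
  qed simp
  show "finite {\<alpha> :: 'd \<Rightarrow> nat. \<forall>i. (i \<in> UNIV \<longrightarrow> \<alpha> i \<in> {..m}) \<and> (i \<notin> UNIV \<longrightarrow> \<alpha> i = 0)}"
    by (rule finite_set_of_finite_funs) auto
qed

lemma poly_deg_le_monomial:
  fixes \<alpha> :: "'d::finite \<Rightarrow> nat"
  assumes "(\<Sum>i\<in>UNIV. \<alpha> i) \<le> m"
  shows "poly_deg_le m (\<lambda>x. \<Prod>i\<in>UNIV. (x $ i) ^ \<alpha> i)"
  unfolding poly_deg_le_def
proof (intro exI allI)
  fix x :: "real ^ 'd"
  have "(\<Sum>\<beta> | (\<Sum>i\<in>UNIV. \<beta> i) \<le> m. (if \<beta> = \<alpha> then 1 else 0) * (\<Prod>i\<in>UNIV. (x $ i) ^ \<beta> i)) =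
      (\<Sum>\<beta> | (\<Sum>i\<in>UNIV. \<beta> i) \<le> m. if \<beta> = \<alpha> then (\<Prod>i\<in>UNIV. (x $ i) ^ \<beta> i) else 0)"
    by (intro sum.cong) auto
  also have "\<dots> = (\<Prod>i\<in>UNIV. (x $ i) ^ \<alpha> i)"
    using assms by (subst sum.delta[OF finite_multiindices]) simp
  finally show "(\<Prod>i\<in>UNIV. (x $ i) ^ \<alpha> i) =
      (\<Sum>\<beta> | (\<Sum>i\<in>UNIV. \<beta> i) \<le> m. (if \<beta> = \<alpha> then 1 else 0) * (\<Prod>i\<in>UNIV. (x $ i) ^ \<beta> i))"
    by simp
qed

lemma poly_deg_le_add:
  assumes "poly_deg_le m p" "poly_deg_le m q"
  shows "poly_deg_le m (\<lambda>x. p x + q x)"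
proof -
  obtain c where "\<forall>x. p x = (\<Sum>\<alpha> | (\<Sum>i\<in>UNIV. \<alpha> i) \<le> m. c \<alpha> * (\<Prod>i\<in>UNIV. (x $ i) ^ \<alpha> i))"
    using assms(1) unfolding poly_deg_le_def ..
  moreover obtain d where "\<forall>x. q x = (\<Sum>\<alpha> | (\<Sum>i\<in>UNIV. \<alpha> i) \<le> m. d \<alpha> * (\<Prod>i\<in>UNIV. (x $ i) ^ \<alpha> i))"
    using assms(2) unfolding poly_deg_le_def ..
  ultimately show ?thesis unfolding poly_deg_le_def
    by (intro exI[of _ "\<lambda>\<alpha>. c \<alpha> + d \<alpha>"]) (simp add: sum.distrib distrib_right)
qed

lemma poly_deg_le_cmult:
  assumes "poly_deg_le m p"
  shows "poly_deg_le m (\<lambda>x. k * p x)"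
proof -
  obtain c where "\<forall>x. p x = (\<Sum>\<alpha> | (\<Sum>i\<in>UNIV. \<alpha> i) \<le> m. c \<alpha> * (\<Prod>i\<in>UNIV. (x $ i) ^ \<alpha> i))"
    using assms unfolding poly_deg_le_def ..
  then show ?thesis unfolding poly_deg_le_def
    by (intro exI[of _ "\<lambda>\<alpha>. k * c \<alpha>"]) (simp add: sum_distrib_left mult.assoc)
qed

lemma poly_deg_le_zero: "poly_deg_le m (\<lambda>x. 0)"
  unfolding poly_deg_le_def by (intro exI[of _ "\<lambda>\<alpha>. 0"]) simp

lemma poly_deg_le_sum:
  assumes "\<And>i. i \<in> I \<Longrightarrow> poly_deg_le m (p i)"
  shows "poly_deg_le m (\<lambda>x. \<Sum>i\<in>I. p i x)"
  using assms by (induction I rule: infinite_finite_induct)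
    (simp_all add: poly_deg_le_zero poly_deg_le_add)

lemma poly_deg_le_diff:
  assumes "poly_deg_le m p" "poly_deg_le m q"
  shows "poly_deg_le m (\<lambda>x. p x - q x)"
  using poly_deg_le_add[OF assms(1) poly_deg_le_cmult[OF assms(2), of "-1"]] by simp

text \<open>The derivative is expressed by monomials again, so that its degree can be read off.
  Subtraction on exponents is truncated; for \<open>\<alpha> i = 0\<close> the factor
  \<open>real (\<alpha> i)\<close> removes the term.\<close>

lemma has_derivative_monomial:
  fixes \<alpha> :: "'d::finite \<Rightarrow> nat"
  shows "((\<lambda>x. \<Prod>i\<in>UNIV. (x $ i) ^ \<alpha> i) has_derivative
     (\<lambda>h. \<Sum>i\<in>UNIV. h $ i * (real (\<alpha> i) * (\<Prod>j\<in>UNIV. (x $ j) ^ (\<alpha>(i := \<alpha> i - 1)) j)))) (at x)"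
proof -
  have "((\<lambda>x. \<Prod>i\<in>UNIV. (x $ i) ^ \<alpha> i) has_derivative
     (\<lambda>h. \<Sum>i\<in>UNIV. (real (\<alpha> i) * (x $ i) ^ (\<alpha> i - 1) * h $ i) * (\<Prod>j\<in>UNIV - {i}. (x $ j) ^ \<alpha> j))) (at x)"
  proof (rule has_derivative_prod)
    fix i :: 'd
    show "((\<lambda>x. (x $ i) ^ \<alpha> i) has_derivative (\<lambda>h. real (\<alpha> i) * (x $ i) ^ (\<alpha> i - 1) * h $ i)) (at x)"
      by (auto intro!: derivative_eq_intros bounded_linear_vec_nth[THEN bounded_linear.has_derivative]
          simp: fun_eq_iff algebra_simps)
  qed
  moreover have "(real (\<alpha> i) * (x $ i) ^ (\<alpha> i - 1) * h) * (\<Prod>j\<in>UNIV - {i}. (x $ j) ^ \<alpha> j) =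
      h * (real (\<alpha> i) * (\<Prod>j\<in>UNIV. (x $ j) ^ (\<alpha>(i := \<alpha> i - 1)) j))" for i h
  proof -
    have "(\<Prod>j\<in>UNIV. (x $ j) ^ (\<alpha>(i := \<alpha> i - 1)) j) =
        (x $ i) ^ (\<alpha> i - 1) * (\<Prod>j\<in>UNIV - {i}. (x $ j) ^ (\<alpha>(i := \<alpha> i - 1)) j)"
      by (subst prod.remove[of _ i]) auto
    also have "(\<Prod>j\<in>UNIV - {i}. (x $ j) ^ (\<alpha>(i := \<alpha> i - 1)) j) = (\<Prod>j\<in>UNIV - {i}. (x $ j) ^ \<alpha> j)"
      by (intro prod.cong) auto
    finally show ?thesis by simp
  qed
  ultimately show ?thesis by (simp only:)
qed

text \<open>The components are placed in degree \<open>m\<close> rather than \<open>m - 1\<close>: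
  this is the degree for which the trace inequality is available, and gradients are inserted
  there.\<close>

lemma poly_deg_le_gradient:
  fixes p :: "real ^ 'd \<Rightarrow> real"
  assumes "poly_deg_le m p"
  shows "\<exists>G. (\<forall>x. GDERIV p x :> G x) \<and> (\<forall>i. poly_deg_le m (\<lambda>x. G x $ i))"
proof -
  obtain c where c: "p = (\<lambda>x. \<Sum>\<alpha> | (\<Sum>i\<in>UNIV. \<alpha> i) \<le> m. c \<alpha> * (\<Prod>i\<in>UNIV. (x $ i) ^ \<alpha> i))"
    using assms unfolding poly_deg_le_def by blast
  define g where "g \<alpha> i x = real (\<alpha> i) * (\<Prod>j\<in>UNIV. (x $ j) ^ (\<alpha>(i := \<alpha> i - 1)) j)"
    for \<alpha> :: "'d \<Rightarrow> nat" and i and x :: "real ^ 'd"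
  define G where "G x = (\<chi> i. \<Sum>\<alpha> | (\<Sum>i\<in>UNIV. \<alpha> i) \<le> m. c \<alpha> * g \<alpha> i x)" for x
  have "GDERIV p x :> G x" for x
  proof -
    have "(p has_derivative (\<lambda>h. \<Sum>\<alpha> | (\<Sum>i\<in>UNIV. \<alpha> i) \<le> m. c \<alpha> * (\<Sum>i\<in>UNIV. h $ i * g \<alpha> i x))) (at x)"
      unfolding c g_def
      by (intro has_derivative_sum has_derivative_mult_right has_derivative_monomial)
    also have "(\<lambda>h. \<Sum>\<alpha> | (\<Sum>i\<in>UNIV. \<alpha> i) \<le> m. c \<alpha> * (\<Sum>i\<in>UNIV. h $ i * g \<alpha> i x)) = (\<lambda>h. h \<bullet> G x)"
      unfolding G_def inner_vec_def
      by (simp add: sum_distrib_left mult.left_commute fun_eq_iff sum.swap[of _ UNIV])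
    finally show ?thesis unfolding gderiv_def .
  qed
  moreover have "poly_deg_le m (\<lambda>x. G x $ i)" for i
    unfolding G_def vec_lambda_beta
  proof (rule poly_deg_le_sum)
    fix \<alpha> :: "'d \<Rightarrow> nat" assume a: "\<alpha> \<in> {\<alpha>. (\<Sum>i\<in>UNIV. \<alpha> i) \<le> m}"
    have "(\<Sum>j\<in>UNIV. (\<alpha>(i := \<alpha> i - 1)) j) \<le> (\<Sum>j\<in>UNIV. \<alpha> j)" by (intro sum_mono) auto
    with a show "poly_deg_le m (\<lambda>x. c \<alpha> * g \<alpha> i x)"
      unfolding g_def by (intro poly_deg_le_cmult poly_deg_le_monomial) auto
  qed
  ultimately show ?thesis by blast
qed

lemma GDERIV_isCont: "GDERIV f x :> D \<Longrightarrow> isCont f x"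
  unfolding gderiv_def by (rule has_derivative_continuous)

lemma poly_deg_le_continuous_on:
  assumes "poly_deg_le m p"
  shows "continuous_on A p"
  using poly_deg_le_gradient[OF assms] by (metis GDERIV_isCont continuous_at_imp_continuous_on)

section \<open>Reproducing families of polynomials on a compact set\<close>

lemma set_integrable_continuous_compact:
  fixes f :: "'a::euclidean_space \<Rightarrow> 'b::euclidean_space"
  assumes "compact K" "continuous_on K f"
  shows "set_integrable lebesgue K f"
proof -
  have "integrable lborel (\<lambda>x. indicator K x *\<^sub>R f x)"
    using borel_integrable_compact[OF assms] .
  then show ?thesis
    unfolding set_integrable_def by (subst integrable_completion) auto
qed

lemma L2_continuous:
  fixes f :: "real ^ 'd \<Rightarrow> 'b::euclidean_space"
  assumes K: "compact K" and f: "continuous_on K f"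
  shows "L2 K f"
  unfolding L2_def
proof
  show "set_borel_measurable lebesgue K f"
    using set_integrable_continuous_compact[OF assms]
    unfolding set_integrable_def set_borel_measurable_def by auto
  show "set_integrable lebesgue K (\<lambda>x. (norm (f x))\<^sup>2)"
    by (intro set_integrable_continuous_compact K continuous_intros f)
qed

lemma L2_inner_cong:
  assumes "K \<in> sets lebesgue" "\<And>x. x \<in> K \<Longrightarrow> v x = v' x" "\<And>x. x \<in> K \<Longrightarrow> w x = w' x"
  shows "L2_inner K v w = L2_inner K v' w'"
  unfolding L2_inner_def using assms by (intro set_lebesgue_integral_cong) auto

lemma L2_inner_sum_left:
  assumes "finite I" "\<And>i. i \<in> I \<Longrightarrow> L2 K (f i)" "L2 K w"
  shows "L2 K (\<lambda>x. \<Sum>i\<in>I. c i *\<^sub>R f i x) \<and>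
    L2_inner K (\<lambda>x. \<Sum>i\<in>I. c i *\<^sub>R f i x) w = (\<Sum>i\<in>I. c i * L2_inner K (f i) w)"
  using assms(1,2)
proof (induction I rule: finite_induct)
  case empty
  have "L2 K (\<lambda>x. 0 *\<^sub>R w x)" by (intro L2_scaleR assms)
  then show ?case by (simp add: L2_inner_def)
next
  case (insert a F)
  then show ?case
    using L2_inner_add_left[of K "\<lambda>x. c a *\<^sub>R f a x" "\<lambda>x. \<Sum>i\<in>F. c i *\<^sub>R f i x" w] assms(3)
    by (auto intro!: L2_add L2_scaleR simp: L2_inner_scaleR_left)
qed

text \<open>A nonzero value at a point of \<open>K\<close>, even at a boundary point, spreads to an
  open set. This set meets the interior because \<open>K\<close> lies in the closure of its
  interior, and nonempty open sets are not negligible.\<close>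

lemma continuous_L2_null_imp_zero:
  fixes r :: "real ^ 'd \<Rightarrow> real"
  assumes K: "compact K" "K \<subseteq> closure (interior K)" and r: "continuous_on UNIV r"
    and null: "L2_inner K r r = 0" and x: "x \<in> K"
  shows "r x = 0"
proof (rule ccontr)
  assume "r x \<noteq> 0"
  define U where "U = {y. r y \<noteq> 0}"
  have U: "open U" unfolding U_def using r by (intro open_Collect_neq continuous_on_const)
  have "x \<in> U \<inter> closure (interior K)" using \<open>r x \<noteq> 0\<close> x K by (auto simp: U_def)
  then have ne: "U \<inter> interior K \<noteq> {}" using U by (metis IntE closure_iff_nhds_not_empty inf_commute empty_iff open_Int_closure_eq_empty IntI)
  have "L2 K r" by (intro L2_continuous K continuous_on_subset[OF r]) auto
  then have int: "integrable lebesgue (\<lambda>x. indicator K x *\<^sub>R (r x * r x))"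
    using L2_inner_integrable[of K r r] by (simp add: set_integrable_def)
  have "(LINT x|lebesgue. indicator K x *\<^sub>R (r x * r x)) = 0"
    using null by (simp add: L2_inner_def set_lebesgue_integral_def)
  then have "AE x in lebesgue. indicator K x *\<^sub>R (r x * r x) = 0"
    using int by (subst (asm) integral_nonneg_eq_0_iff_AE) auto
  then have "AE x in lebesgue. x \<notin> U \<inter> interior K"
    by eventually_elim (use interior_subset in \<open>auto simp: U_def indicator_def\<close>)
  then have "negligible (U \<inter> interior K)"
    using AE_iff_null_sets[of "U \<inter> interior K" lebesgue] U
    by (simp add: negligible_iff_null_sets borel_open del: Int_iff)
  with ne U show False by (meson open_Int open_interior open_not_negligible)
qed

text \<open>Gram--Schmidt; functions that vanish almost everywhere on \<open>K\<close> are dropped.\<close>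

lemma finite_span_reproducing:
  fixes A :: "(real ^ 'd \<Rightarrow> real) set"
  assumes K: "compact K" "K \<subseteq> closure (interior K)"
    and A: "finite A" "\<And>a. a \<in> A \<Longrightarrow> continuous_on UNIV a"
  shows "\<exists>R. finite R \<and> (\<forall>o'\<in>R. \<exists>c. o' = (\<lambda>x. \<Sum>a\<in>A. c a * a x)) \<and>
    (\<forall>c. \<forall>x\<in>K. (\<Sum>a\<in>A. c a * a x) =
       (\<Sum>o'\<in>R. L2_inner K (\<lambda>x. \<Sum>a\<in>A. c a * a x) o' * o' x))"
  using A
proof (induction A rule: finite_induct)
  case empty
  then show ?case by (intro exI[of _ "{}"]) auto
next
  case (insert a A)
  define sp where "sp B = {v. \<exists>c. v = (\<lambda>x. \<Sum>b\<in>B. c b * b x)}" for B :: "(real ^ 'd \<Rightarrow> real) set"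
  have Ks: "K \<in> sets lebesgue" using K by (auto intro: fmeasurableD lmeasurable_compact)
  obtain O' where O': "finite O'" "O' \<subseteq> sp A"
    and rep0: "\<forall>c. \<forall>x\<in>K. (\<Sum>a\<in>A. c a * a x) = (\<Sum>o'\<in>O'. L2_inner K (\<lambda>x. \<Sum>a\<in>A. c a * a x) o' * o' x)"
    using insert.IH insert.prems unfolding sp_def by blast
  have rep: "v x = (\<Sum>o'\<in>O'. L2_inner K v o' * o' x)" if "v \<in> sp A" "x \<in> K" for v x
    using that rep0 unfolding sp_def by auto
  have cA: "continuous_on UNIV v" if "v \<in> sp A" for v
    using that insert.prems unfolding sp_def by (auto intro!: continuous_intros)
  have ca: "continuous_on UNIV a" using insert.prems by simp
  have cO: "continuous_on UNIV v" if "v \<in> O'" for v using that O' cA by auto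
  have L: "L2 K v" if "continuous_on UNIV v" for v :: "real ^ 'd \<Rightarrow> real"
    by (intro L2_continuous K continuous_on_subset[OF that]) auto
  define P where "P = (\<lambda>x. \<Sum>o'\<in>O'. L2_inner K a o' * o' x)"
  define r where "r = (\<lambda>x. a x - P x)"
  have cP: "continuous_on UNIV P" unfolding P_def by (intro continuous_intros cO)
  have cr: "continuous_on UNIV r" unfolding r_def by (intro continuous_intros ca cP)
  have ipP: "L2_inner K (\<lambda>x. \<Sum>o'\<in>O'. c o' * o' x) w = (\<Sum>o'\<in>O'. c o' * L2_inner K o' w)"
    if "continuous_on UNIV w" for w :: "real ^ 'd \<Rightarrow> real" and c
    using L2_inner_sum_left[OF O'(1), of K "\<lambda>o'. o'" w c] L[OF cO] L[OF that] by simp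
  \<comment> \<open>By the reproducing formula for the span of \<open>A\<close>, both (v, a) and (v,
    P) equal the sum of the products (v, o') (o', a).\<close>
  have orth: "L2_inner K v r = 0" if v: "v \<in> sp A" for v
  proof -
    have "L2_inner K v r = L2_inner K v a - L2_inner K v P"
      unfolding r_def by (intro L2_inner_diff_right L ca cP cA[OF v])
    also have "L2_inner K v P = (\<Sum>o'\<in>O'. L2_inner K a o' * L2_inner K o' v)"
      using ipP[OF cA[OF v]] L2_inner_commute[of K v P] unfolding P_def by simp
    also have "L2_inner K v a = L2_inner K (\<lambda>x. \<Sum>o'\<in>O'. L2_inner K v o' * o' x) a"
      using rep[OF v] by (intro L2_inner_cong Ks) auto
    also have "\<dots> = (\<Sum>o'\<in>O'. L2_inner K v o' * L2_inner K o' a)" by (rule ipP[OF ca])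
    finally show ?thesis by (simp add: L2_inner_commute[of K _ a] L2_inner_commute[of K _ v] mult.commute)
  qed
  have split: "\<exists>v\<in>sp A. (\<lambda>x. \<Sum>b\<in>insert a A. c b * b x) = (\<lambda>x. v x + c a * a x)" for c
    using insert.hyps by (intro bexI[of _ "\<lambda>x. \<Sum>b\<in>A. c b * b x"]) (auto simp: sp_def)
  have spI: "(\<lambda>x. v x + k * a x) \<in> sp (insert a A)" if v: "v \<in> sp A" for v k
  proof -
    obtain c where c: "v = (\<lambda>x. \<Sum>b\<in>A. c b * b x)" using v unfolding sp_def by blast
    have "(\<Sum>b\<in>A. (c(a := k)) b * b x) = (\<Sum>b\<in>A. c b * b x)" for x
      using insert.hyps by (intro sum.cong) auto
    then show ?thesis using insert.hyps
      unfolding sp_def c by (intro CollectI exI[of _ "c(a := k)"]) (simp add: fun_eq_iff)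
  qed
  have O'ins: "O' \<subseteq> sp (insert a A)" using spI[of _ 0] O' by auto
  \<comment> \<open>Both cases below reduce to the formula for \<open>v + k a\<close> with
    \<open>v\<close> in the span of \<open>A\<close>. The invariant of the induction is the formula
    itself rather than orthonormality.\<close>
  have goal: ?case if Q: "finite Q" "Q \<subseteq> sp (insert a A)" and
    q: "\<And>v k x. v \<in> sp A \<Longrightarrow> x \<in> K \<Longrightarrow>
      v x + k * a x = (\<Sum>o'\<in>Q. L2_inner K (\<lambda>x. v x + k * a x) o' * o' x)" for Q
  proof (intro exI[of _ Q] conjI Q(1) ballI allI)
    fix c x assume "x \<in> K"
    obtain v where "v \<in> sp A" and v: "(\<lambda>x. \<Sum>b\<in>insert a A. c b * b x) = (\<lambda>x. v x + c a * a x)"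
      using split by blast
    then show "(\<Sum>b\<in>insert a A. c b * b x) =
        (\<Sum>o'\<in>Q. L2_inner K (\<lambda>x. \<Sum>b\<in>insert a A. c b * b x) o' * o' x)"
      using q[of v x "c a"] \<open>x \<in> K\<close> fun_cong[OF v, of x] unfolding v by simp
  qed (use Q(2) in \<open>auto simp: sp_def\<close>)
  have ipv: "L2_inner K (\<lambda>x. v x + k * a x) w = L2_inner K v w + k * L2_inner K a w"
    if "v \<in> sp A" "continuous_on UNIV w" for v k w
    using L2_inner_add_left[of K v "\<lambda>x. k *\<^sub>R a x" w] L[OF cA[OF that(1)]] L[OF that(2)] L[OF ca]
      L2_inner_scaleR_left[of K k a w]
    by (simp add: L2_scaleR[OF L[OF ca], of k, simplified])
  define N where "N = L2_inner K r r"
  show ?case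
  proof (cases "N = 0")
    case True
    then have "r x = 0" if "x \<in> K" for x
      using continuous_L2_null_imp_zero[OF K cr _ that] by (simp add: N_def)
    \<comment> \<open>On \<open>K\<close> the new function is already a combination of the old ones,
      so the family stays as it is.\<close>
    then have aP: "a x = P x" if "x \<in> K" for x using that by (auto simp: r_def)
    show ?thesis
    proof (rule goal[OF O'(1) O'ins])
      fix v k x assume v: "v \<in> sp A" "x \<in> K"
      have "(\<Sum>o'\<in>O'. L2_inner K (\<lambda>x. v x + k * a x) o' * o' x) =
          (\<Sum>o'\<in>O'. L2_inner K v o' * o' x + k * (L2_inner K a o' * o' x))"
        by (intro sum.cong refl) (simp add: ipv[OF v(1) cO] algebra_simps)
      also have "\<dots> = v x + k * P x"
        using rep[OF v] by (simp add: sum.distrib sum_distrib_left P_def)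
      finally show "v x + k * a x = (\<Sum>o'\<in>O'. L2_inner K (\<lambda>x. v x + k * a x) o' * o' x)"
        using aP[OF v(2)] by simp
    qed
  next
    case False
    then have N: "N > 0" using L2_inner_self_nonneg[of K r] by (simp add: N_def)
    define e where "e = (\<lambda>x. (1 / sqrt N) * r x)"
    have ce: "continuous_on UNIV e" unfolding e_def by (intro continuous_intros cr)
    have ipe: "L2_inner K w e = L2_inner K w r / sqrt N" for w by (simp add: L2_inner_def e_def)
    have er: "L2_inner K e r = sqrt N" using N
      by (simp add: e_def L2_inner_def N_def[unfolded L2_inner_def, simplified, symmetric] real_div_sqrt)
    \<comment> \<open>All members of \<open>O'\<close> are orthogonal to \<open>r\<close>, whereas
      (e, r) is \<open>sqrt N > 0\<close>. Hence the sum over the enlarged family really gains a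
      term.\<close>
    have eO: "e \<notin> O'" using er orth[of e] O' N by auto
    have PA: "P \<in> sp A"
    proof -
      have "\<forall>o'\<in>O'. \<exists>c. o' = (\<lambda>x. \<Sum>b\<in>A. c b * b x)" using O'(2) unfolding sp_def by blast
      then obtain c where c: "\<And>o'. o' \<in> O' \<Longrightarrow> o' = (\<lambda>x. \<Sum>b\<in>A. c o' b * b x)" by metis
      have "P x = (\<Sum>b\<in>A. (\<Sum>o'\<in>O'. L2_inner K a o' * c o' b) * b x)" for x
      proof -
        have "P x = (\<Sum>o'\<in>O'. L2_inner K a o' * (\<Sum>b\<in>A. c o' b * b x))"
          unfolding P_def using c by (intro sum.cong refl) (metis (no_types, lifting))
        also have "\<dots> = (\<Sum>b\<in>A. (\<Sum>o'\<in>O'. L2_inner K a o' * c o' b) * b x)"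
          by (simp add: sum_distrib_left sum_distrib_right mult.assoc) (rule sum.swap)
        finally show ?thesis .
      qed
      then have "P = (\<lambda>x. \<Sum>b\<in>A. (\<Sum>o'\<in>O'. L2_inner K a o' * c o' b) * b x)" by (rule ext)
      then show ?thesis unfolding sp_def
        by (intro CollectI exI[of _ "\<lambda>b. \<Sum>o'\<in>O'. L2_inner K a o' * c o' b"])
    qed
    have neg: "(\<lambda>x. k * v x) \<in> sp A" if vA: "v \<in> sp A" for k v
    proof -
      obtain c where c: "v = (\<lambda>x. \<Sum>b\<in>A. c b * b x)" using vA unfolding sp_def by blast
      show ?thesis unfolding sp_def c
        by (intro CollectI exI[of _ "\<lambda>b. k * c b"]) (simp add: sum_distrib_left mult.assoc)
    qed
    have "e \<in> sp (insert a A)"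
      using spI[OF neg[OF PA, of "- 1 / sqrt N"], of "1 / sqrt N"]
      by (simp add: e_def r_def diff_divide_distrib)
    have ar: "L2_inner K a r = N"
      using L2_inner_diff_left[OF L[OF ca] L[OF cP] L[OF cr]] orth[OF PA] by (simp add: N_def r_def)
    show ?thesis
    proof (rule goal[of "insert e O'"])
      show "insert e O' \<subseteq> sp (insert a A)" using \<open>e \<in> sp (insert a A)\<close> O'ins by blast
      fix v k x assume v: "v \<in> sp A" "x \<in> K"
      have "(\<Sum>o'\<in>O'. L2_inner K (\<lambda>x. v x + k * a x) o' * o' x) =
          (\<Sum>o'\<in>O'. L2_inner K v o' * o' x + k * (L2_inner K a o' * o' x))"
        by (intro sum.cong refl) (simp add: ipv[OF v(1) cO] algebra_simps)
      also have "\<dots> = v x + k * P x"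
        using rep[OF v] by (simp add: sum.distrib sum_distrib_left P_def)
      finally have "(\<Sum>o'\<in>O'. L2_inner K (\<lambda>x. v x + k * a x) o' * o' x) = v x + k * P x" .
      moreover have "L2_inner K (\<lambda>x. v x + k * a x) e * e x = k * r x"
        using N unfolding ipv[OF v(1) ce] ipe orth[OF v(1)] ar by (simp add: e_def)
      ultimately show "v x + k * a x = (\<Sum>o'\<in>insert e O'. L2_inner K (\<lambda>x. v x + k * a x) o' * o' x)"
        using O'(1) eO by (simp add: r_def algebra_simps)
    qed (use O' in simp)
  qed
qed

text \<open>Point evaluation becomes a finite combination of values of \<open>L2_inner\<close>,
  which is the form in which convergence in L^2 controls polynomials pointwise on
  \<open>K\<close>.\<close>

lemma poly_deg_le_reproducing:
  fixes K :: "(real ^ 'd) set"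
  assumes K: "compact K" "K \<subseteq> closure (interior K)"
  obtains R where "finite R" "\<And>q. q \<in> R \<Longrightarrow> poly_deg_le m q"
    "\<And>p x. poly_deg_le m p \<Longrightarrow> x \<in> K \<Longrightarrow> p x = (\<Sum>q\<in>R. L2_inner K p q * q x)"
proof -
  define M where "M = (\<lambda>\<alpha> (x :: real ^ 'd). \<Prod>i\<in>UNIV. (x $ i) ^ \<alpha> i) ` {\<alpha>. (\<Sum>i\<in>UNIV. \<alpha> i) \<le> m}"
  have M: "finite M" "\<And>a. a \<in> M \<Longrightarrow> poly_deg_le m a"
    unfolding M_def using finite_multiindices poly_deg_le_monomial by auto
  have span: "\<exists>d. p = (\<lambda>x. \<Sum>a\<in>M. d a * a x)" if p: "poly_deg_le m p" for p :: "real ^ 'd \<Rightarrow> real"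
  proof -
    obtain c where c: "\<forall>x. p x = (\<Sum>\<alpha> | (\<Sum>i\<in>UNIV. \<alpha> i) \<le> m. c \<alpha> * (\<Prod>i\<in>UNIV. (x $ i) ^ \<alpha> i))"
      using p unfolding poly_deg_le_def ..
    define h where "h = (\<lambda>\<alpha> (x :: real ^ 'd). \<Prod>i\<in>UNIV. (x $ i) ^ \<alpha> i)"
    define I where "I = {\<alpha> :: 'd \<Rightarrow> nat. (\<Sum>i\<in>UNIV. \<alpha> i) \<le> m}"
    have I: "finite I" "M = h ` I" unfolding I_def M_def h_def by (simp_all add: finite_multiindices)
    \<comment> \<open>\<open>M\<close> is a set of functions, so the coefficients of all
      multi-indices that give the same function are collected; distinctness of the monomials need
      not be argued.\<close>
    have "p x = (\<Sum>a\<in>M. (\<Sum>\<alpha> | \<alpha> \<in> I \<and> h \<alpha> = a. c \<alpha>) * a x)" for x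
    proof -
      have "p x = (\<Sum>\<alpha>\<in>I. c \<alpha> * h \<alpha> x)" using c unfolding I_def h_def by blast
      also have "\<dots> = (\<Sum>a\<in>h ` I. \<Sum>\<alpha> | \<alpha> \<in> I \<and> h \<alpha> = a. c \<alpha> * h \<alpha> x)"
        by (rule sum.image_gen[OF I(1)])
      also have "\<dots> = (\<Sum>a\<in>M. (\<Sum>\<alpha> | \<alpha> \<in> I \<and> h \<alpha> = a. c \<alpha>) * a x)"
        unfolding I(2) sum_distrib_right by (intro sum.cong refl) auto
      finally show ?thesis .
    qed
    then have "p = (\<lambda>x. \<Sum>a\<in>M. (\<Sum>\<alpha> | \<alpha> \<in> I \<and> h \<alpha> = a. c \<alpha>) * a x)" by (rule ext)
    then show ?thesis by (rule exI[of _ "\<lambda>a. \<Sum>\<alpha> | \<alpha> \<in> I \<and> h \<alpha> = a. c \<alpha>"])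
  qed
  obtain R where R: "finite R" "\<forall>o'\<in>R. \<exists>c. o' = (\<lambda>x. \<Sum>a\<in>M. c a * a x)"
    "\<forall>c. \<forall>x\<in>K. (\<Sum>a\<in>M. c a * a x) =
       (\<Sum>o'\<in>R. L2_inner K (\<lambda>x. \<Sum>a\<in>M. c a * a x) o' * o' x)"
    using finite_span_reproducing[OF K M(1)] poly_deg_le_continuous_on[OF M(2)] by blast
  show thesis
  proof (rule that[OF R(1)])
    show "poly_deg_le m q" if "q \<in> R" for q
    proof -
      obtain c where q: "q = (\<lambda>x. \<Sum>a\<in>M. c a * a x)" using R(2) \<open>q \<in> R\<close> by blast
      show ?thesis unfolding q by (intro poly_deg_le_sum poly_deg_le_cmult M(2))
    qed
    show "p x = (\<Sum>q\<in>R. L2_inner K p q * q x)" if p: "poly_deg_le m p" and x: "x \<in> K" for p x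
    proof -
      obtain d where d: "p = (\<lambda>x. \<Sum>a\<in>M. d a * a x)" using span[OF p] by blast
      show ?thesis using R(3) x unfolding d by blast
    qed
  qed
qed

section \<open>Facets of a polytope\<close>

text \<open>For a facet every point gives the same number, because the normal is orthogonal to all
  differences of points of \<open>F\<close>.\<close>

definition facet_offset :: "(real ^ 'd) set \<Rightarrow> (real ^ 'd) set \<Rightarrow> real" where
  "facet_offset K F = outer_normal K F \<bullet> (SOME x. x \<in> F)"

text \<open>Signed distance from the hyperplane of a facet, positive on the side of
  \<open>K\<close>.\<close>

definition facet_dist :: "(real ^ 'd) set \<Rightarrow> (real ^ 'd) set \<Rightarrow> real ^ 'd \<Rightarrow> real" where
  "facet_dist K F x = facet_offset K F - outer_normal K F \<bullet> x"

text \<open>Let w be the component of n orthogonal to a. Both \<open>b *\<^sub>R a\<close> and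
  \<open>b *\<^sub>R a + w\<close> lie on the first hyperplane, hence on the second, so n is
  orthogonal to w; this forces w = 0.\<close>

lemma unit_normal_eq:
  fixes a n :: "real ^ 'd"
  assumes a: "norm a = 1" and n: "norm n = 1" and sub: "{x. a \<bullet> x = b} \<subseteq> {x. n \<bullet> x = c}"
  shows "n = a \<or> n = - a"
proof -
  define k where "k = n \<bullet> a"
  define w where "w = n - (n \<bullet> a) *\<^sub>R a"
  have aa: "a \<bullet> a = 1" "n \<bullet> n = 1" using a n by (simp_all add: dot_square_norm)
  have aw: "a \<bullet> w = 0" by (simp add: w_def inner_diff_right aa inner_commute)
  have "a \<bullet> (b *\<^sub>R a) = b" "a \<bullet> (b *\<^sub>R a + w) = b" using aw aa by (simp_all add: inner_add_right)
  with sub have "n \<bullet> (b *\<^sub>R a) = c" "n \<bullet> (b *\<^sub>R a + w) = c"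
    by (metis (mono_tags, lifting) mem_Collect_eq subsetD)+
  then have "n \<bullet> w = 0" by (simp add: inner_add_right)
  then have "w \<bullet> w = 0" using aw by (simp add: w_def inner_diff_left inner_commute)
  then have eq: "n = k *\<^sub>R a" by (simp add: w_def k_def)
  have "n \<bullet> n = k\<^sup>2 * (a \<bullet> a)" unfolding eq by (simp add: power2_eq_square)
  then have "k = 1 \<or> k = -1" using aa by (simp add: power2_eq_1_iff)
  with eq show ?thesis by auto
qed

locale convex_body =
  fixes K :: "(real ^ 'd) set"
  assumes polytope: "polytope K" and interior_nonempty: "interior K \<noteq> {}"
begin

lemma polyhedron: "polyhedron K" and convex: "convex K" and compact: "compact K" and
  closed: "closed K"
  using polytope by (auto simp: polytope_imp_polyhedron polytope_imp_convex polytope_imp_compact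
      polytope_imp_closed)

lemma closure_interior: "closure (interior K) = K"
  using convex_closure_interior[OF convex interior_nonempty] closed by simp

lemma finite_facets: "finite {F. F facet_of K}"
  by (rule finite_polyhedron_facets[OF polyhedron])

lemma aff_dim_eq: "aff_dim K = int CARD('d)"
  using interior_nonempty affine_hull_nonempty_interior aff_dim_eq_full[of K] by auto

text \<open>The definite description in \<open>outer_normal\<close> is resolved by the normalised
  supporting functional of the facet. A dimension count makes the affine hull of \<open>F\<close>
  the full hyperplane, so a competing normal can differ only in sign, and an interior point of
  \<open>K\<close> decides the sign.\<close>

lemma facet_hyperplane:
  assumes F: "F facet_of K"
  shows "norm (outer_normal K F) = 1"
    and "\<And>x. x \<in> K \<Longrightarrow> outer_normal K F \<bullet> x \<le> facet_offset K F"
    and "F = K \<inter> {x. outer_normal K F \<bullet> x = facet_offset K F}"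
    and "affine hull F = {x. outer_normal K F \<bullet> x = facet_offset K F}"
proof -
  obtain a0 b0 where a0: "a0 \<noteq> 0" "K \<subseteq> {x. a0 \<bullet> x \<le> b0}" "F = K \<inter> {x. a0 \<bullet> x = b0}"
    using facet_of_polyhedron[OF polyhedron F] .
  define a b where "a = a0 /\<^sub>R norm a0" and "b = b0 / norm a0"
  have a: "norm a = 1" using a0 by (simp add: a_def)
  have le: "a \<bullet> x \<le> b \<longleftrightarrow> a0 \<bullet> x \<le> b0" and eq: "a \<bullet> x = b \<longleftrightarrow> a0 \<bullet> x = b0" for x
    using a0(1) by (simp_all add: a_def b_def field_simps)
  have Kle: "a \<bullet> x \<le> b" if "x \<in> K" for x using a0 that le by auto
  have Feq: "F = K \<inter> {x. a \<bullet> x = b}" using a0(3) eq by simp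
  have "F \<noteq> {}" using F by (simp add: facet_of_def)
  have aff: "affine hull F = {x. a \<bullet> x = b}"
  proof -
    have sub: "affine hull F \<subseteq> {x. a \<bullet> x = b}"
      using Feq by (intro hull_minimal affine_hyperplane) auto
    have "a \<noteq> 0" using a by auto
    have "aff_dim F = int CARD('d) - 1" using F aff_dim_eq by (simp add: facet_of_def)
    also have "\<dots> = aff_dim {x. a \<bullet> x = b}" using \<open>a \<noteq> 0\<close> by (simp add: aff_dim_hyperplane)
    finally have "affine hull F = affine hull {x. a \<bullet> x = b}"
      using aff_dim_eq_full_gen[of F "{x. a \<bullet> x = b}"] Feq by auto
    then show ?thesis by (simp add: affine_hyperplane affine_hull_eq)
  qed
  obtain z where z: "z \<in> interior K" using interior_nonempty by auto
  have zlt: "a \<bullet> z < b"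
  proof -
    have "interior K \<subseteq> interior {x. a \<bullet> x \<le> b}" using Kle by (intro interior_mono) auto
    moreover have "a \<noteq> 0" using a by auto
    ultimately show ?thesis using z by auto
  qed
  have "outer_normal K F = a"
    unfolding outer_normal_def
  proof (rule the_equality)
    show "norm a = 1 \<and> (\<forall>x\<in>F. \<forall>y\<in>F. a \<bullet> (y - x) = 0) \<and> (\<forall>x\<in>F. \<forall>y\<in>K. a \<bullet> (y - x) \<le> 0)"
      using a Feq Kle by (auto simp: inner_diff_right)
    fix n assume n: "norm n = 1 \<and> (\<forall>x\<in>F. \<forall>y\<in>F. n \<bullet> (y - x) = 0) \<and> (\<forall>x\<in>F. \<forall>y\<in>K. n \<bullet> (y - x) \<le> 0)"
    obtain x0 where x0: "x0 \<in> F" using \<open>F \<noteq> {}\<close> by auto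
    have "F \<subseteq> {x. n \<bullet> x = n \<bullet> x0}" 
    proof
      fix x assume "x \<in> F"
      then have "n \<bullet> (x - x0) = 0" using n x0 by blast
      then show "x \<in> {x. n \<bullet> x = n \<bullet> x0}" by (simp add: inner_diff_right)
    qed
    then have "affine hull F \<subseteq> {x. n \<bullet> x = n \<bullet> x0}" by (intro hull_minimal affine_hyperplane)
    then have "{x. a \<bullet> x = b} \<subseteq> {x. n \<bullet> x = n \<bullet> x0}" using aff by simp
    then have "n = a \<or> n = - a" using unit_normal_eq[OF a] n by blast
    moreover have "n \<noteq> - a"
    proof
      assume "n = - a"
      moreover have "n \<bullet> (z - x0) \<le> 0" using n x0 z interior_subset by blast
      moreover have "a \<bullet> x0 = b" using x0 Feq by auto
      ultimately show False using zlt by (simp add: inner_diff_right)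
    qed
    ultimately show "n = a" by simp
  qed
  moreover have "facet_offset K F = b"
  proof -
    have "(SOME x. x \<in> F) \<in> F" using \<open>F \<noteq> {}\<close> by (simp add: some_in_eq)
    then show ?thesis using Feq calculation by (auto simp: facet_offset_def)
  qed
  ultimately show "norm (outer_normal K F) = 1"
    and "\<And>x. x \<in> K \<Longrightarrow> outer_normal K F \<bullet> x \<le> facet_offset K F"
    and "F = K \<inter> {x. outer_normal K F \<bullet> x = facet_offset K F}"
    and "affine hull F = {x. outer_normal K F \<bullet> x = facet_offset K F}"
    using a Kle Feq aff by simp_all
qed

lemma mem_facet_iff:
  assumes "F facet_of K"
  shows "x \<in> F \<longleftrightarrow> x \<in> K \<and> facet_dist K F x = 0"
proof -
  have "x \<in> F \<longleftrightarrow> x \<in> K \<and> outer_normal K F \<bullet> x = facet_offset K F"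
    using facet_hyperplane(3)[OF assms] by blast
  then show ?thesis by (auto simp: facet_dist_def)
qed

text \<open>A full-dimensional polytope is the intersection of its facet half-spaces. If x satisfied
  all inequalities outside \<open>K\<close>, the segment from an interior point z to x would leave
  \<open>K\<close> at a point w of some facet. The distance from this facet is affine along the
  segment, positive at z and nonnegative at x, so it cannot vanish at w.\<close>

lemma mem_interior_iff: "x \<in> interior K \<longleftrightarrow> (\<forall>F. F facet_of K \<longrightarrow> 0 < facet_dist K F x)"
  and mem_body_iff: "x \<in> K \<longleftrightarrow> (\<forall>F. F facet_of K \<longrightarrow> 0 \<le> facet_dist K F x)"
proof -
  have int: "interior K = K - \<Union>{F. F facet_of K}"
    using rel_interior_of_polyhedron[OF polyhedron] rel_interior_nonempty_interior[OF interior_nonempty]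
    by simp
  have ge: "0 \<le> facet_dist K F x" if "F facet_of K" "x \<in> K" for F x
    using facet_hyperplane(2)[OF that] by (simp add: facet_dist_def)
  have pos: "0 < facet_dist K F x" if F: "F facet_of K" and x: "x \<in> interior K" for F x
  proof -
    have "x \<in> K" "x \<notin> F" using int F x by blast+
    then show ?thesis using ge[OF F, of x] mem_facet_iff[OF F, of x] by auto
  qed
  show b: "x \<in> K \<longleftrightarrow> (\<forall>F. F facet_of K \<longrightarrow> 0 \<le> facet_dist K F x)" for x
  proof (intro iffI allI impI)
    assume x: "\<forall>F. F facet_of K \<longrightarrow> 0 \<le> facet_dist K F x"
    show "x \<in> K"
    proof (rule ccontr)
      assume "x \<notin> K"
      obtain z where z: "z \<in> interior K" using interior_nonempty by auto
      then have "z \<in> K" using interior_subset by blast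
      then have "closed_segment z x \<inter> frontier K \<noteq> {}"
        using \<open>x \<notin> K\<close> by (intro connected_Int_frontier) auto
      then obtain w where w: "w \<in> closed_segment z x" "w \<in> frontier K" by auto
      then have "w \<in> K" "w \<notin> interior K" using closed by (auto simp: frontier_def)
      then obtain F where F: "F facet_of K" "w \<in> F" using int by blast
      obtain t where t: "0 \<le> t" "t \<le> 1" "w = (1 - t) *\<^sub>R z + t *\<^sub>R x"
        using w(1) by (auto simp: in_segment)
      have "t \<noteq> 1" using t(3) \<open>x \<notin> K\<close> \<open>w \<in> K\<close> by auto
      have "facet_dist K F w = (1 - t) * facet_dist K F z + t * facet_dist K F x"
        by (simp add: facet_dist_def t(3) inner_add_right algebra_simps)
      moreover have "(1 - t) * facet_dist K F z > 0" using pos[OF F(1) z] t \<open>t \<noteq> 1\<close> by simp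
      moreover have "t * facet_dist K F x \<ge> 0" using x F t by simp
      moreover have "facet_dist K F w = 0" using F mem_facet_iff by blast
      ultimately show False by simp
    qed
  qed (use ge in auto)
  show "x \<in> interior K \<longleftrightarrow> (\<forall>F. F facet_of K \<longrightarrow> 0 < facet_dist K F x)" for x
  proof (intro iffI allI impI)
    assume x: "\<forall>F. F facet_of K \<longrightarrow> 0 < facet_dist K F x"
    then have "x \<in> K" using b[of x] by (auto intro: less_imp_le)
    moreover have "x \<notin> F" if "F facet_of K" for F
      using x that mem_facet_iff[OF that, of x] by auto
    ultimately show "x \<in> interior K" using int by blast
  qed (use pos in auto)
qed

text \<open>Otherwise one facet would be a proper face of the other with the same dimension.\<close>

lemma distinct_facets:
  assumes F: "F facet_of K" and F': "F' facet_of K" and ne: "F \<noteq> F'"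
  shows "\<not> {x. outer_normal K F \<bullet> x = facet_offset K F} \<subseteq> {x. outer_normal K F' \<bullet> x = facet_offset K F'}"
proof
  assume sub: "{x. outer_normal K F \<bullet> x = facet_offset K F} \<subseteq> {x. outer_normal K F' \<bullet> x = facet_offset K F'}"
  then have "F \<subseteq> F'" using facet_hyperplane(3)[OF F] facet_hyperplane(3)[OF F'] by blast
  moreover have "F face_of F'"
    using F F' \<open>F \<subseteq> F'\<close> by (meson face_of_subset facet_of_imp_face_of facet_of_imp_subset)
  moreover have "aff_dim F = aff_dim F'" using F F' by (simp add: facet_of_def)
  moreover have "convex F'" using F' by (meson face_of_imp_convex facet_of_imp_face_of)
  ultimately show False using face_of_aff_dim_lt[of F' F] ne by auto
qed

lemma facet_dist_shift:
  "facet_dist K F (x - t *\<^sub>R v) = facet_dist K F x + t * (outer_normal K F \<bullet> v)"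
  by (simp add: facet_dist_def inner_diff_right)

lemma facet_dist_shift_self:
  "F facet_of K \<Longrightarrow> facet_dist K F (x - t *\<^sub>R outer_normal K F) = facet_dist K F x + t"
  using facet_hyperplane(1)[of F] by (simp add: facet_dist_shift dot_square_norm)

text \<open>Describes the relative interior of a facet. Strict inequalities are the form that
  survives small displacements and that can be verified for almost every projected point.\<close>

definition generic :: "(real ^ 'd) set \<Rightarrow> real ^ 'd \<Rightarrow> bool" where
  "generic F x \<longleftrightarrow> x \<in> F \<and> (\<forall>F'. F' facet_of K \<and> F' \<noteq> F \<longrightarrow> 0 < facet_dist K F' x)"

text \<open>The distances from the other facets are positive at x and continuous, and the distance
  from \<open>F\<close> itself grows like t.\<close>

lemma generic_inward:
  assumes F: "F facet_of K" and x: "generic F x"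
  shows "\<forall>\<^sub>F t in at_right 0. x - t *\<^sub>R outer_normal K F \<in> interior K"
proof -
  have "\<forall>\<^sub>F t in at_right 0. \<forall>F'\<in>{F. F facet_of K}. 0 < facet_dist K F' (x - t *\<^sub>R outer_normal K F)"
  proof (rule eventually_ball_finite[OF finite_facets], rule ballI)
    fix F' assume F': "F' \<in> {F. F facet_of K}"
    show "\<forall>\<^sub>F t in at_right 0. 0 < facet_dist K F' (x - t *\<^sub>R outer_normal K F)"
    proof (cases "F' = F")
      case True
      have "facet_dist K F x = 0" using x mem_facet_iff[OF F] unfolding generic_def by blast
      then show ?thesis
        using F True by (simp add: facet_dist_shift_self eventually_at_right_less)
    next
      case False
      have "((\<lambda>t. facet_dist K F' (x - t *\<^sub>R outer_normal K F)) \<longlongrightarrow>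
          facet_dist K F' (x - 0 *\<^sub>R outer_normal K F)) (at_right 0)"
        unfolding facet_dist_def by (intro tendsto_intros)
      then show ?thesis using False F' x by (intro order_tendstoD(1)) (auto simp: generic_def)
    qed
  qed
  then show ?thesis by (simp add: mem_interior_iff)
qed

text \<open>If a second facet contained such a point, it would contain all of \<open>F\<close>. Thus
  every facet has generic points.\<close>

lemma rel_interior_generic:
  assumes F: "F facet_of K" and x: "x \<in> rel_interior F"
  shows "generic F x"
  unfolding generic_def
proof (intro conjI allI impI)
  show "x \<in> F" using x rel_interior_subset by blast
  fix F' assume F': "F' facet_of K \<and> F' \<noteq> F"
  have "x \<in> K" using \<open>x \<in> F\<close> F facet_of_imp_subset by blast
  then have "0 \<le> facet_dist K F' x" using mem_body_iff F' by blast
  moreover have "facet_dist K F' x \<noteq> 0"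
  proof
    assume "facet_dist K F' x = 0"
    then have "x \<in> F'" using mem_facet_iff[of F'] F' \<open>x \<in> K\<close> by blast
    then have "F \<subseteq> F'"
      using subset_of_face_of[of F' K F] F F' x by (auto simp: facet_of_imp_face_of facet_of_imp_subset)
    then have "affine hull F \<subseteq> affine hull F'" by (rule hull_mono)
    then show False using distinct_facets[of F F'] F F' facet_hyperplane(4) by auto
  qed
  ultimately show "0 < facet_dist K F' x" by simp
qed

text \<open>A proper nonempty face is the intersection of the facets that contain it, and
  \<open>F\<close> is the only facet through x.\<close>

lemma generic_face_eq:
  assumes F: "F facet_of K" and x: "generic F x" and G: "G face_of K" "x \<in> G" "G \<noteq> K"
  shows "G = F"
proof -
  have only: "F' = F" if "F' facet_of K" "G \<subseteq> F'" for F'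
  proof (rule ccontr)
    assume "F' \<noteq> F"
    then have "0 < facet_dist K F' x" using x that by (simp add: generic_def)
    moreover have "x \<in> F'" using G that by auto
    ultimately show False using mem_facet_iff[OF that(1)] by auto
  qed
  obtain F' where "F' facet_of K" "G \<subseteq> F'"
    using face_of_polyhedron_subset_facet[OF polyhedron G(1) _ G(3)] G(2) by blast
  with only have "{F'. F' facet_of K \<and> G \<subseteq> F'} = {F}" using F by blast
  then show ?thesis using face_of_polyhedron[OF polyhedron G(1) _ G(3)] G(2) by auto
qed

text \<open>\<open>Lim\<close> is determined only if x is a limit point of the interior. This also
  holds at boundary points because \<open>K\<close> is the closure of its interior.\<close>

lemma trace_from_eq:
  assumes x: "x \<in> K" and p: "continuous_on UNIV p" and eq: "\<And>y. y \<in> interior K \<Longrightarrow> \<phi> y = p y"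
  shows "trace_from K \<phi> x = p x"
proof -
  have "x islimpt interior K"
  proof (cases "x \<in> interior K")
    case True
    then show ?thesis using interior_limit_point[of x "interior K"] by simp
  next
    case False
    then show ?thesis using x closure_interior by (auto simp: closure_def)
  qed
  then have nt: "\<not> trivial_limit (at x within interior K)" by (simp add: trivial_limit_within)
  have "(p \<longlongrightarrow> p x) (at x within interior K)"
    using p by (meson UNIV_I continuous_on_def subset_UNIV tendsto_within_subset)
  moreover have "\<forall>\<^sub>F y in at x within interior K. p y = \<phi> y"
    using eq by (auto simp: eventually_at intro!: exI[of _ 1])
  ultimately have "(\<phi> \<longlongrightarrow> p x) (at x within interior K)"
    by (simp add: tendsto_cong)
  then show ?thesis unfolding trace_from_def by (rule tendsto_Lim[OF nt])
qed

end

text \<open>For d at least 2 a facet has affine dimension at least 1 and hence two distinct points;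
  in dimension 1 the weight \<open>1 / diameter F\<close> would be a division by 0.\<close>

lemma facet_diameter_pos:
  fixes K :: "(real ^ 'd) set"
  assumes K: "convex_body K" and F: "F facet_of K" and d: "CARD('d) \<ge> 2"
  shows "0 < diameter F" "diameter F \<le> diameter K"
proof -
  interpret convex_body K by fact
  have FK: "F \<subseteq> K" using F by (rule facet_of_imp_subset)
  have bK: "bounded K" using compact by (rule compact_imp_bounded)
  show "diameter F \<le> diameter K" using FK bK by (rule diameter_subset)
  have "aff_dim F = int CARD('d) - 1" using F aff_dim_eq by (simp add: facet_of_def)
  then have "aff_dim F \<ge> 1" using d by simp
  then have "F \<noteq> {}" "\<not> (\<exists>a. F = {a})" by (auto simp: aff_dim_sing)
  then obtain x y where xy: "x \<in> F" "y \<in> F" "x \<noteq> y" by blast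
  have "bounded F" using bK FK bounded_subset by blast
  then have "dist x y \<le> diameter F" using xy by (intro diameter_bounded_bound)
  then show "0 < diameter F" using xy(3) by (smt (verit) zero_less_dist_iff)
qed

section \<open>Surface measure\<close>

definition hyperplane_proj :: "real ^ 'd \<Rightarrow> real \<Rightarrow> real ^ 'd \<Rightarrow> real ^ 'd" where
  "hyperplane_proj n b y = y + (b - n \<bullet> y) *\<^sub>R n"

definition slab :: "real ^ 'd \<Rightarrow> real \<Rightarrow> (real ^ 'd) set" where
  "slab n b = {y. \<bar>b - n \<bullet> y\<bar> \<le> 1 / 2}"

lemma continuous_hyperplane_proj [continuous_intros]:
  "continuous_on A f \<Longrightarrow> continuous_on A (\<lambda>x. hyperplane_proj n b (f x))"
  unfolding hyperplane_proj_def by (intro continuous_intros)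

lemma borel_measurable_hyperplane_proj [measurable]:
  "hyperplane_proj n b \<in> borel_measurable borel"
  by (intro borel_measurable_continuous_onI continuous_intros)

lemma slab_borel [measurable]: "slab n b \<in> sets borel"
  unfolding slab_def by measurable

lemma inner_hyperplane_proj: "norm n = 1 \<Longrightarrow> n \<bullet> hyperplane_proj n b y = b"
  by (simp add: hyperplane_proj_def inner_add_right dot_square_norm)

lemma dist_hyperplane_proj: "norm n = 1 \<Longrightarrow> dist y (hyperplane_proj n b y) = \<bar>b - n \<bullet> y\<bar>"
  by (simp add: hyperplane_proj_def dist_norm)

lemma closest_point_hyperplane:
  assumes n: "norm n = 1"
  shows "closest_point {x. n \<bullet> x = b} y = hyperplane_proj n b y"
proof (rule closest_point_unique[symmetric])
  show "convex {x. n \<bullet> x = b}" by (rule convex_hyperplane)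
  show "closed {x. n \<bullet> x = b}" by (rule closed_hyperplane)
  show "hyperplane_proj n b y \<in> {x. n \<bullet> x = b}" using n by (simp add: inner_hyperplane_proj)
  show "\<forall>z\<in>{x. n \<bullet> x = b}. dist y (hyperplane_proj n b y) \<le> dist y z"
  proof
    fix z assume "z \<in> {x. n \<bullet> x = b}"
    then have "\<bar>b - n \<bullet> y\<bar> = \<bar>n \<bullet> (z - y)\<bar>" by (simp add: inner_diff_right)
    also have "\<dots> \<le> norm n * norm (z - y)" by (rule Cauchy_Schwarz_ineq2)
    finally show "dist y (hyperplane_proj n b y) \<le> dist y z"
      using dist_hyperplane_proj[OF n, of y b] n by (simp add: dist_norm norm_minus_commute)
  qed
qed

locale hyperplane_piece =
  fixes F :: "(real ^ 'd) set" and n :: "real ^ 'd" and b :: real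
  assumes unit: "norm n = 1" and aff: "affine hull F = {x. n \<bullet> x = b}" and compact: "compact F"
begin

lemma borel_F [measurable]: "F \<in> sets borel"
  using compact by (rule borel_compact)

definition prism :: "(real ^ 'd) set" where
  "prism = {y. hyperplane_proj n b y \<in> F \<and> y \<in> slab n b}"

lemma prism_borel [measurable]: "prism \<in> sets borel"
  unfolding prism_def by measurable

lemma surface_measure_eq:
  "surface_measure F =
     distr (restrict_space lborel prism) (restrict_space borel F) (hyperplane_proj n b)"
proof -
  have "closest_point (affine hull F) = hyperplane_proj n b"
    unfolding aff using closest_point_hyperplane[OF unit] by auto
  then show ?thesis
    unfolding surface_measure_def by (simp add: prism_def slab_def dist_hyperplane_proj[OF unit])
qed

lemma proj_measurable:
  "hyperplane_proj n b \<in> measurable (restrict_space lborel prism) (restrict_space borel F)"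
proof (rule measurable_restrict_space2)
  show "hyperplane_proj n b \<in> space (restrict_space lborel prism) \<rightarrow> F"
    by (auto simp: space_restrict_space prism_def)
  show "hyperplane_proj n b \<in> restrict_space lborel prism \<rightarrow>\<^sub>M borel"
    by (intro measurable_restrict_space1) simp
qed

lemma space_surface_measure: "space (surface_measure F) = F"
  by (simp add: surface_measure_eq space_restrict_space)

lemma borel_measurable_surface:
  "q \<in> borel_measurable borel \<Longrightarrow> q \<in> borel_measurable (surface_measure F)"
  by (auto simp: surface_measure_eq intro: measurable_restrict_space1)

lemma surface_integral_eq:
  fixes q :: "real ^ 'd \<Rightarrow> real"
  assumes q: "q \<in> borel_measurable borel"
  shows "(LINT x|surface_measure F. q x) =
    (LINT y|lborel. indicator prism y * q (hyperplane_proj n b y))"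
proof -
  have "(LINT x|surface_measure F. q x) = (LINT y|restrict_space lborel prism. q (hyperplane_proj n b y))"
    unfolding surface_measure_eq
    by (intro integral_distr proj_measurable measurable_restrict_space1 q)
  also have "\<dots> = (LINT y|lborel. indicator prism y *\<^sub>R q (hyperplane_proj n b y))"
    by (rule integral_restrict_space) simp
  finally show ?thesis by simp
qed

lemma bounded_prism: "bounded prism"
proof -
  obtain B where B: "\<And>x. x \<in> F \<Longrightarrow> norm x \<le> B"
    using compact_imp_bounded[OF compact] by (auto simp: bounded_iff)
  show ?thesis
    unfolding bounded_iff
  proof (intro exI[of _ "B + 1"] ballI)
    fix y assume "y \<in> prism"
    then have "norm (hyperplane_proj n b y) \<le> B" "dist y (hyperplane_proj n b y) \<le> 1 / 2"
      using B by (auto simp: prism_def slab_def dist_hyperplane_proj[OF unit])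
    then show "norm y \<le> B + 1"
      using norm_triangle_sub[of y "hyperplane_proj n b y"] by (simp add: dist_norm)
  qed
qed

lemma finite_surface_measure: "finite_measure (surface_measure F)"
  unfolding surface_measure_eq
proof (rule finite_measure.finite_measure_distr[OF _ proj_measurable], rule finite_measureI)
  have "emeasure lborel prism < \<infinity>" using bounded_prism by (rule emeasure_bounded_finite)
  then show "emeasure (restrict_space lborel prism) (space (restrict_space lborel prism)) \<noteq> \<infinity>"
    by (simp add: emeasure_restrict_space space_restrict_space)
qed

lemma integrable_surface:
  fixes q :: "real ^ 'd \<Rightarrow> 'b::euclidean_space"
  assumes "q \<in> borel_measurable borel" "\<And>x. x \<in> F \<Longrightarrow> norm (q x) \<le> B"
  shows "integrable (surface_measure F) q"
  using finite_surface_measure assms borel_measurable_surface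
  by (intro finite_measure.integrable_const_bound[of _ q B]) (auto simp: space_surface_measure)

lemma integrable_surface_continuous:
  fixes q :: "real ^ 'd \<Rightarrow> 'b::euclidean_space"
  assumes "continuous_on UNIV q"
  shows "integrable (surface_measure F) q"
proof -
  have "bounded (q ` F)"
    using assms compact by (intro compact_imp_bounded compact_continuous_image continuous_on_subset[OF assms]) auto
  then obtain B where "\<And>x. x \<in> F \<Longrightarrow> norm (q x) \<le> B" by (auto simp: bounded_iff)
  then show ?thesis using assms by (intro integrable_surface borel_measurable_continuous_onI) auto
qed

end

text \<open>Every point lies in the unit slab exactly for an interval of translates of length 1.\<close>

lemma lebesgue_integral_slab:
  fixes h :: "real ^ 'd \<Rightarrow> real"
  assumes n: "norm n = 1" and h: "integrable lborel h"
  shows "(LINT x|lborel. h x) =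
    (LINT y|lborel. indicator (slab n b) y * (LINT t|lborel. h (hyperplane_proj n b y - t *\<^sub>R n)))"
proof -
  have P: "pair_sigma_finite (lborel :: real measure) (lborel :: (real ^ 'd) measure)" ..
  have [measurable]: "h \<in> borel_measurable borel" using h by auto
  \<comment> \<open>Translation by \<open>t *\<^sub>R n\<close> turns \<open>f\<close> into
    \<open>g\<close>: in \<open>f\<close> the argument of \<open>h\<close> moves, in
    \<open>g\<close> the slab does.\<close>
  define f where "f t y = indicator (slab n b) y * h (y + t *\<^sub>R n)" for t y
  define g where "g t y = indicator (slab n (b + t)) y * h y" for t y
  have ind: "indicator (slab n (b + t)) y = (indicator {n \<bullet> y - b - 1/2..n \<bullet> y - b + 1/2} t :: real)"
    for t y
  proof -
    have "\<bar>b + t - n \<bullet> y\<bar> \<le> 1 / 2 \<longleftrightarrow> n \<bullet> y - b - 1/2 \<le> t \<and> t \<le> n \<bullet> y - b + 1/2" by linarith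
    then show ?thesis by (simp add: slab_def indicator_def)
  qed
  have [measurable]: "case_prod f \<in> borel_measurable (lborel \<Otimes>\<^sub>M lborel)"
    unfolding f_def case_prod_unfold by measurable
  have [measurable]: "case_prod g \<in> borel_measurable (lborel \<Otimes>\<^sub>M lborel)"
    unfolding g_def case_prod_unfold slab_def by measurable
  have shift: "f t (y - t *\<^sub>R n) = g t y" for t y
    using n by (simp add: f_def g_def slab_def indicator_def inner_diff_right dot_square_norm algebra_simps)
  have tr_nn: "(\<integral>\<^sup>+y. ennreal \<bar>f t y\<bar> \<partial>lborel) = (\<integral>\<^sup>+y. ennreal \<bar>g t y\<bar> \<partial>lborel)" for t
  proof -
    have "(\<integral>\<^sup>+y. ennreal \<bar>f t y\<bar> \<partial>lborel) =
        (\<integral>\<^sup>+y. ennreal \<bar>f t y\<bar> \<partial>distr lborel borel ((+) (- t *\<^sub>R n)))"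
      by (simp add: lborel_distr_plus)
    also have "\<dots> = (\<integral>\<^sup>+y. ennreal \<bar>f t (- t *\<^sub>R n + y)\<bar> \<partial>lborel)"
      unfolding f_def by (subst nn_integral_distr) auto
    also have "\<dots> = (\<integral>\<^sup>+y. ennreal \<bar>g t y\<bar> \<partial>lborel)" using shift[of t] by simp
    finally show ?thesis .
  qed
  have tr: "(LINT y|lborel. f t y) = (LINT y|lborel. g t y)" for t
  proof -
    have "(LINT y|lborel. f t y) = (LINT y|distr lborel borel ((+) (- t *\<^sub>R n)). f t y)"
      by (simp add: lborel_distr_plus)
    also have "\<dots> = (LINT y|lborel. f t (- t *\<^sub>R n + y))"
      unfolding f_def by (subst integral_distr) auto
    also have "\<dots> = (LINT y|lborel. g t y)" using shift[of t] by simp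
    finally show ?thesis .
  qed
  have g_nn: "(\<integral>\<^sup>+t. (\<integral>\<^sup>+y. ennreal \<bar>g t y\<bar> \<partial>lborel) \<partial>lborel) < \<infinity>"
  proof -
    have "(\<integral>\<^sup>+t. (\<integral>\<^sup>+y. ennreal \<bar>g t y\<bar> \<partial>lborel) \<partial>lborel) =
        (\<integral>\<^sup>+y. (\<integral>\<^sup>+t. ennreal \<bar>g t y\<bar> \<partial>lborel) \<partial>lborel)"
      by (rule pair_sigma_finite.Fubini'[OF P, symmetric]) simp
    also have "\<dots> = (\<integral>\<^sup>+y. ennreal \<bar>h y\<bar> \<partial>lborel)"
    proof (rule nn_integral_cong)
      fix y
      have "(\<integral>\<^sup>+t. ennreal \<bar>g t y\<bar> \<partial>lborel) =
          (\<integral>\<^sup>+t. ennreal \<bar>h y\<bar> * indicator {n \<bullet> y - b - 1/2..n \<bullet> y - b + 1/2} t \<partial>lborel)"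
        unfolding g_def ind by (intro nn_integral_cong) (auto simp: indicator_def)
      also have "\<dots> = ennreal \<bar>h y\<bar>" by (simp add: nn_integral_cmult)
      finally show "(\<integral>\<^sup>+t. ennreal \<bar>g t y\<bar> \<partial>lborel) = ennreal \<bar>h y\<bar>" .
    qed
    also have "\<dots> < \<infinity>" using h by (simp add: integrable_iff_bounded)
    finally show ?thesis .
  qed
  have int_g: "integrable (lborel \<Otimes>\<^sub>M lborel) (case_prod g)"
    using g_nn by (simp add: integrable_iff_bounded lborel.nn_integral_fst[symmetric])
  have int_f: "integrable (lborel \<Otimes>\<^sub>M lborel) (case_prod f)"
    using g_nn tr_nn by (simp add: integrable_iff_bounded lborel.nn_integral_fst[symmetric])
  have "(LINT y|lborel. (LINT t|lborel. f t y)) = (LINT t|lborel. (LINT y|lborel. f t y))"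
    by (rule pair_sigma_finite.Fubini_integral[OF P int_f])
  also have "\<dots> = (LINT t|lborel. (LINT y|lborel. g t y))" unfolding tr ..
  also have "\<dots> = (LINT y|lborel. (LINT t|lborel. g t y))"
    by (rule pair_sigma_finite.Fubini_integral[OF P int_g, symmetric])
  also have "\<dots> = (LINT x|lborel. h x)" unfolding g_def ind by simp
  finally have "(LINT y|lborel. (LINT t|lborel. f t y)) = (LINT x|lborel. h x)" .
  moreover have "(LINT t|lborel. f t y) =
      indicator (slab n b) y * (LINT t|lborel. h (hyperplane_proj n b y - t *\<^sub>R n))" for y
  proof -
    have "(LINT t|lborel. f t y) = indicator (slab n b) y * (LINT t|lborel. h (y + t *\<^sub>R n))"
      unfolding f_def by simp
    \<comment> \<open>Reflecting and shifting t replaces y by its projection and lets positive t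
      point against the normal, which is inwards for a facet.\<close>
    also have "(LINT t|lborel. h (y + t *\<^sub>R n)) =
        \<bar>-1\<bar> *\<^sub>R (LINT t|lborel. h (y + ((b - n \<bullet> y) + (-1) * t) *\<^sub>R n))"
      by (rule lborel_integral_real_affine) simp
    also have "(\<lambda>t. h (y + ((b - n \<bullet> y) + (-1) * t) *\<^sub>R n)) = (\<lambda>t. h (hyperplane_proj n b y - t *\<^sub>R n))"
      by (simp add: hyperplane_proj_def algebra_simps)
    finally show ?thesis by simp
  qed
  ultimately show ?thesis by simp
qed

text \<open>An approximate identity in the normal direction: rescaling across the hyperplane turns
  the concentrated kernel into the fixed profile \<open>k\<close>. Convergence of \<open>G\<close>
  is required only where \<open>k\<close> is nonzero, so the support of the profile decides from
  which side of the hyperplane the limit is taken.\<close>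

lemma strip_limit:
  fixes G :: "nat \<Rightarrow> real ^ 'd \<Rightarrow> real" and k :: "real \<Rightarrow> real"
  assumes n: "norm n = 1"
    and k: "k \<in> borel_measurable borel" "\<And>\<tau>. \<bar>k \<tau>\<bar> \<le> A" "\<And>\<tau>. 1 < \<bar>\<tau>\<bar> \<Longrightarrow> k \<tau> = 0"
    and \<epsilon>: "\<And>i. 0 < \<epsilon> i" "\<And>i. \<epsilon> i \<le> 1"
    and G: "\<And>i. G i \<in> borel_measurable borel" "\<And>i x. \<bar>G i x\<bar> \<le> B" "\<And>i x. R < norm x \<Longrightarrow> G i x = 0"
    and g: "g \<in> borel_measurable borel"
    and lim: "AE y in lborel. \<forall>\<tau>. k \<tau> \<noteq> 0 \<longrightarrow>
      (\<lambda>i. G i (hyperplane_proj n b y - (\<epsilon> i * \<tau>) *\<^sub>R n)) \<longlonglongrightarrow> g (hyperplane_proj n b y)"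
  shows "(\<lambda>i. LINT x|lborel. 1 / \<epsilon> i * k ((b - n \<bullet> x) / \<epsilon> i) * G i x) \<longlonglongrightarrow>
    (LINT \<tau>|lborel. k \<tau>) * (LINT y|lborel. indicator (slab n b) y * g (hyperplane_proj n b y))"
proof -
  let ?\<pi> = "hyperplane_proj n b"
  note [measurable] = k(1) G(1) g
  have A: "0 \<le> A" using k(2)[of 0] by linarith
  have B: "0 \<le> B" using G(2)[of 0 0] by linarith
  define D where "D \<tau> = A * B * indicator {-1..1} \<tau>" for \<tau> :: real
  have D_int: "integrable lborel D" unfolding D_def by simp
  have D: "\<bar>k \<tau> * G i x\<bar> \<le> D \<tau>" for \<tau> i x
  proof (cases "\<tau> \<in> {-1..1}")
    case True
    then show ?thesis using k(2) G(2) A B by (simp add: D_def abs_mult mult_mono)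
  next
    case False
    then have "1 < \<bar>\<tau>\<bar>" by auto
    then show ?thesis using k(3) A B by (simp add: D_def)
  qed
  define J where "J i y = (LINT \<tau>|lborel. k \<tau> * G i (?\<pi> y - (\<epsilon> i * \<tau>) *\<^sub>R n))" for i y
  have J_meas [measurable]: "J i \<in> borel_measurable lborel" for i
    unfolding J_def by measurable
  have k_int: "integrable lborel (\<lambda>\<tau>. k \<tau> * G i (x - (\<epsilon> i * \<tau>) *\<^sub>R n))" for i x
    by (rule Bochner_Integration.integrable_bound[OF D_int _ AE_I2]) (auto intro: order_trans[OF D abs_ge_self])
  have J_le: "\<bar>J i y\<bar> \<le> 2 * A * B" for i y
  proof -
    have "norm (J i y) \<le> (LINT \<tau>|lborel. norm (k \<tau> * G i (?\<pi> y - (\<epsilon> i * \<tau>) *\<^sub>R n)))"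
      unfolding J_def by (rule integral_norm_bound)
    also have "\<dots> \<le> (LINT \<tau>|lborel. D \<tau>)"
      using D by (intro integral_mono D_int integrable_norm k_int) auto
    also have "\<dots> = 2 * A * B" by (simp add: D_def)
    finally show ?thesis by simp
  qed
  \<comment> \<open>The projection moves y by at most 1/2 and the strip by at most 1, so beyond
    \<open>R + 2\<close> only points where \<open>G\<close> vanishes are met.\<close>
  have J_supp: "J i y = 0" if y: "y \<in> slab n b" "R + 2 < norm y" for i y
  proof -
    have zero: "k \<tau> * G i (?\<pi> y - (\<epsilon> i * \<tau>) *\<^sub>R n) = 0" for \<tau>
    proof (cases "1 < \<bar>\<tau>\<bar>")
      case False
      have "\<epsilon> i * \<bar>\<tau>\<bar> \<le> 1 * 1" using \<epsilon>[of i] False by (intro mult_mono) auto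
      then have "norm ((\<epsilon> i * \<tau>) *\<^sub>R n) \<le> 1" using n \<epsilon>(1)[of i] by (simp add: abs_mult)
      moreover have "dist y (?\<pi> y) \<le> 1 / 2" using y n by (simp add: dist_hyperplane_proj slab_def)
      moreover have "norm y \<le> norm (y - ?\<pi> y) + norm ((\<epsilon> i * \<tau>) *\<^sub>R n) + norm (?\<pi> y - (\<epsilon> i * \<tau>) *\<^sub>R n)"
        using norm_triangle_ineq[of "y - ?\<pi> y + (\<epsilon> i * \<tau>) *\<^sub>R n" "?\<pi> y - (\<epsilon> i * \<tau>) *\<^sub>R n"]
          norm_triangle_ineq[of "y - ?\<pi> y" "(\<epsilon> i * \<tau>) *\<^sub>R n"] by simp
      ultimately have "R < norm (?\<pi> y - (\<epsilon> i * \<tau>) *\<^sub>R n)" using y by (simp add: dist_norm)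
      then show ?thesis using G(3) by simp
    qed (use k(3) in simp)
    show ?thesis unfolding J_def zero by simp
  qed
  \<comment> \<open>The substitution t = \<open>\<epsilon> i * \<tau>\<close> across the hyperplane
    absorbs the factor \<open>1 / \<epsilon> i\<close>.\<close>
  have eq: "(LINT x|lborel. 1 / \<epsilon> i * k ((b - n \<bullet> x) / \<epsilon> i) * G i x) =
      (LINT y|lborel. indicator (slab n b) y * J i y)" for i
  proof -
    define h where "h x = 1 / \<epsilon> i * k ((b - n \<bullet> x) / \<epsilon> i) * G i x" for x
    have "integrable lborel h"
    proof (rule Bochner_Integration.integrable_bound)
      show "integrable lborel (\<lambda>x::real ^ 'd. indicator (cball 0 R) x *\<^sub>R (1 / \<epsilon> i * A * B))"
        by (intro integrable_scaleR_left integrable_real_indicator emeasure_bounded_finite) auto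
      show "h \<in> borel_measurable lborel" unfolding h_def by measurable
      show "AE x in lborel. norm (h x) \<le> norm (indicator (cball 0 R) x *\<^sub>R (1 / \<epsilon> i * A * B))"
      proof (rule AE_I2)
        fix x :: "real ^ 'd"
        have "\<bar>k ((b - n \<bullet> x) / \<epsilon> i) * G i x\<bar> \<le> A * B"
          using k(2) G(2) A B by (simp add: abs_mult mult_mono)
        then have "1 / \<epsilon> i * \<bar>k ((b - n \<bullet> x) / \<epsilon> i) * G i x\<bar> \<le> 1 / \<epsilon> i * (A * B)"
          using \<epsilon>(1)[of i] by (intro mult_left_mono) auto
        then show "norm (h x) \<le> norm (indicator (cball 0 R) x *\<^sub>R (1 / \<epsilon> i * A * B))"
          using G(3)[of x i] \<epsilon>(1)[of i] A B
          by (cases "x \<in> cball 0 R") (auto simp: h_def abs_mult)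
      qed
    qed
    then have eq1: "(LINT x|lborel. h x) =
        (LINT y|lborel. indicator (slab n b) y * (LINT t|lborel. h (?\<pi> y - t *\<^sub>R n)))"
      by (rule lebesgue_integral_slab[OF n])
    have inner: "(LINT t|lborel. h (?\<pi> y - t *\<^sub>R n)) = J i y" for y
    proof -
      have "(LINT t|lborel. h (?\<pi> y - t *\<^sub>R n)) =
          \<bar>\<epsilon> i\<bar> *\<^sub>R (LINT t|lborel. h (?\<pi> y - (0 + \<epsilon> i * t) *\<^sub>R n))"
        using \<epsilon>(1)[of i] by (intro lborel_integral_real_affine) auto
      also have "\<dots> = (LINT t|lborel. \<epsilon> i * h (?\<pi> y - (0 + \<epsilon> i * t) *\<^sub>R n))"
        using \<epsilon>(1)[of i] by simp
      also have "\<dots> = J i y"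
        unfolding J_def
      proof (rule Bochner_Integration.integral_cong[OF refl])
        fix t
        have "b - n \<bullet> (?\<pi> y - (0 + \<epsilon> i * t) *\<^sub>R n) = \<epsilon> i * t"
          using n by (simp add: inner_diff_right inner_hyperplane_proj dot_square_norm)
        then show "\<epsilon> i * h (?\<pi> y - (0 + \<epsilon> i * t) *\<^sub>R n) = k t * G i (?\<pi> y - (\<epsilon> i * t) *\<^sub>R n)"
          using \<epsilon>(1)[of i] by (simp add: h_def)
      qed
      finally show ?thesis .
    qed
    show ?thesis using eq1 unfolding inner unfolding h_def .
  qed
  have "(\<lambda>i. LINT y|lborel. indicator (slab n b) y * J i y) \<longlonglongrightarrow>
      (LINT y|lborel. indicator (slab n b) y * ((LINT \<tau>|lborel. k \<tau>) * g (?\<pi> y)))"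
  proof (rule integral_dominated_convergence)
    show "integrable lborel (\<lambda>y::real ^ 'd. indicator (cball 0 (R + 2)) y *\<^sub>R (2 * A * B))"
      by (intro integrable_scaleR_left integrable_real_indicator emeasure_bounded_finite) auto
    show "AE y in lborel. norm (indicator (slab n b) y * J i y) \<le>
        indicator (cball 0 (R + 2)) y *\<^sub>R (2 * A * B)" for i
    proof (rule AE_I2)
      fix y :: "real ^ 'd"
      show "norm (indicator (slab n b) y * J i y) \<le> indicator (cball 0 (R + 2)) y *\<^sub>R (2 * A * B)"
        using J_le[of i y] J_supp[of y i] A B
        by (cases "y \<in> slab n b"; cases "R + 2 < norm y") (auto simp: indicator_def)
    qed
    show "AE y in lborel. (\<lambda>i. indicator (slab n b) y * J i y) \<longlonglongrightarrow>
        indicator (slab n b) y * ((LINT \<tau>|lborel. k \<tau>) * g (?\<pi> y))"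
      using lim
    proof eventually_elim
      case (elim y)
      have "(\<lambda>i. J i y) \<longlonglongrightarrow> (LINT \<tau>|lborel. k \<tau> * g (?\<pi> y))"
        unfolding J_def
      proof (rule integral_dominated_convergence[OF _ _ D_int])
        show "AE \<tau> in lborel. (\<lambda>i. k \<tau> * G i (?\<pi> y - (\<epsilon> i * \<tau>) *\<^sub>R n)) \<longlonglongrightarrow> k \<tau> * g (?\<pi> y)"
        proof (rule AE_I2)
          fix \<tau> show "(\<lambda>i. k \<tau> * G i (?\<pi> y - (\<epsilon> i * \<tau>) *\<^sub>R n)) \<longlonglongrightarrow> k \<tau> * g (?\<pi> y)"
            using elim by (cases "k \<tau> = 0") (auto intro: tendsto_mult_left)
        qed
        show "AE \<tau> in lborel. norm (k \<tau> * G i (?\<pi> y - (\<epsilon> i * \<tau>) *\<^sub>R n)) \<le> D \<tau>" for i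
          using D by simp
      qed measurable
      then have "(\<lambda>i. J i y) \<longlonglongrightarrow> (LINT \<tau>|lborel. k \<tau>) * g (?\<pi> y)" by simp
      then show ?case by (rule tendsto_mult_left)
    qed
  qed measurable
  moreover have "(LINT y|lborel. indicator (slab n b) y * ((LINT \<tau>|lborel. k \<tau>) * g (?\<pi> y))) =
      (LINT \<tau>|lborel. k \<tau>) * (LINT y|lborel. indicator (slab n b) y * g (?\<pi> y))"
    by (simp add: mult.left_commute)
  ultimately show ?thesis unfolding eq by simp
qed

section \<open>Cut-off functions and normal traces\<close>

definition pos_square :: "real \<Rightarrow> real" where
  "pos_square t = (max 0 t)\<^sup>2"

lemma pos_square_deriv: "(pos_square has_real_derivative 2 * max 0 t) (at t)"
proof (cases t "0 :: real" rule: linorder_cases)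
  case less
  have "((\<lambda>s::real. 0) has_real_derivative 0) (at t)" by simp
  then have "(pos_square has_real_derivative 0) (at t)"
    by (rule has_field_derivative_transform_within_open[of _ _ _ "{..<0}"])
      (use less in \<open>auto simp: pos_square_def\<close>)
  then show ?thesis using less by simp
next
  case equal
  have "((\<lambda>h. pos_square h / h) \<longlongrightarrow> 0) (at 0)"
  proof (rule Lim_null_comparison)
    show "\<forall>\<^sub>F h in at 0. norm (pos_square h / h) \<le> \<bar>h\<bar>"
      by (rule always_eventually) (auto simp: pos_square_def max_def power2_eq_square)
    show "((\<lambda>h::real. \<bar>h\<bar>) \<longlongrightarrow> 0) (at 0)" by (rule tendsto_rabs_zero) simp
  qed
  then show ?thesis using equal by (simp add: has_field_derivative_iff pos_square_def)
next
  case greater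
  have "((\<lambda>s::real. s\<^sup>2) has_real_derivative 2 * t) (at t)" by (auto intro!: derivative_eq_intros)
  then have "(pos_square has_real_derivative 2 * t) (at t)"
    by (rule has_field_derivative_transform_within_open[of _ _ _ "{0<..}"])
      (use greater in \<open>auto simp: pos_square_def\<close>)
  then show ?thesis using greater by simp
qed

text \<open>Equals 1 - (1 - t^2)^2 between 0 and 1 and is constant on either side. Writing it with
  squared positive parts yields differentiability at both transition points by the chain rule,
  without gluing.\<close>

definition smooth_step :: "real \<Rightarrow> real" where
  "smooth_step t = 1 - pos_square (1 - pos_square t)"

definition smooth_step_deriv :: "real \<Rightarrow> real" where
  "smooth_step_deriv t = 4 * (max 0 (1 - pos_square t) * max 0 t)"

lemma smooth_step_has_deriv: "(smooth_step has_real_derivative smooth_step_deriv t) (at t)"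
proof -
  have "((\<lambda>t. 1 - pos_square t) has_real_derivative (0 - 2 * max 0 t)) (at t)"
    by (intro DERIV_diff DERIV_const pos_square_deriv)
  from DERIV_diff[OF DERIV_const DERIV_chain2[OF pos_square_deriv this], of 1]
  show ?thesis unfolding smooth_step_def smooth_step_deriv_def by (simp add: mult_ac)
qed

lemma smooth_step_0: "t \<le> 0 \<Longrightarrow> smooth_step t = 0"
  by (simp add: smooth_step_def pos_square_def)

lemma smooth_step_1: "1 \<le> t \<Longrightarrow> smooth_step t = 1"
  using one_le_power[of t 2] by (simp add: smooth_step_def pos_square_def)

lemma smooth_step_bounds: "0 \<le> smooth_step t" "smooth_step t \<le> 1"
proof -
  have "pos_square t \<ge> 0" by (simp add: pos_square_def)
  then have "max 0 (1 - pos_square t) \<le> 1" by simp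
  then have "(max 0 (1 - pos_square t))\<^sup>2 \<le> 1\<^sup>2" by (intro power_mono) auto
  then show "0 \<le> smooth_step t" by (simp add: smooth_step_def pos_square_def)
  show "smooth_step t \<le> 1" by (simp add: smooth_step_def pos_square_def)
qed

lemma smooth_step_deriv_nonzeroD:
  assumes "smooth_step_deriv t \<noteq> 0"
  shows "0 < t \<and> t < 1"
proof -
  have "max 0 t \<noteq> 0" "max 0 (1 - pos_square t) \<noteq> 0" using assms by (auto simp: smooth_step_deriv_def)
  then have "0 < t" "pos_square t < 1" by (auto simp: max_def split: if_splits)
  then show ?thesis by (simp add: pos_square_def power_less_one_iff abs_square_less_1)
qed

lemma smooth_step_deriv_bounds: "0 \<le> smooth_step_deriv t" "smooth_step_deriv t \<le> 4"
proof -
  show "0 \<le> smooth_step_deriv t" by (simp add: smooth_step_deriv_def)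
  show "smooth_step_deriv t \<le> 4"
  proof (cases "smooth_step_deriv t = 0")
    case False
    then have t: "0 < t" "t < 1" using smooth_step_deriv_nonzeroD by auto
    have "max 0 (1 - pos_square t) * max 0 t \<le> 1 * 1"
      using t by (intro mult_mono) (auto simp: pos_square_def)
    then show ?thesis by (simp add: smooth_step_deriv_def)
  qed simp
qed

lemma continuous_smooth_step_deriv: "continuous_on A smooth_step_deriv"
  unfolding smooth_step_deriv_def pos_square_def by (intro continuous_intros)

lemma continuous_smooth_step: "continuous_on A smooth_step"
  unfolding smooth_step_def pos_square_def by (intro continuous_intros)

text \<open>The total rise of the step. Having weight 1, the strip integrals converge to the surface
  integral without a further factor.\<close>

lemma integral_smooth_step_deriv: "(LINT \<tau>|lborel. smooth_step_deriv (\<tau> + \<sigma>)) = 1"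
proof -
  have "(LINT \<tau>|lborel. smooth_step_deriv \<tau>) =
      \<bar>1\<bar> *\<^sub>R (LINT \<tau>|lborel. smooth_step_deriv (\<sigma> + 1 * \<tau>))"
    by (rule lborel_integral_real_affine) simp
  then have "(LINT \<tau>|lborel. smooth_step_deriv (\<tau> + \<sigma>)) = (LINT \<tau>|lborel. smooth_step_deriv \<tau>)"
    by (simp add: add.commute)
  also have "\<dots> = (LINT \<tau>|lborel. indicator {0..1} \<tau> *\<^sub>R smooth_step_deriv \<tau>)"
    using smooth_step_deriv_nonzeroD
    by (intro Bochner_Integration.integral_cong refl) (force simp: indicator_def)
  also have "(LINT \<tau>|lborel. indicator {0..1} \<tau> *\<^sub>R smooth_step_deriv \<tau>) = smooth_step 1 - smooth_step 0"
  proof (rule integral_FTC_atLeastAtMost)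
    show "(smooth_step has_vector_derivative smooth_step_deriv x) (at x within {0..1})" for x
      using smooth_step_has_deriv[of x]
      by (simp add: has_real_derivative_iff_has_vector_derivative has_vector_derivative_at_within)
  qed (use continuous_smooth_step_deriv in auto)
  also have "\<dots> = 1" by (simp add: smooth_step_0 smooth_step_1)
  finally show ?thesis .
qed

text \<open>The factor \<open>Suc i\<close> drives the argument to plus or minus infinity, according
  to the sign of L, and the fixed shift cannot prevent this. The values \<open>l i\<close> may vary
  because they will be distances of moving points.\<close>

lemma smooth_step_scaled_eventually:
  assumes "l \<longlonglongrightarrow> L"
  shows "0 < L \<Longrightarrow> \<forall>\<^sub>F i in sequentially. smooth_step (l i * real (Suc i) + \<sigma>) = 1"
    and "L < 0 \<Longrightarrow> \<forall>\<^sub>F i in sequentially. smooth_step (l i * real (Suc i) + \<sigma>) = 0"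
proof -
  have S: "filterlim (\<lambda>i. real (Suc i)) at_top sequentially"
    using filterlim_real_sequentially by (rule filterlim_compose[OF _ filterlim_Suc])
  {
    assume "0 < L"
    then have "filterlim (\<lambda>i. l i * real (Suc i)) at_top sequentially"
      using assms S by (intro filterlim_tendsto_pos_mult_at_top)
    then have "\<forall>\<^sub>F i in sequentially. 1 - \<sigma> \<le> l i * real (Suc i)" by (simp add: filterlim_at_top)
    then show "\<forall>\<^sub>F i in sequentially. smooth_step (l i * real (Suc i) + \<sigma>) = 1"
      by eventually_elim (rule smooth_step_1, simp)
  }
  {
    assume "L < 0"
    then have "filterlim (\<lambda>i. - l i * real (Suc i)) at_top sequentially"
      using assms S by (intro filterlim_tendsto_pos_mult_at_top[of _ "- L"]) (auto intro: tendsto_minus)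
    then have "\<forall>\<^sub>F i in sequentially. \<sigma> \<le> - l i * real (Suc i)" by (simp add: filterlim_at_top)
    then show "\<forall>\<^sub>F i in sequentially. smooth_step (l i * real (Suc i) + \<sigma>) = 0"
      by eventually_elim (rule smooth_step_0, simp)
  }
qed

section \<open>Test functions of class C^1\<close>

lemma C1_with_gradient_continuous:
  assumes "C1_with_gradient \<phi> G"
  shows "continuous_on A \<phi>" "continuous_on A G"
  using assms unfolding C1_with_gradient_def
  by (auto intro: continuous_at_imp_continuous_on GDERIV_isCont continuous_on_subset)

lemma C1_with_gradient_mult:
  assumes "C1_with_gradient \<phi> G" "C1_with_gradient \<psi> \<Psi>"
  shows "C1_with_gradient (\<lambda>x. \<phi> x * \<psi> x) (\<lambda>x. \<phi> x *\<^sub>R \<Psi> x + \<psi> x *\<^sub>R G x)"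
  unfolding C1_with_gradient_def
proof
  show "\<forall>x. GDERIV (\<lambda>x. \<phi> x * \<psi> x) x :> \<phi> x *\<^sub>R \<Psi> x + \<psi> x *\<^sub>R G x"
    using assms by (auto simp: C1_with_gradient_def intro: GDERIV_mult)
  show "continuous_on UNIV (\<lambda>x. \<phi> x *\<^sub>R \<Psi> x + \<psi> x *\<^sub>R G x)"
    by (intro continuous_intros C1_with_gradient_continuous[OF assms(1)]
        C1_with_gradient_continuous[OF assms(2)])
qed

lemma C1_with_gradient_prod:
  assumes "finite I" "\<And>i. i \<in> I \<Longrightarrow> C1_with_gradient (f i) (G i)"
  shows "C1_with_gradient (\<lambda>x. \<Prod>i\<in>I. f i x) (\<lambda>x. \<Sum>i\<in>I. (\<Prod>j\<in>I - {i}. f j x) *\<^sub>R G i x)"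
  unfolding C1_with_gradient_def
proof
  have d: "((\<lambda>x. f i x) has_derivative (\<lambda>h. h \<bullet> G i x)) (at x)" if "i \<in> I" for i x
    using assms(2)[OF that] by (simp add: C1_with_gradient_def gderiv_def)
  show "\<forall>x. GDERIV (\<lambda>x. \<Prod>i\<in>I. f i x) x :> (\<Sum>i\<in>I. (\<Prod>j\<in>I - {i}. f j x) *\<^sub>R G i x)"
  proof
    fix x
    have "((\<lambda>x. \<Prod>i\<in>I. f i x) has_derivative (\<lambda>h. \<Sum>i\<in>I. (h \<bullet> G i x) * (\<Prod>j\<in>I - {i}. f j x))) (at x)"
      by (rule has_derivative_prod) (rule d)
    then show "GDERIV (\<lambda>x. \<Prod>i\<in>I. f i x) x :> (\<Sum>i\<in>I. (\<Prod>j\<in>I - {i}. f j x) *\<^sub>R G i x)"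
      unfolding gderiv_def by (simp add: inner_sum_right mult.commute)
  qed
  show "continuous_on UNIV (\<lambda>x. \<Sum>i\<in>I. (\<Prod>j\<in>I - {i}. f j x) *\<^sub>R G i x)"
    using assms(2)[THEN C1_with_gradient_continuous(1)] assms(2)[THEN C1_with_gradient_continuous(2)]
    by (intro continuous_intros) auto
qed

lemma L2_set_integrable:
  fixes g :: "real ^ 'd \<Rightarrow> real"
  assumes \<Omega>: "\<Omega> \<in> sets lebesgue" "bounded \<Omega>" and g: "L2 \<Omega> g"
  shows "set_integrable lebesgue \<Omega> g"
proof -
  have "\<Omega> \<in> lmeasurable" using \<Omega> bounded_set_imp_lmeasurable by blast
  then have "integrable lebesgue (indicator \<Omega> :: _ \<Rightarrow> real)"
    by (auto simp: fmeasurable_def intro: integrable_real_indicator)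
  then have "L2 \<Omega> (\<lambda>x. 1 :: real)"
    using \<Omega> unfolding L2_def set_borel_measurable_def set_integrable_def by simp
  from L2_inner_integrable[OF g this] show ?thesis by simp
qed

lemma is_weak_divD:
  assumes "is_weak_div \<Omega> w g" "C1_with_gradient \<phi> G" "compact (closure {x. \<phi> x \<noteq> 0})"
    "closure {x. \<phi> x \<noteq> 0} \<subseteq> \<Omega>"
  shows "(LINT x:\<Omega>|lebesgue. w x \<bullet> G x) = - (LINT x:\<Omega>|lebesgue. g x * \<phi> x)"
  using assms(1)[unfolded is_weak_div_def, THEN conjunct2, rule_format, of \<phi> G] assms(2-4) by simp

lemma frontier_AE_convex:
  fixes K :: "(real ^ 'd) set"
  assumes "convex K" "closed K"
  shows "AE x in lebesgue. x \<in> interior K \<or> x \<notin> K"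
proof -
  have "negligible (frontier K)" using assms(1) by (rule negligible_convex_frontier)
  then have "AE x in lebesgue. x \<notin> frontier K"
    by (simp add: negligible_iff_null_sets AE_not_in)
  then show ?thesis by eventually_elim (use assms(2) in \<open>auto simp: frontier_def\<close>)
qed

section \<open>Cut-off functions and normal traces on one polytope\<close>

context convex_body
begin

abbreviation facets :: "(real ^ 'd) set set" where
  "facets \<equiv> {F. F facet_of K}"

text \<open>The transition takes place at distances between \<open>- \<sigma> F / Suc i\<close> and
  \<open>(1 - \<sigma> F) / Suc i\<close> from the facet. Shift 0 puts it just inside the facet
  hyperplane, shift 1 just outside, and shift -1 at a positive distance inside.\<close>

abbreviation step :: "((real ^ 'd) set \<Rightarrow> real) \<Rightarrow> nat \<Rightarrow> (real ^ 'd) set \<Rightarrow> real ^ 'd \<Rightarrow> real" where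
  "step \<sigma> i F x \<equiv> smooth_step (facet_dist K F x * real (Suc i) + \<sigma> F)"

definition cutoff :: "((real ^ 'd) set \<Rightarrow> real) \<Rightarrow> nat \<Rightarrow> real ^ 'd \<Rightarrow> real" where
  "cutoff \<sigma> i x = (\<Prod>F\<in>facets. step \<sigma> i F x)"

definition cutoff_gradient :: "((real ^ 'd) set \<Rightarrow> real) \<Rightarrow> nat \<Rightarrow> real ^ 'd \<Rightarrow> real ^ 'd" where
  "cutoff_gradient \<sigma> i x = (\<Sum>F\<in>facets. (\<Prod>F'\<in>facets - {F}. step \<sigma> i F' x) *\<^sub>R
     (- (smooth_step_deriv (facet_dist K F x * real (Suc i) + \<sigma> F) * real (Suc i)) *\<^sub>R outer_normal K F))"

lemma C1_cutoff: "C1_with_gradient (cutoff \<sigma> i) (cutoff_gradient \<sigma> i)"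
proof -
  have "C1_with_gradient (\<lambda>x. step \<sigma> i F x)
    (\<lambda>x. - (smooth_step_deriv (facet_dist K F x * real (Suc i) + \<sigma> F) * real (Suc i)) *\<^sub>R outer_normal K F)" for F
    unfolding C1_with_gradient_def
  proof
    show "\<forall>x. GDERIV (\<lambda>x. step \<sigma> i F x) x :>
        - (smooth_step_deriv (facet_dist K F x * real (Suc i) + \<sigma> F) * real (Suc i)) *\<^sub>R outer_normal K F"
    proof
      fix x
      have "((\<lambda>x. facet_dist K F x * real (Suc i) + \<sigma> F) has_derivative
          (\<lambda>h. - (outer_normal K F \<bullet> h) * real (Suc i))) (at x)"
        unfolding facet_dist_def by (auto intro!: derivative_eq_intros)
      from has_derivative_compose[OF this smooth_step_has_deriv[unfolded has_field_derivative_def]]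
      show "GDERIV (\<lambda>x. step \<sigma> i F x) x :>
        - (smooth_step_deriv (facet_dist K F x * real (Suc i) + \<sigma> F) * real (Suc i)) *\<^sub>R outer_normal K F"
        unfolding gderiv_def by (simp add: inner_commute mult_ac)
    qed
    show "continuous_on UNIV (\<lambda>x. - (smooth_step_deriv (facet_dist K F x * real (Suc i) + \<sigma> F) * real (Suc i)) *\<^sub>R outer_normal K F)"
      unfolding facet_dist_def
      by (intro continuous_intros continuous_on_compose2[OF continuous_smooth_step_deriv[of UNIV]]) auto
  qed
  from C1_with_gradient_prod[OF finite_facets this] show ?thesis
    unfolding cutoff_def[abs_def] cutoff_gradient_def[abs_def] .
qed

lemma L2_interior_continuous:
  assumes "continuous_on UNIV (f :: real ^ 'd \<Rightarrow> real)"
  shows "L2 (interior K) f"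
proof (rule L2_subset[OF _ _ interior_subset])
  show "L2 K f" by (intro L2_continuous compact continuous_on_subset[OF assms]) simp
qed simp

lemma borel_measurable_cutoff: "cutoff \<sigma> i \<in> borel_measurable lebesgue"
  by (intro measurable_completion)
    (simp add: borel_measurable_continuous_onI C1_with_gradient_continuous(1)[OF C1_cutoff])

lemma cutoff_bounds: "0 \<le> cutoff \<sigma> i x" "cutoff \<sigma> i x \<le> 1"
  unfolding cutoff_def by (auto intro!: prod_nonneg prod_le_1 simp: smooth_step_bounds)

lemma continuous_facet_dist [continuous_intros]:
  "continuous_on A f \<Longrightarrow> continuous_on A (\<lambda>x. facet_dist K F (f x))"
  unfolding facet_dist_def by (intro continuous_intros)

text \<open>With all facets this gives the pointwise limit of the cut-off; with all facets but one
  it gives the factor that remains in the strip along that one, evaluated at points approaching the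
  facet.\<close>

lemma step_prod_eventually:
  assumes "\<And>F. F \<in> A \<Longrightarrow> F \<in> facets" "x \<longlonglongrightarrow> X"
  shows "(\<And>F. F \<in> A \<Longrightarrow> 0 < facet_dist K F X) \<Longrightarrow>
      \<forall>\<^sub>F i in sequentially. (\<Prod>F\<in>A. step \<sigma> i F (x i)) = 1"
    and "F \<in> A \<Longrightarrow> facet_dist K F X < 0 \<Longrightarrow>
      \<forall>\<^sub>F i in sequentially. (\<Prod>F\<in>A. step \<sigma> i F (x i)) = 0"
proof -
  have fin: "finite A" using assms(1) finite_facets by (meson finite_subset subsetI)
  have lim: "(\<lambda>i. facet_dist K F (x i)) \<longlonglongrightarrow> facet_dist K F X" for F
    unfolding facet_dist_def by (intro tendsto_intros assms(2))
  {
    assume "\<And>F. F \<in> A \<Longrightarrow> 0 < facet_dist K F X"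
    then have "\<forall>\<^sub>F i in sequentially. \<forall>F\<in>A. step \<sigma> i F (x i) = 1"
      using smooth_step_scaled_eventually(1)[OF lim] fin by (intro eventually_ball_finite) auto
    then show "\<forall>\<^sub>F i in sequentially. (\<Prod>F\<in>A. step \<sigma> i F (x i)) = 1"
      by eventually_elim simp
  }
  {
    assume F: "F \<in> A" "facet_dist K F X < 0"
    from smooth_step_scaled_eventually(2)[OF lim F(2)]
    show "\<forall>\<^sub>F i in sequentially. (\<Prod>F\<in>A. step \<sigma> i F (x i)) = 0"
      by eventually_elim (use F fin in auto)
  }
qed

lemma cutoff_tendsto:
  assumes "x \<in> interior K \<or> x \<notin> K"
  shows "(\<lambda>i. cutoff \<sigma> i x) \<longlonglongrightarrow> indicator (interior K) x"
proof (cases "x \<in> interior K")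
  case True
  then have "\<forall>\<^sub>F i in sequentially. cutoff \<sigma> i x = 1"
    unfolding cutoff_def by (intro step_prod_eventually(1)[of _ "\<lambda>i. x" x]) (auto simp: mem_interior_iff)
  then show ?thesis using True by (simp add: tendsto_eventually)
next
  case False
  then obtain F where "F facet_of K" "facet_dist K F x < 0"
    using assms mem_body_iff[of x] by (auto simp: not_le)
  then have "\<forall>\<^sub>F i in sequentially. cutoff \<sigma> i x = 0"
    unfolding cutoff_def by (intro step_prod_eventually(2)[of _ "\<lambda>i. x" x F]) auto
  then show ?thesis using False by (simp add: tendsto_eventually)
qed

lemma integral_cutoff_tendsto:
  assumes g: "integrable lebesgue g"
  shows "(\<lambda>i. LINT x|lebesgue. cutoff \<sigma> i x * g x) \<longlonglongrightarrow>
    (LINT x|lebesgue. indicator (interior K) x * g x)"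
proof (rule integral_dominated_convergence[where w = "\<lambda>x. \<bar>g x\<bar>"])
  have gm: "g \<in> borel_measurable lebesgue" using g by auto
  show "(\<lambda>x. cutoff \<sigma> i x * g x) \<in> borel_measurable lebesgue" for i
    by (intro borel_measurable_times borel_measurable_cutoff gm)
  have "interior K \<in> sets lebesgue" by auto
  then show "(\<lambda>x. indicator (interior K) x * g x) \<in> borel_measurable lebesgue"
    using gm by (intro borel_measurable_times borel_measurable_indicator)
  show "AE x in lebesgue. (\<lambda>i. cutoff \<sigma> i x * g x) \<longlonglongrightarrow> indicator (interior K) x * g x"
    using frontier_AE_convex[OF convex closed]
    by eventually_elim (intro tendsto_mult_right cutoff_tendsto)
  show "AE x in lebesgue. norm (cutoff \<sigma> i x * g x) \<le> \<bar>g x\<bar>" for i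
  proof (rule AE_I2)
    fix x
    show "norm (cutoff \<sigma> i x * g x) \<le> \<bar>g x\<bar>"
      using cutoff_bounds[of \<sigma> i x] by (simp add: abs_mult mult_left_le_one_le)
  qed
  show "integrable lebesgue (\<lambda>x. \<bar>g x\<bar>)" using g by simp
qed

text \<open>Needed because the function chosen by \<open>weak_div\<close> and the one in
  \<open>H0_div\<close> may differ. Cut-offs with compact support in the interior of
  \<open>K\<close> make \<open>\<psi>\<close> an admissible test function for both, and their limit
  removes the cut-off.\<close>

lemma weak_div_interior_unique:
  fixes w :: "real ^ 'd \<Rightarrow> real ^ 'd"
  assumes \<Omega>: "open \<Omega>" "bounded \<Omega>" "interior K \<subseteq> \<Omega>"
    and g1: "is_weak_div \<Omega> w g1" and g2: "is_weak_div \<Omega> w g2" and \<psi>: "C1_with_gradient \<psi> \<Psi>"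
  shows "(LINT x|lebesgue. indicator (interior K) x * (g1 x * \<psi> x)) =
    (LINT x|lebesgue. indicator (interior K) x * (g2 x * \<psi> x))"
proof -
  have \<Omega>s: "\<Omega> \<in> sets lebesgue" using \<Omega>(1) by (simp add: borel_open)
  \<comment> \<open>The shift -1 makes the cut-off vanish wherever some facet is closer than
    \<open>1 / Suc i\<close>, which yields a support inside the open element.\<close>
  define \<kappa> where "\<kappa> = cutoff (\<lambda>_. -1)"
  have \<kappa>0: "facet_dist K F x \<ge> 1 / real (Suc i)" if "\<kappa> i x \<noteq> 0" "F \<in> facets" for i x F
  proof (rule ccontr)
    assume "\<not> ?thesis"
    then have "facet_dist K F x * real (Suc i) + -1 \<le> 0" by (simp add: field_simps)
    then have "step (\<lambda>_. -1) i F x = 0" by (rule smooth_step_0)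
    then have "\<kappa> i x = 0" unfolding \<kappa>_def cutoff_def using that(2) finite_facets
      by (intro prod_zero) auto
    with that show False by simp
  qed
  have int_eq: "(LINT x|lebesgue. \<kappa> i x * (indicator \<Omega> x * (g1 x * \<psi> x))) =
      (LINT x|lebesgue. \<kappa> i x * (indicator \<Omega> x * (g2 x * \<psi> x)))" for i
  proof -
    define \<phi> where "\<phi> = (\<lambda>x. \<kappa> i x * \<psi> x)"
    define L where "L = (\<Inter>F\<in>facets. {x. 1 / real (Suc i) \<le> facet_dist K F x})"
    have clL: "closed L" unfolding L_def
      by (intro closed_INT ballI closed_Collect_le continuous_intros)
    have LK: "L \<subseteq> interior K"
    proof
      fix x assume "x \<in> L"
      have "0 < facet_dist K F x" if "F facet_of K" for F
      proof -
        have "1 / real (Suc i) \<le> facet_dist K F x" using \<open>x \<in> L\<close> that unfolding L_def by blast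
        moreover have "0 < 1 / real (Suc i)" by simp
        ultimately show ?thesis by linarith
      qed
      then show "x \<in> interior K" by (simp add: mem_interior_iff)
    qed
    have "{x. \<phi> x \<noteq> 0} \<subseteq> L" unfolding \<phi>_def L_def using \<kappa>0[of i] by auto
    then have cl: "closure {x. \<phi> x \<noteq> 0} \<subseteq> L" using clL by (rule closure_minimal)
    then have "closure {x. \<phi> x \<noteq> 0} \<subseteq> K" using LK interior_subset by blast
    then have "{x. \<phi> x \<noteq> 0} \<subseteq> K" using closure_subset by (rule order_trans[rotated])
    then have "bounded {x. \<phi> x \<noteq> 0}"
      by (rule bounded_subset[OF compact_imp_bounded[OF compact]])
    then have "compact (closure {x. \<phi> x \<noteq> 0})" unfolding compact_closure .
    moreover have "closure {x. \<phi> x \<noteq> 0} \<subseteq> \<Omega>" using cl LK \<Omega>(3) by blast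
    moreover have "C1_with_gradient \<phi> (\<lambda>x. \<kappa> i x *\<^sub>R \<Psi> x + \<psi> x *\<^sub>R cutoff_gradient (\<lambda>_. -1) i x)"
      unfolding \<phi>_def \<kappa>_def by (rule C1_with_gradient_mult[OF C1_cutoff \<psi>])
    ultimately have "(LINT x:\<Omega>|lebesgue. g1 x * \<phi> x) = (LINT x:\<Omega>|lebesgue. g2 x * \<phi> x)"
      using is_weak_divD[OF g1] is_weak_divD[OF g2] by simp
    then show ?thesis by (simp add: set_lebesgue_integral_def \<phi>_def mult_ac)
  qed
  have lim: "(\<lambda>i. LINT x|lebesgue. \<kappa> i x * (indicator \<Omega> x * (g x * \<psi> x))) \<longlonglongrightarrow>
      (LINT x|lebesgue. indicator (interior K) x * (g x * \<psi> x))" if g: "L2 \<Omega> g" for g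
  proof -
    have "L2 \<Omega> \<psi>"
    proof -
      have c: "compact (closure \<Omega>)" using \<Omega>(2) by (simp add: compact_closure)
      have "L2 (closure \<Omega>) \<psi>" by (intro L2_continuous c C1_with_gradient_continuous(1)[OF \<psi>])
      then show ?thesis using \<Omega>s closure_subset by (rule L2_subset)
    qed
    from L2_inner_integrable[OF g this]
    have "integrable lebesgue (\<lambda>x. indicator \<Omega> x * (g x * \<psi> x))" by (simp add: set_integrable_def)
    from integral_cutoff_tendsto[OF this, of "\<lambda>_. -1"]
    have "(\<lambda>i. LINT x|lebesgue. \<kappa> i x * (indicator \<Omega> x * (g x * \<psi> x))) \<longlonglongrightarrow>
        (LINT x|lebesgue. indicator (interior K) x * (indicator \<Omega> x * (g x * \<psi> x)))"
      by (simp add: \<kappa>_def)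
    also have "(\<lambda>x. indicator (interior K) x * (indicator \<Omega> x * (g x * \<psi> x))) =
        (\<lambda>x. indicator (interior K) x * (g x * \<psi> x))"
      using \<Omega>(3) by (auto simp: indicator_def fun_eq_iff)
    finally show ?thesis .
  qed
  have "L2 \<Omega> g1" "L2 \<Omega> g2" using g1 g2 by (auto simp: is_weak_div_def)
  from LIMSEQ_unique[OF lim[OF this(1), unfolded int_eq] lim[OF this(2)]] show ?thesis .
qed

lemma hyperplane_piece_facet:
  assumes "F facet_of K"
  shows "hyperplane_piece F (outer_normal K F) (facet_offset K F)"
proof
  show "compact F"
    using compact_Int_closed[OF compact closed_hyperplane[of "outer_normal K F" "facet_offset K F"]]
      facet_hyperplane(3)[OF assms] by simp
qed (use facet_hyperplane[OF assms] in auto)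

abbreviation facet_proj :: "(real ^ 'd) set \<Rightarrow> real ^ 'd \<Rightarrow> real ^ 'd" where
  "facet_proj F \<equiv> hyperplane_proj (outer_normal K F) (facet_offset K F)"

text \<open>Composed with the projection, the distance from another facet is an affine function c -
  m . y. As the two facet hyperplanes differ, m and c do not both vanish, and the zero set is
  negligible.\<close>

lemma facet_dist_proj_nonzero_AE:
  assumes F: "F facet_of K" and F': "F' facet_of K" "F' \<noteq> F"
  shows "AE y in lborel. facet_dist K F' (facet_proj F y) \<noteq> 0"
proof -
  define n b n' b' where "n = outer_normal K F" and "b = facet_offset K F"
    and "n' = outer_normal K F'" and "b' = facet_offset K F'"
  define m c where "m = n' - (n' \<bullet> n) *\<^sub>R n" and "c = b' - b * (n' \<bullet> n)"
  have nn: "n \<bullet> n = 1" using facet_hyperplane(1)[OF F] by (simp add: n_def dot_square_norm)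
  have eq: "facet_dist K F' (facet_proj F y) = c - m \<bullet> y" for y
    by (simp add: facet_dist_def hyperplane_proj_def n_def b_def n'_def b'_def m_def c_def
        inner_add_right inner_diff_left algebra_simps)
  have "m \<noteq> 0 \<or> c \<noteq> 0"
  proof (rule ccontr)
    assume "\<not> ?thesis"
    then have "m = 0" "c = 0" by auto
    then have "n' = (n' \<bullet> n) *\<^sub>R n" "b' = b * (n' \<bullet> n)" by (simp_all add: m_def c_def)
    then have "n' \<bullet> x = b'" if "n \<bullet> x = b" for x
      using that by (metis inner_scaleR_left mult.commute)
    then show False using distinct_facets[OF F F'(1)] F'(2) by (auto simp: n_def b_def n'_def b'_def)
  qed
  then have "negligible {y. m \<bullet> y = c}" by (rule negligible_hyperplane)
  moreover have "{y. m \<bullet> y = c} \<in> sets borel" by (simp add: closed_hyperplane borel_closed)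
  ultimately have "{y. m \<bullet> y = c} \<in> null_sets lborel"
    by (simp add: negligible_iff_null_sets null_sets_completion_iff)
  then have "AE y in lborel. y \<notin> {y. m \<bullet> y = c}" by (rule AE_not_in)
  then show ?thesis by eventually_elim (simp add: eq)
qed

lemma facet_dist_proj_nonzero_AE_all:
  assumes F: "F facet_of K"
  shows "AE y in lborel. \<forall>F'\<in>facets - {F}. facet_dist K F' (facet_proj F y) \<noteq> 0"
  using finite_facets facet_dist_proj_nonzero_AE[OF F] by (intro AE_finite_allI) auto

lemma facet_dist_proj_self: "F facet_of K \<Longrightarrow> facet_dist K F (facet_proj F y) = 0"
  using inner_hyperplane_proj[OF facet_hyperplane(1), of F] by (simp add: facet_dist_def)

text \<open>A projected point in \<open>F\<close> has nonnegative distances from all facets, and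
  almost every one avoids the other facet hyperplanes.\<close>

lemma normal_trace_AE:
  assumes F: "F facet_of K"
  shows "AE y in lborel. facet_proj F y \<in> F \<longrightarrow> generic F (facet_proj F y)"
  using facet_dist_proj_nonzero_AE_all[OF F]
proof eventually_elim
  case (elim y)
  show ?case
  proof
    assume y: "facet_proj F y \<in> F"
    then have "0 \<le> facet_dist K F' (facet_proj F y)" if "F' facet_of K" for F'
      using that mem_body_iff facet_of_imp_subset[OF F] by blast
    with elim y show "generic F (facet_proj F y)"
      by (force simp: generic_def order_le_less)
  qed
qed

text \<open>
  Testing with \<open>cutoff \<sigma> i * \<psi>\<close> and letting \<open>i \<rightarrow> \<infinity>\<close>. The gradient of the cut-off concentrates on the
  facets, inside \<open>K\<close> where \<open>\<sigma> = 0\<close> and outside \<open>K\<close> where \<open>\<sigma> = 1\<close>, so that for each facet one may choose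
  from which side the normal component of \<open>v\<close> is taken.
\<close>

lemma normal_trace_identity:
  fixes v :: "real ^ 'd \<Rightarrow> real ^ 'd" and g \<psi> :: "real ^ 'd \<Rightarrow> real"
  assumes v: "v \<in> borel_measurable borel" "\<And>x. norm (v x) \<le> V" "\<And>x. R < norm x \<Longrightarrow> v x = 0"
    and g: "integrable lebesgue g" "\<And>x. R < norm x \<Longrightarrow> g x = 0"
    and H: "\<And>\<phi> G. C1_with_gradient \<phi> G \<Longrightarrow> (LINT x|lebesgue. v x \<bullet> G x + g x * \<phi> x) = 0"
    and \<psi>: "C1_with_gradient \<psi> \<Psi>"
    and \<sigma>: "\<And>F. F facet_of K \<Longrightarrow> \<sigma> F = 0 \<or> \<sigma> F = 1"
    and \<gamma>: "\<And>F. F facet_of K \<Longrightarrow> \<gamma> F \<in> borel_measurable borel"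
    and lim: "\<And>F. F facet_of K \<Longrightarrow> AE y in lborel. generic F (facet_proj F y) \<longrightarrow>
      (\<forall>\<tau>. 0 < \<tau> + \<sigma> F \<and> \<tau> + \<sigma> F < 1 \<longrightarrow>
        (\<lambda>i. v (facet_proj F y - (1 / real (Suc i) * \<tau>) *\<^sub>R outer_normal K F) \<bullet> outer_normal K F)
          \<longlonglongrightarrow> \<gamma> F (facet_proj F y))"
  shows "(LINT x|lebesgue. indicator (interior K) x * (v x \<bullet> \<Psi> x + g x * \<psi> x)) =
    (\<Sum>F\<in>facets. LINT x|surface_measure F. \<gamma> F x * \<psi> x)"
proof -
  note [measurable] = v(1)
  have \<psi>c: "continuous_on UNIV \<psi>" "continuous_on UNIV \<Psi>"
    using C1_with_gradient_continuous[OF \<psi>] by auto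
  have \<psi>m [measurable]: "\<psi> \<in> borel_measurable borel" "\<Psi> \<in> borel_measurable borel"
    using \<psi>c by (auto intro: borel_measurable_continuous_onI)
  obtain P where P: "\<And>x. x \<in> cball 0 R \<Longrightarrow> \<bar>\<psi> x\<bar> \<le> P" "\<And>x. x \<in> cball 0 R \<Longrightarrow> norm (\<Psi> x) \<le> P" "0 \<le> P"
  proof -
    have "bounded (\<psi> ` cball 0 R)" "bounded (\<Psi> ` cball 0 R)"
      by (intro compact_imp_bounded compact_continuous_image compact_cball
          continuous_on_subset[OF \<psi>c(1)] continuous_on_subset[OF \<psi>c(2)] subset_UNIV)+
    then obtain P1 P2 where "\<And>x. x \<in> cball 0 R \<Longrightarrow> \<bar>\<psi> x\<bar> \<le> P1" "\<And>x. x \<in> cball 0 R \<Longrightarrow> norm (\<Psi> x) \<le> P2"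
      unfolding bounded_iff by force
    then show thesis by (intro that[of "max 0 (max P1 P2)"]) (auto simp: le_max_iff_disj)
  qed
  have V: "0 \<le> V" using v(2)[of 0] norm_ge_zero order_trans by blast
  define q where "q x = v x \<bullet> \<Psi> x + g x * \<psi> x" for x
  have bounded_int: "integrable lborel f"
    if "f \<in> borel_measurable borel" "\<And>x. \<bar>f x\<bar> \<le> M" "\<And>x. R < norm x \<Longrightarrow> f x = 0"
    for f :: "real ^ 'd \<Rightarrow> real" and M
  proof (rule Bochner_Integration.integrable_bound[OF _ _ AE_I2])
    show "integrable lborel (\<lambda>x::real ^ 'd. indicator (cball 0 R) x *\<^sub>R M)"
      by (intro integrable_scaleR_left integrable_real_indicator emeasure_bounded_finite) auto
    show "norm (f x) \<le> norm (indicator (cball 0 R) x *\<^sub>R M)" for x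
      using that(2)[of x] that(3)[of x] by (cases "x \<in> cball 0 R") auto
  qed (use that in auto)
  have q_int: "integrable lebesgue q"
    unfolding q_def
  proof (rule Bochner_Integration.integrable_add)
    have "integrable lborel (\<lambda>x. v x \<bullet> \<Psi> x)"
    proof (rule bounded_int[where M = "V * P"])
      show "\<bar>v x \<bullet> \<Psi> x\<bar> \<le> V * P" for x
      proof (cases "R < norm x")
        case False
        have "\<bar>v x \<bullet> \<Psi> x\<bar> \<le> norm (v x) * norm (\<Psi> x)" by (rule Cauchy_Schwarz_ineq2)
        also have "\<dots> \<le> V * P" using False V by (intro mult_mono v(2) P(2)) auto
        finally show ?thesis .
      qed (use v(3) V P in simp)
    qed (use v(3) in auto)
    then show "integrable lebesgue (\<lambda>x. v x \<bullet> \<Psi> x)" by (simp add: integrable_completion)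
    show "integrable lebesgue (\<lambda>x. g x * \<psi> x)"
    proof (rule Bochner_Integration.integrable_bound[OF _ _ AE_I2])
      show "integrable lebesgue (\<lambda>x. P * \<bar>g x\<bar>)" using g(1) by simp
      have "\<psi> \<in> borel_measurable lebesgue" by (intro measurable_completion) simp
      then show "(\<lambda>x. g x * \<psi> x) \<in> borel_measurable lebesgue" using g(1) by (intro borel_measurable_times) auto
      show "norm (g x * \<psi> x) \<le> norm (P * \<bar>g x\<bar>)" for x
      proof (cases "R < norm x")
        case False
        then have "\<bar>\<psi> x\<bar> * \<bar>g x\<bar> \<le> P * \<bar>g x\<bar>" by (intro mult_right_mono P(1)) auto
        then show ?thesis using P(3) by (simp add: abs_mult mult.commute)
      qed (use g(2) in simp)
    qed
  qed
  define k where "k F \<tau> = smooth_step_deriv (\<tau> + \<sigma> F)" for F \<tau>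
  define G where "G F i x = (\<Prod>F'\<in>facets - {F}. step \<sigma> i F' x) * (\<psi> x * (v x \<bullet> outer_normal K F))"
    for F i x
  define e where "e i = 1 / real (Suc i)" for i
  \<comment> \<open>The share of the facet \<open>F\<close> in minus \<open>\<psi>\<close> times the
    product of \<open>v\<close> with the gradient of the cut-off, written in the shape that
    \<open>strip_limit\<close> expects.\<close>
  define strip where "strip F i x = 1 / e i * k F ((facet_offset K F - outer_normal K F \<bullet> x) / e i) * G F i x" for F i x
  have e: "0 < e i" "e i \<le> 1" for i by (simp_all add: e_def)
  have step_m [measurable]: "step \<sigma> i F' \<in> borel_measurable borel" for i F'
    by (intro borel_measurable_continuous_onI continuous_intros
        continuous_on_compose2[OF continuous_smooth_step[of UNIV]]) auto
  have k_m [measurable]: "k F \<in> borel_measurable borel" for F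
    unfolding k_def by (intro borel_measurable_continuous_onI continuous_intros
        continuous_on_compose2[OF continuous_smooth_step_deriv[of UNIV]]) auto
  have G_m [measurable]: "G F i \<in> borel_measurable borel" for F i
    unfolding G_def by measurable
  have step_prod: "\<bar>\<Prod>F'\<in>A. step \<sigma> i F' x\<bar> \<le> 1" for A i x
    by (auto simp: abs_prod smooth_step_bounds intro!: prod_le_1)
  have G_le: "\<bar>G F i x\<bar> \<le> P * V" if F: "F facet_of K" for F i x
  proof (cases "R < norm x")
    case False
    have "\<bar>v x \<bullet> outer_normal K F\<bar> \<le> V"
      using Cauchy_Schwarz_ineq2[of "v x" "outer_normal K F"] facet_hyperplane(1)[OF F] v(2)[of x] by simp
    then have "\<bar>\<psi> x\<bar> * \<bar>v x \<bullet> outer_normal K F\<bar> \<le> P * V"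
      using False P(3) by (intro mult_mono P(1)) auto
    then have "\<bar>\<Prod>F'\<in>facets - {F}. step \<sigma> i F' x\<bar> * (\<bar>\<psi> x\<bar> * \<bar>v x \<bullet> outer_normal K F\<bar>) \<le> 1 * (P * V)"
      by (rule mult_mono[OF step_prod]) auto
    then show ?thesis by (simp add: G_def abs_mult)
  qed (use v(3) V P(3) in \<open>simp add: G_def\<close>)
  have G_0: "G F i x = 0" if "R < norm x" for F i x using v(3)[OF that] by (simp add: G_def)
  have strip_m [measurable]: "strip F i \<in> borel_measurable borel" for F i
    unfolding strip_def by measurable
  have strip_int: "integrable lborel (\<lambda>x. strip F i x)"
    if F: "F facet_of K" for F i
  proof (rule bounded_int[where M = "1 / e i * 4 * (P * V)"])
    show "\<bar>strip F i x\<bar> \<le> 1 / e i * 4 * (P * V)" for x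
      unfolding strip_def abs_mult using smooth_step_deriv_bounds e(1)[of i]
      by (intro mult_mono G_le[OF F]) (auto simp: k_def)
  qed (use G_0 in \<open>auto simp: strip_def\<close>)
  \<comment> \<open>The tested identity, with the gradient of the cut-off moved to the right-hand
    side.\<close>
  have split: "(LINT x|lebesgue. cutoff \<sigma> i x * q x) =
      (\<Sum>F\<in>facets. LINT x|lborel. strip F i x)" for i
  proof -
    have "C1_with_gradient (\<lambda>x. cutoff \<sigma> i x * \<psi> x)
        (\<lambda>x. cutoff \<sigma> i x *\<^sub>R \<Psi> x + \<psi> x *\<^sub>R cutoff_gradient \<sigma> i x)"
      by (rule C1_with_gradient_mult[OF C1_cutoff \<psi>])
    from H[OF this]
    have "0 = (LINT x|lebesgue. v x \<bullet> (cutoff \<sigma> i x *\<^sub>R \<Psi> x + \<psi> x *\<^sub>R cutoff_gradient \<sigma> i x) +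
        g x * (cutoff \<sigma> i x * \<psi> x))" by simp
    also have "(\<lambda>x. v x \<bullet> (cutoff \<sigma> i x *\<^sub>R \<Psi> x + \<psi> x *\<^sub>R cutoff_gradient \<sigma> i x) +
        g x * (cutoff \<sigma> i x * \<psi> x)) =
      (\<lambda>x. cutoff \<sigma> i x * q x -
        (\<Sum>F\<in>facets. strip F i x))"
    proof
      fix x
      have "v x \<bullet> cutoff_gradient \<sigma> i x * \<psi> x =
          - (\<Sum>F\<in>facets. strip F i x)"
        unfolding cutoff_gradient_def inner_sum_right sum_distrib_right sum_negf[symmetric]
        by (intro sum.cong refl) (simp add: strip_def k_def G_def e_def facet_dist_def mult_ac)
      then show "v x \<bullet> (cutoff \<sigma> i x *\<^sub>R \<Psi> x + \<psi> x *\<^sub>R cutoff_gradient \<sigma> i x) +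
          g x * (cutoff \<sigma> i x * \<psi> x) = cutoff \<sigma> i x * q x -
        (\<Sum>F\<in>facets. strip F i x)"
        by (simp add: q_def inner_add_right algebra_simps)
    qed
    also have "(LINT x|lebesgue. cutoff \<sigma> i x * q x -
        (\<Sum>F\<in>facets. strip F i x)) =
        (LINT x|lebesgue. cutoff \<sigma> i x * q x) -
        (LINT x|lebesgue. (\<Sum>F\<in>facets. strip F i x))"
    proof (rule Bochner_Integration.integral_diff)
      show "integrable lebesgue (\<lambda>x. cutoff \<sigma> i x * q x)"
      proof (rule Bochner_Integration.integrable_bound[OF q_int _ AE_I2])
        show "(\<lambda>x. cutoff \<sigma> i x * q x) \<in> borel_measurable lebesgue"
          using q_int by (intro borel_measurable_times borel_measurable_cutoff) auto
        show "norm (cutoff \<sigma> i x * q x) \<le> norm (q x)" for x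
          using cutoff_bounds[of \<sigma> i x] by (simp add: abs_mult mult_left_le_one_le)
      qed
      show "integrable lebesgue (\<lambda>x. \<Sum>F\<in>facets. strip F i x)"
        using strip_int by (intro Bochner_Integration.integrable_sum) (simp add: integrable_completion)
    qed
    also have "(LINT x|lebesgue. (\<Sum>F\<in>facets. strip F i x)) =
        (LINT x|lborel. (\<Sum>F\<in>facets. strip F i x))"
      by (rule integral_completion) simp
    also have "\<dots> = (\<Sum>F\<in>facets. LINT x|lborel. strip F i x)"
      using strip_int by (intro Bochner_Integration.integral_sum) simp
    finally show ?thesis by simp
  qed
  have "(\<lambda>i. LINT x|lebesgue. cutoff \<sigma> i x * q x) \<longlonglongrightarrow> (\<Sum>F\<in>facets. LINT x|surface_measure F. \<gamma> F x * \<psi> x)"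
    unfolding split
  proof (rule tendsto_sum)
    fix F assume "F \<in> facets"
    then have F: "F facet_of K" by simp
    interpret S: hyperplane_piece F "outer_normal K F" "facet_offset K F"
      by (rule hyperplane_piece_facet[OF F])
    note [measurable] = \<gamma>[OF F] S.borel_F
    \<comment> \<open>The slab is larger than the prism over \<open>F\<close>; the indicator records
      the limit 0 for projections that miss \<open>F\<close>.\<close>
    define g' where "g' x = indicator F x * (\<gamma> F x * \<psi> x)" for x
    have "(\<lambda>i. LINT x|lborel. 1 / e i * k F ((facet_offset K F - outer_normal K F \<bullet> x) / e i) * G F i x) \<longlonglongrightarrow>
      (LINT \<tau>|lborel. k F \<tau>) *
      (LINT y|lborel. indicator (slab (outer_normal K F) (facet_offset K F)) y * g' (facet_proj F y))"
    proof (rule strip_limit[where A = 4 and B = "P * V" and R = R])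
      show "norm (outer_normal K F) = 1" by (rule S.unit)
      show "\<bar>k F \<tau>\<bar> \<le> 4" for \<tau> using smooth_step_deriv_bounds[of "\<tau> + \<sigma> F"] by (simp add: k_def)
      show "k F \<tau> = 0" if "1 < \<bar>\<tau>\<bar>" for \<tau>
      proof (rule ccontr)
        assume "k F \<tau> \<noteq> 0"
        then have "0 < \<tau> + \<sigma> F \<and> \<tau> + \<sigma> F < 1"
          unfolding k_def by (rule smooth_step_deriv_nonzeroD)
        then show False using \<sigma>[OF F] that by auto
      qed
      show "AE y in lborel. \<forall>\<tau>. k F \<tau> \<noteq> 0 \<longrightarrow>
        (\<lambda>i. G F i (facet_proj F y - (e i * \<tau>) *\<^sub>R outer_normal K F)) \<longlonglongrightarrow> g' (facet_proj F y)"
        using lim[OF F] facet_dist_proj_nonzero_AE_all[OF F]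
      proof eventually_elim
        case (elim y)
        show ?case
        proof (intro allI impI)
          fix \<tau> assume "k F \<tau> \<noteq> 0"
          then have \<tau>: "0 < \<tau> + \<sigma> F \<and> \<tau> + \<sigma> F < 1"
            unfolding k_def by (rule smooth_step_deriv_nonzeroD)
          define x where "x i = facet_proj F y - (e i * \<tau>) *\<^sub>R outer_normal K F" for i
          have e0: "e \<longlonglongrightarrow> 0" using LIMSEQ_inverse_real_of_nat
            by (simp add: e_def[abs_def] inverse_eq_divide)
          have x: "x \<longlonglongrightarrow> facet_proj F y"
          proof -
            have "x \<longlonglongrightarrow> facet_proj F y - (0 * \<tau>) *\<^sub>R outer_normal K F"
              unfolding x_def by (intro tendsto_intros e0)
            then show ?thesis by simp
          qed
          show "(\<lambda>i. G F i (facet_proj F y - (e i * \<tau>) *\<^sub>R outer_normal K F)) \<longlonglongrightarrow> g' (facet_proj F y)"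
          \<comment> \<open>For almost every y no other distance vanishes. Either all are positive
            and the projection is a generic point of \<open>F\<close>, or one is negative and
            eventually annihilates the product of the other steps.\<close>
          proof (cases "\<forall>F'\<in>facets - {F}. 0 < facet_dist K F' (facet_proj F y)")
            case True
            have "facet_proj F y \<in> K"
              unfolding mem_body_iff using True facet_dist_proj_self[OF F, of y]
              by (metis DiffI less_imp_le mem_Collect_eq order_refl singletonD)
            then have yF: "facet_proj F y \<in> F"
              using mem_facet_iff[OF F] facet_dist_proj_self[OF F] by blast
            then have gen: "generic F (facet_proj F y)" using True by (simp add: generic_def)
            have ev: "\<forall>\<^sub>F i in sequentially. (\<Prod>F'\<in>facets - {F}. step \<sigma> i F' (x i)) = 1"
              by (rule step_prod_eventually(1)[OF _ x]) (use True in auto)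
            have "(\<lambda>i. \<psi> (x i)) \<longlonglongrightarrow> \<psi> (facet_proj F y)"
              using \<psi>c(1) x by (metis UNIV_I continuous_on_def filterlim_compose at_within_open open_UNIV
                  tendsto_at_iff_tendsto_nhds continuous_on_eq_continuous_at isCont_tendsto_compose)
            moreover have "(\<lambda>i. v (x i) \<bullet> outer_normal K F) \<longlonglongrightarrow> \<gamma> F (facet_proj F y)"
              using elim(1) gen \<tau> unfolding x_def e_def by blast
            ultimately have "(\<lambda>i. (\<Prod>F'\<in>facets - {F}. step \<sigma> i F' (x i)) *
                (\<psi> (x i) * (v (x i) \<bullet> outer_normal K F))) \<longlonglongrightarrow>
                1 * (\<psi> (facet_proj F y) * \<gamma> F (facet_proj F y))"
              by (intro tendsto_mult tendsto_eventually[OF ev])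
            then show ?thesis unfolding G_def x_def[symmetric]
              using yF by (simp add: g'_def mult.commute)
          next
            case False
            then obtain F' where F': "F' \<in> facets - {F}" "facet_dist K F' (facet_proj F y) < 0"
              using elim(2) by (meson linorder_neqE)
            have "\<forall>\<^sub>F i in sequentially. (\<Prod>F'\<in>facets - {F}. step \<sigma> i F' (x i)) = 0"
              by (rule step_prod_eventually(2)[OF _ x F'(1) F'(2)]) auto
            then have "\<forall>\<^sub>F i in sequentially. G F i (x i) = 0"
              by eventually_elim (simp add: G_def)
            moreover have "facet_proj F y \<notin> F"
              using F' mem_body_iff facet_of_imp_subset[OF F] by (metis Diff_iff mem_Collect_eq not_le subsetD)
            ultimately show ?thesis unfolding x_def[symmetric]
              by (simp add: g'_def tendsto_eventually)
          qed
        qed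
      qed
    qed (use e G_le[OF F] G_0 in \<open>auto simp: g'_def[abs_def]\<close>)
    also have "(LINT \<tau>|lborel. k F \<tau>) = 1" unfolding k_def by (rule integral_smooth_step_deriv)
    also have "(\<lambda>y. indicator (slab (outer_normal K F) (facet_offset K F)) y * g' (facet_proj F y)) =
        (\<lambda>y. indicator S.prism y * (\<gamma> F (facet_proj F y) * \<psi> (facet_proj F y)))"
      by (auto simp: S.prism_def g'_def indicator_def fun_eq_iff)
    also have "1 * (LINT y|lborel. indicator S.prism y * (\<gamma> F (facet_proj F y) * \<psi> (facet_proj F y))) =
        (LINT x|surface_measure F. \<gamma> F x * \<psi> x)"
      by (subst S.surface_integral_eq) auto
    finally show "(\<lambda>i. LINT x|lborel. strip F i x) \<longlonglongrightarrow>
        (LINT x|surface_measure F. \<gamma> F x * \<psi> x)" unfolding strip_def .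
  qed
  from LIMSEQ_unique[OF integral_cutoff_tendsto[OF q_int] this]
  show ?thesis unfolding q_def .
qed

end

section \<open>Meshes\<close>

locale triangulated_domain =
  fixes \<Omega> :: "(real ^ 'd) set" and T :: "(real ^ 'd) set set" and ori :: "(real ^ 'd) set \<Rightarrow> (real ^ 'd) set"
  assumes domain: "polyhedral_domain \<Omega>" and mesh: "simplicial_mesh \<Omega> T" and ori: "orientation T ori"
begin

lemma finite_T: "finite T"
  using mesh by (simp add: simplicial_mesh_def triangulation_def)

lemma Union_T: "\<Union>T = closure \<Omega>"
  using mesh by (simp add: simplicial_mesh_def)

lemma body: "K \<in> T \<Longrightarrow> convex_body K"
proof
  assume K: "K \<in> T"
  then have s: "int CARD('d) simplex K" using mesh by (simp add: simplicial_mesh_def)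
  then show "polytope K" by (rule simplex_imp_polytope)
  have "aff_dim K = int CARD('d)" using s by (rule aff_dim_simplex)
  then have "affine hull K = UNIV" using aff_dim_eq_full[of K] by simp
  moreover have "K \<noteq> {}" using \<open>aff_dim K = int CARD('d)\<close> by auto
  moreover have "convex K" using s by (rule convex_simplex)
  ultimately show "interior K \<noteq> {}"
    using rel_interior_eq_empty[of K] rel_interior_interior[of K] by simp
qed

text \<open>That open elements lie in \<open>\<Omega>\<close>, and not merely in its closure, rests
  on \<open>\<Omega>\<close> being the interior of a closed set: this set contains the closure of
  \<open>\<Omega>\<close>, so passing to interiors gives \<open>\<Omega>\<close> back.\<close>

lemma open_domain: "open \<Omega>" and bounded_domain: "bounded \<Omega>" and
  interior_subset_domain: "K \<in> T \<Longrightarrow> interior K \<subseteq> \<Omega>"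
proof -
  obtain P where P: "finite P" "\<forall>S\<in>P. polytope S" "\<Omega> = interior (\<Union>P)"
    using domain unfolding polyhedral_domain_def by blast
  show "open \<Omega>" using P by simp
  have "bounded (\<Union>P)" using P polytope_imp_bounded by (intro bounded_Union) auto
  then show "bounded \<Omega>" using P interior_subset bounded_subset by blast
  have "closed (\<Union>P)" using P polytope_imp_closed by (intro closed_Union) auto
  then have "closure \<Omega> \<subseteq> \<Union>P" using P by (metis closure_minimal interior_subset)
  then show "interior K \<subseteq> \<Omega>" if "K \<in> T" for K
    using that Union_T P(3) by (metis Union_upper interior_mono order_trans)
qed

lemma domain_subset: "\<Omega> \<subseteq> \<Union>T"
  using Union_T closure_subset by blast

lemma domain_sets [simp]: "\<Omega> \<in> sets lebesgue"
  using open_domain by (simp add: borel_open)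

lemma Int_face: "K \<in> T \<Longrightarrow> K' \<in> T \<Longrightarrow> K \<inter> K' face_of K"
  using mesh by (auto simp: simplicial_mesh_def triangulation_def)

text \<open>A face that meets the interior of a convex set is the whole set; the intersection of the
  elements is a face of both.\<close>

lemma interior_disjoint:
  assumes "K \<in> T" "K' \<in> T" "x \<in> interior K" "x \<in> interior K'"
  shows "K = K'"
proof -
  have "x \<in> K \<inter> K'" using assms interior_subset by blast
  then have "K \<inter> K' = K" "K' \<inter> K = K'"
    using face_of_disjoint_interior[OF Int_face[OF assms(1,2)]]
      face_of_disjoint_interior[OF Int_face[OF assms(2,1)]] assms(3,4) by blast+
  then show ?thesis by blast
qed

lemma AE_interior: "AE x in lebesgue. x \<in> \<Omega> \<longrightarrow> (\<exists>K\<in>T. x \<in> interior K)"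
proof -
  have "AE x in lebesgue. \<forall>K\<in>T. x \<in> interior K \<or> x \<notin> K"
  proof (rule AE_finite_allI[OF finite_T])
    fix K assume "K \<in> T"
    then interpret convex_body K by (rule body)
    show "AE x in lebesgue. x \<in> interior K \<or> x \<notin> K" by (rule frontier_AE_convex[OF convex closed])
  qed
  then show ?thesis by eventually_elim (use domain_subset in blast)
qed

lemma finite_faces: "finite (mesh_faces T)"
proof -
  have "mesh_faces T = (\<Union>K\<in>T. {F. F facet_of K})" by (auto simp: mesh_faces_def)
  then show ?thesis using finite_T convex_body.finite_facets[OF body] by simp
qed

lemma ori_face: "F \<in> mesh_faces T \<Longrightarrow> ori F \<in> T" "F \<in> mesh_faces T \<Longrightarrow> F facet_of ori F"
  using ori by (auto simp: orientation_def)

lemma mesh_facesI: "K \<in> T \<Longrightarrow> F facet_of K \<Longrightarrow> F \<in> mesh_faces T"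
  by (auto simp: mesh_faces_def)

lemma boundary_face_element:
  assumes "F \<in> mesh_faces T" "F \<subseteq> frontier \<Omega>"
  shows "{K \<in> T. F facet_of K} = {ori F}"
proof -
  have "card {K \<in> T. F facet_of K} = 1" using mesh assms by (simp add: simplicial_mesh_def)
  then obtain K where "{K \<in> T. F facet_of K} = {K}" by (auto simp: card_1_singleton_iff)
  then show ?thesis using ori_face[OF assms(1)] by blast
qed

text \<open>Gives the definite description in \<open>minus_element\<close> its meaning: besides
  \<open>ori F\<close> exactly one element remains.\<close>

lemma interior_face_elements:
  assumes "F \<in> mesh_faces T" "\<not> F \<subseteq> frontier \<Omega>"
  shows "{K \<in> T. F facet_of K} = {ori F, minus_element T ori F}" "minus_element T ori F \<noteq> ori F"
proof -
  have "card {K \<in> T. F facet_of K} = 2" using mesh assms by (simp add: simplicial_mesh_def)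
  then obtain A B where AB: "{K \<in> T. F facet_of K} = {A, B}" "A \<noteq> B" by (auto simp: card_2_iff)
  then have "\<exists>C. {K \<in> T. F facet_of K} = {ori F, C} \<and> C \<noteq> ori F"
    using ori_face[OF assms(1)] by (metis (mono_tags, lifting) insert_commute insert_iff mem_Collect_eq singletonD)
  then obtain C where C: "{K \<in> T. F facet_of K} = {ori F, C}" "C \<noteq> ori F" by blast
  have "minus_element T ori F = C"
    unfolding minus_element_def by (rule the_equality) (use C in blast)+
  with C show "{K \<in> T. F facet_of K} = {ori F, minus_element T ori F}" "minus_element T ori F \<noteq> ori F"
    by auto
qed

text \<open>Both normals belong to the hyperplane spanned by \<open>F\<close>, so only the sign is
  open. If they were equal, points slightly inward from a relative interior point of
  \<open>F\<close> would lie in both open elements.\<close>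

lemma opposite_normals:
  assumes K: "K \<in> T" "F facet_of K" and K': "K' \<in> T" "F facet_of K'" and ne: "K \<noteq> K'"
  shows "outer_normal K' F = - outer_normal K F" "facet_offset K' F = - facet_offset K F"
proof -
  interpret A: convex_body K by (rule body[OF K(1)])
  interpret B: convex_body K' by (rule body[OF K'(1)])
  note a = A.facet_hyperplane[OF K(2)] and b = B.facet_hyperplane[OF K'(2)]
  have "F \<noteq> {}" using K(2) by (simp add: facet_of_def)
  then obtain z where "z \<in> F" by blast
  then have z: "outer_normal K F \<bullet> z = facet_offset K F" "outer_normal K' F \<bullet> z = facet_offset K' F"
    using a(3) b(3) by blast+
  have "outer_normal K' F \<noteq> outer_normal K F"
  proof
    assume eq: "outer_normal K' F = outer_normal K F"
    have "convex F" using K(2) by (meson face_of_imp_convex facet_of_imp_face_of A.convex)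
    then obtain x where x: "x \<in> rel_interior F" using \<open>F \<noteq> {}\<close> rel_interior_eq_empty by blast
    have "\<forall>\<^sub>F t in at_right 0. x - t *\<^sub>R outer_normal K F \<in> interior K"
      using A.generic_inward[OF K(2) A.rel_interior_generic[OF K(2) x]] .
    moreover have "\<forall>\<^sub>F t in at_right 0. x - t *\<^sub>R outer_normal K F \<in> interior K'"
      using B.generic_inward[OF K'(2) B.rel_interior_generic[OF K'(2) x]] eq by simp
    ultimately have "\<forall>\<^sub>F t :: real in at_right 0. False"
      by eventually_elim (use interior_disjoint[OF K(1) K'(1)] ne in blast)
    then show False by (simp add: eventually_False trivial_limit_at_right_real)
  qed
  then show eq: "outer_normal K' F = - outer_normal K F"
    using unit_normal_eq[OF a(1) b(1), of "facet_offset K F" "facet_offset K' F"] a(4) b(4) by auto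
  show "facet_offset K' F = - facet_offset K F" using z eq by simp
qed

text \<open>\<open>K\<close> itself is left at once through \<open>F\<close>. Any other element
  containing x would meet \<open>K\<close> in a proper face through x, hence in \<open>F\<close>,
  and \<open>F\<close> would belong to two elements, which a boundary face does not. So x keeps a
  positive distance from the other elements.\<close>

lemma boundary_outward:
  assumes K: "K \<in> T" and F: "F facet_of K" "F \<subseteq> frontier \<Omega>" and x: "convex_body.generic K F x"
  shows "\<forall>\<^sub>F t in at_right 0. x + t *\<^sub>R outer_normal K F \<notin> \<Omega>"
proof -
  interpret convex_body K by (rule body[OF K])
  have "\<forall>\<^sub>F t in at_right 0. \<forall>K'\<in>T. x + t *\<^sub>R outer_normal K F \<notin> K'"
  proof (rule eventually_ball_finite[OF finite_T], rule ballI)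
    fix K' assume K': "K' \<in> T"
    interpret B: convex_body K' by (rule body[OF K'])
    show "\<forall>\<^sub>F t in at_right 0. x + t *\<^sub>R outer_normal K F \<notin> K'"
    proof (cases "K' = K")
      case True
      have "facet_dist K F x = 0" using x mem_facet_iff[OF F(1)] by (auto simp: generic_def)
      then have "facet_dist K F (x + t *\<^sub>R outer_normal K F) < 0" if "0 < t" for t
        using facet_dist_shift_self[OF F(1), of x "- t"] that by simp
      then have "x + t *\<^sub>R outer_normal K F \<notin> K" if "0 < t" for t
        using that F(1) mem_body_iff by (metis not_le)
      then show ?thesis using True by (auto simp: eventually_at_right_less intro: eventually_mono[OF eventually_at_right_less])
    next
      case False
      have "x \<notin> K'"
      proof
        assume "x \<in> K'"
        have "x \<in> F" using x by (simp add: generic_def)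
        then have "x \<in> K \<inter> K'" using \<open>x \<in> K'\<close> F(1) facet_of_imp_subset by blast
        moreover have "K \<inter> K' \<noteq> K"
        proof
          assume "K \<inter> K' = K"
          then have "interior K \<subseteq> interior K'" by (intro interior_mono) blast
          then show False using interior_nonempty interior_disjoint[OF K K'] False by blast
        qed
        ultimately have "K \<inter> K' = F" using generic_face_eq[OF F(1) x Int_face[OF K K']] by blast
        then have "F face_of K'" using Int_face[OF K' K] by (simp add: Int_commute)
        then have "F facet_of K'" using F(1) aff_dim_eq B.aff_dim_eq by (simp add: facet_of_def)
        then have "K' \<in> {K \<in> T. F facet_of K}" "K \<in> {K \<in> T. F facet_of K}" using K K' F by auto
        then show False using boundary_face_element[OF mesh_facesI[OF K F(1)] F(2)] False by auto
      qed
      then have "x \<in> - K'" "open (- K')" using B.closed by auto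
      moreover have "((\<lambda>t. x + t *\<^sub>R outer_normal K F) \<longlongrightarrow> x + 0 *\<^sub>R outer_normal K F) (at_right 0)"
        by (intro tendsto_intros)
      ultimately have "\<forall>\<^sub>F t in at_right 0. x + t *\<^sub>R outer_normal K F \<in> - K'"
        by (intro topological_tendstoD) auto
      then show ?thesis by simp
    qed
  qed
  then show ?thesis by eventually_elim (use domain_subset in blast)
qed

end

section \<open>Piecewise polynomials and the convective form\<close>

text \<open>The algebraic part of \<open>sym_grad_h\<close>, separated so that it can be applied to
  polynomial Jacobians. Its values are trace-free for d = 3 but not for d = 2.\<close>

definition dev_part :: "real ^ 'd ^ 'd \<Rightarrow> real ^ 'd ^ 'd" where
  "dev_part A = A + transpose A - ((2 / 3) * trace A) *\<^sub>R mat 1"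

lemma sym_grad_h_eq: "sym_grad_h w x = dev_part (grad_h w x)"
  by (simp add: sym_grad_h_def dev_part_def)

lemma dev_part_nth:
  "dev_part A $ i $ j = A $ i $ j + A $ j $ i - (2 / 3) * (\<Sum>k\<in>UNIV. A $ k $ k) * (if i = j then 1 else 0)"
  by (simp add: dev_part_def transpose_def trace_def mat_def)

lemma has_derivative_vec:
  fixes f :: "real ^ 'd \<Rightarrow> real ^ 'd"
  assumes "\<And>i. GDERIV (\<lambda>x. f x $ i) x :> A $ i"
  shows "(f has_derivative (*v) A) (at x)"
proof (subst has_derivative_componentwise_within, rule ballI)
  fix b :: "real ^ 'd" assume "b \<in> Basis"
  then obtain i where b: "b = axis i 1" by (auto simp: Basis_vec_def)
  have "((\<lambda>x. f x $ i) has_derivative (\<lambda>h. h \<bullet> A $ i)) (at x)"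
    using assms[of i] by (simp add: gderiv_def)
  then show "((\<lambda>x. f x \<bullet> b) has_derivative (\<lambda>h. (A *v h) \<bullet> b)) (at x)"
    unfolding b inner_axis by (simp add: matrix_vector_mult_def inner_vec_def mult.commute)
qed

context triangulated_domain
begin

text \<open>The polynomials and their Jacobians live on the whole space, so after passing to them
  continuity up to and across the faces is automatic, and values of \<open>w\<close> on the skeleton
  no longer occur.\<close>

definition pw_poly_rep :: "nat \<Rightarrow> (real ^ 'd \<Rightarrow> real ^ 'd) \<Rightarrow>
    ((real ^ 'd) set \<Rightarrow> real ^ 'd \<Rightarrow> real ^ 'd) \<Rightarrow> ((real ^ 'd) set \<Rightarrow> real ^ 'd \<Rightarrow> real ^ 'd ^ 'd) \<Rightarrow> bool" where
  "pw_poly_rep m w p J \<longleftrightarrow> (\<forall>K\<in>T. (\<forall>x\<in>interior K. w x = p K x) \<and> (\<forall>i. poly_deg_le m (\<lambda>x. p K x $ i)) \<and>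
     (\<forall>x. (p K has_derivative (*v) (J K x)) (at x)) \<and> (\<forall>i j. poly_deg_le m (\<lambda>x. J K x $ i $ j)))"

lemma pw_poly_rep_exists:
  assumes w: "\<And>i. pw_poly T m (\<lambda>x. w x $ i)"
  obtains p J where "pw_poly_rep m w p J"
proof -
  have "\<forall>K i. \<exists>q. K \<in> T \<longrightarrow> poly_deg_le m q \<and> (\<forall>x\<in>interior K. w x $ i = q x)"
    using w unfolding pw_poly_def by blast
  then obtain q where q: "\<And>K i. K \<in> T \<Longrightarrow> poly_deg_le m (q K i)"
    "\<And>K i x. K \<in> T \<Longrightarrow> x \<in> interior K \<Longrightarrow> w x $ i = q K i x" by metis
  have "\<forall>K i. \<exists>G. K \<in> T \<longrightarrow> (\<forall>x. GDERIV (q K i) x :> G x) \<and> (\<forall>j. poly_deg_le m (\<lambda>x. G x $ j))"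
    using poly_deg_le_gradient[OF q(1)] by blast
  then obtain G where G: "\<And>K i x. K \<in> T \<Longrightarrow> GDERIV (q K i) x :> G K i x"
    "\<And>K i j. K \<in> T \<Longrightarrow> poly_deg_le m (\<lambda>x. G K i x $ j)" by metis
  show thesis
  proof (rule that[of "\<lambda>K x. \<chi> i. q K i x" "\<lambda>K x. \<chi> i. G K i x"])
    show "pw_poly_rep m w (\<lambda>K x. \<chi> i. q K i x) (\<lambda>K x. \<chi> i. G K i x)"
      unfolding pw_poly_rep_def using q G by (auto simp: vec_eq_iff intro!: has_derivative_vec)
  qed
qed

lemma pw_poly_repD:
  assumes "pw_poly_rep m w p J" "K \<in> T"
  shows "\<And>x. x \<in> interior K \<Longrightarrow> w x = p K x" "\<And>i. poly_deg_le m (\<lambda>x. p K x $ i)"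
    "\<And>x. (p K has_derivative (*v) (J K x)) (at x)" "\<And>i j. poly_deg_le m (\<lambda>x. J K x $ i $ j)"
    "\<And>A. continuous_on A (p K)" "\<And>A. continuous_on A (J K)" "\<And>A. continuous_on A (\<lambda>x. dev_part (J K x))"
    "\<And>i j. poly_deg_le m (\<lambda>x. dev_part (J K x) $ i $ j)"
proof -
  show rep: "\<And>x. x \<in> interior K \<Longrightarrow> w x = p K x" "\<And>i. poly_deg_le m (\<lambda>x. p K x $ i)"
    "\<And>x. (p K has_derivative (*v) (J K x)) (at x)" "\<And>i j. poly_deg_le m (\<lambda>x. J K x $ i $ j)"
    using assms unfolding pw_poly_rep_def by auto
  show "continuous_on A (p K)" for A
    using rep(3) by (meson has_derivative_continuous continuous_at_imp_continuous_on)
  have cv: "continuous_on A B" if "\<And>i j. poly_deg_le m (\<lambda>x. B x $ i $ j)"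
    for A and B :: "real ^ 'd \<Rightarrow> real ^ 'd ^ 'd"
  proof -
    have "continuous_on A (\<lambda>x. \<chi> i. \<chi> j. B x $ i $ j)"
      using that poly_deg_le_continuous_on by (intro continuous_on_vec_lambda) blast
    then show ?thesis by (simp add: vec_lambda_eta)
  qed
  show "continuous_on A (J K)" for A by (rule cv) (rule rep(4))
  show dp: "poly_deg_le m (\<lambda>x. dev_part (J K x) $ i $ j)" for i j
  proof -
    have "poly_deg_le m (\<lambda>x. (2 / 3 * c) * (\<Sum>k\<in>UNIV. J K x $ k $ k))" for c
      by (intro poly_deg_le_cmult poly_deg_le_sum rep(4))
    from this[of "if i = j then 1 else 0"] show ?thesis
      unfolding dev_part_nth by (intro poly_deg_le_diff poly_deg_le_add rep(4)) (simp add: mult_ac)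
  qed
  show "continuous_on A (\<lambda>x. dev_part (J K x))" for A by (rule cv) (rule dp)
qed

lemma grad_h_eq:
  assumes rep: "pw_poly_rep m w p J" and K: "K \<in> T" and x: "x \<in> interior K"
  shows "grad_h w x = J K x"
proof -
  have "(w has_derivative (*v) (J K x)) (at x)"
    by (rule has_derivative_transform_within_open[OF pw_poly_repD(3)[OF rep K] open_interior x])
      (simp add: pw_poly_repD(1)[OF rep K])
  then have "frechet_derivative w (at x) = (*v) (J K x)"
    by (rule frechet_derivative_at[symmetric])
  then show ?thesis unfolding grad_h_def jacobian_def by (simp add: matrix_of_matrix_vector_mul)
qed

lemma trace_from_rep:
  assumes "pw_poly_rep m w p J" "K \<in> T" "x \<in> K"
  shows "trace_from K w x = p K x" "trace_from K (sym_grad_h w) x = dev_part (J K x)"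
proof -
  interpret convex_body K by (rule body[OF assms(2)])
  show "trace_from K w x = p K x"
    using pw_poly_repD[OF assms(1,2)] by (intro trace_from_eq assms(3)) auto
  show "trace_from K (sym_grad_h w) x = dev_part (J K x)"
    using pw_poly_repD(7)[OF assms(1,2)] grad_h_eq[OF assms(1,2)]
    by (intro trace_from_eq[where p = "\<lambda>x. dev_part (J K x)"] assms(3)) (auto simp: sym_grad_h_eq)
qed

text \<open>Integrability over \<open>\<Omega>\<close> is obtained together with the formula: off
  the null skeleton \<open>f\<close> agrees with the finite sum of its restrictions to the open
  elements.\<close>

lemma domain_integral_split:
  fixes f :: "real ^ 'd \<Rightarrow> real"
  assumes f: "\<And>K. K \<in> T \<Longrightarrow> integrable lebesgue (\<lambda>x. indicator (interior K) x * f x)"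
  shows "set_integrable lebesgue \<Omega> f"
    and "(LINT x:\<Omega>|lebesgue. f x) = (\<Sum>K\<in>T. LINT x|lebesgue. indicator (interior K) x * f x)"
proof -
  define S where "S x = (\<Sum>K\<in>T. indicator (interior K) x * f x)" for x
  have Si: "integrable lebesgue S"
    unfolding S_def using f by (intro Bochner_Integration.integrable_sum) auto
  have S\<Omega>: "indicator \<Omega> x * S x = S x" for x
  proof (cases "x \<in> \<Omega>")
    case False
    then have "\<forall>K\<in>T. x \<notin> interior K" using interior_subset_domain by blast
    then show ?thesis by (simp add: S_def)
  qed simp
  have "(\<lambda>x. indicator \<Omega> x *\<^sub>R S x) = S" using S\<Omega> by (intro ext) simp
  then have Sset: "set_integrable lebesgue \<Omega> S" using Si by (simp only: set_integrable_def)
  define N where "N = {x \<in> \<Omega>. \<forall>K\<in>T. x \<notin> interior K}"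
  have "AE x in lebesgue. x \<notin> N" using AE_interior by eventually_elim (auto simp: N_def)
  moreover have "N \<in> sets lebesgue"
  proof -
    have "N = \<Omega> - (\<Union>K\<in>T. interior K)" by (auto simp: N_def)
    moreover have "open (\<Union>K\<in>T. interior K)" by auto
    ultimately show ?thesis by (simp add: borel_open sets.Diff)
  qed
  ultimately have N: "negligible N" by (simp add: negligible_iff_null_sets AE_iff_null_sets)
  have fS: "f x = S x" if xN: "x \<in> \<Omega> - N" for x
  proof -
    obtain K where K: "K \<in> T" "x \<in> interior K" using xN unfolding N_def by blast
    have "S x = (\<Sum>K'\<in>T. if K' = K then f x else 0)"
      unfolding S_def
    proof (rule sum.cong[OF refl])
      fix L assume L: "L \<in> T"
      have "x \<notin> interior L" if "L \<noteq> K" using interior_disjoint[OF L K(1) _ K(2)] that by blast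
      then show "indicator (interior L) x * f x = (if L = K then f x else 0)"
        using K(2) by simp
    qed
    then show ?thesis using K finite_T by simp
  qed
  show fset: "set_integrable lebesgue \<Omega> f"
    by (rule absolutely_integrable_spike[OF Sset N]) (use fS in auto)
  have "(LINT x:\<Omega>|lebesgue. f x) = integral \<Omega> f" using fset by (rule set_lebesgue_integral_eq_integral)
  also have "\<dots> = integral \<Omega> S" by (rule integral_spike[OF N]) (use fS in auto)
  also have "\<dots> = (LINT x:\<Omega>|lebesgue. S x)" using Sset by (rule set_lebesgue_integral_eq_integral(2)[symmetric])
  also have "\<dots> = (LINT x|lebesgue. S x)" by (simp add: set_lebesgue_integral_def S\<Omega>)
  also have "\<dots> = (\<Sum>K\<in>T. LINT x|lebesgue. indicator (interior K) x * f x)"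
    unfolding S_def using f by (intro Bochner_Integration.integral_sum) auto
  finally show "(LINT x:\<Omega>|lebesgue. f x) = (\<Sum>K\<in>T. LINT x|lebesgue. indicator (interior K) x * f x)" .
qed

lemma integrable_interior_continuous:
  fixes f :: "real ^ 'd \<Rightarrow> real"
  assumes "K \<in> T" "continuous_on UNIV f"
  shows "integrable lebesgue (\<lambda>x. indicator (interior K) x * f x)"
proof -
  interpret convex_body K by (rule body[OF assms(1)])
  have "set_integrable lebesgue K f"
    by (intro set_integrable_continuous_compact compact continuous_on_subset[OF assms(2)]) auto
  then have "set_integrable lebesgue (interior K) f"
    by (rule set_integrable_subset) (auto simp: interior_subset)
  then show ?thesis by (simp add: set_integrable_def)
qed

lemma integral_interior_eq:
  fixes f :: "real ^ 'd \<Rightarrow> real"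
  assumes K: "K \<in> T" and f: "continuous_on UNIV f"
  shows "(LINT x:K|lebesgue. f x) = (LINT x|lebesgue. indicator (interior K) x * f x)"
  unfolding set_lebesgue_integral_def
proof (rule integral_cong_AE)
  interpret convex_body K by (rule body[OF K])
  show "(\<lambda>x. indicator K x *\<^sub>R f x) \<in> borel_measurable lebesgue"
    using set_integrable_continuous_compact[OF compact continuous_on_subset[OF f]]
    by (simp add: set_integrable_def)
  show "(\<lambda>x. indicator (interior K) x * f x) \<in> borel_measurable lebesgue"
    using integrable_interior_continuous[OF K f] by auto
  show "AE x in lebesgue. indicator K x *\<^sub>R f x = indicator (interior K) x * f x"
    using frontier_AE_convex[OF convex closed]
    by eventually_elim (use interior_subset in \<open>auto simp: indicator_def\<close>)
qed

lemma interior_integral_cong: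
  assumes "K \<in> T" "\<And>x. x \<in> interior K \<Longrightarrow> f x = (g x :: real)"
  shows "(\<lambda>x. indicator (interior K) x * f x) = (\<lambda>x. indicator (interior K) x * g x)"
  using assms(2) by (auto simp: indicator_def fun_eq_iff)

lemma face_piece: "K \<in> T \<Longrightarrow> F facet_of K \<Longrightarrow> hyperplane_piece F (outer_normal K F) (facet_offset K F)"
  using convex_body.hyperplane_piece_facet[OF body] .

lemma space_surface: "F \<in> mesh_faces T \<Longrightarrow> space (surface_measure F) = F"
  using hyperplane_piece.space_surface_measure[OF face_piece] ori_face by blast

lemma integrable_face:
  fixes q :: "real ^ 'd \<Rightarrow> real"
  assumes "F \<in> mesh_faces T" "continuous_on UNIV q"
  shows "integrable (surface_measure F) q"
  using hyperplane_piece.integrable_surface_continuous[OF face_piece assms(2)] ori_face[OF assms(1)] by blast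

lemma face_integral_cong:
  assumes "F \<in> mesh_faces T" "\<And>x. x \<in> F \<Longrightarrow> f x = g x"
  shows "(LINT x|surface_measure F. f x) = (LINT x|surface_measure F. g x)"
  using assms by (intro Bochner_Integration.integral_cong refl) (simp add: space_surface)

text \<open>
  On an interior face the normal component is taken from the \<open>+\<close> side for both neighbours,
  and boundary faces are approached from outside \<open>\<Omega>\<close>, so that they do not contribute.
\<close>

lemma element_balance:
  fixes \<beta> :: "real ^ 'd \<Rightarrow> real ^ 'd"
  assumes K: "K \<in> T" and \<beta>: "\<beta> \<in> H0_div \<Omega>" and rep: "pw_poly_rep m \<beta> p J"
    and \<psi>: "C1_with_gradient \<psi> \<Psi>"
  shows "(LINT x|lebesgue. indicator (interior K) x * (p K x \<bullet> \<Psi> x)) +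
      (LINT x|lebesgue. indicator (interior K) x * (weak_div \<Omega> \<beta> x * \<psi> x)) =
    (\<Sum>F | F facet_of K \<and> \<not> F \<subseteq> frontier \<Omega>. (if ori F = K then 1 else -1) *
      (LINT x|surface_measure F. (p (ori F) x \<bullet> face_normal ori F) * \<psi> x))"
proof -
  interpret convex_body K by (rule body[OF K])
  have L2\<beta>: "L2 \<Omega> \<beta>" using \<beta> by (simp add: H0_div_def)
  obtain g where g: "is_weak_div \<Omega> \<beta> g" and
    g0: "\<And>\<phi> G. C1_with_gradient \<phi> G \<Longrightarrow> (LINT x:\<Omega>|lebesgue. \<beta> x \<bullet> G x + g x * \<phi> x) = 0"
    using \<beta> unfolding H0_div_def by blast
  have L2g: "L2 \<Omega> g" using g by (simp add: is_weak_div_def)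
  have wd: "is_weak_div \<Omega> \<beta> (weak_div \<Omega> \<beta>)" unfolding weak_div_def by (rule someI[of "is_weak_div \<Omega> \<beta>", OF g])
  \<comment> \<open>A bounded Borel representative of \<open>\<beta>\<close>, extended by zero. Its
    value is prescribed at every point, so limits along sequences towards a facet make
    sense.\<close>
  define v where "v x = (\<Sum>K\<in>T. indicator (interior K) x *\<^sub>R p K x)" for x
  define g' where "g' x = indicator \<Omega> x * g x" for x
  have v_in: "v x = p K' x" if "K' \<in> T" "x \<in> interior K'" for K' x
  proof -
    have "v x = (\<Sum>K\<in>T. if K = K' then p K' x else 0)"
      unfolding v_def
    proof (rule sum.cong[OF refl])
      fix L assume L: "L \<in> T"
      have "x \<notin> interior L" if "L \<noteq> K'"
        using interior_disjoint[OF L \<open>K' \<in> T\<close> _ \<open>x \<in> interior K'\<close>] that by blast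
      then show "indicator (interior L) x *\<^sub>R p L x = (if L = K' then p K' x else 0)"
        using that(2) by simp
    qed
    then show ?thesis using that finite_T by simp
  qed
  have v\<Omega>: "v x = 0" if "x \<notin> \<Omega>" for x
    unfolding v_def
  proof (rule sum.neutral, rule ballI)
    fix K' assume "K' \<in> T"
    then have "x \<notin> interior K'" using interior_subset_domain that by blast
    then show "indicator (interior K') x *\<^sub>R p K' x = 0" by simp
  qed
  have vm: "v \<in> borel_measurable borel"
    unfolding v_def using pw_poly_repD(5)[OF rep]
    by (intro borel_measurable_sum borel_measurable_scaleR borel_measurable_indicator
        borel_measurable_continuous_onI) auto
  obtain V where V: "\<And>x. norm (v x) \<le> V"
  proof -
    have "\<exists>B. \<forall>x\<in>K'. norm (p K' x) \<le> B" if "K' \<in> T" for K'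
    proof -
      have "bounded (p K' ` K')"
        using pw_poly_repD(5)[OF rep that] convex_body.compact[OF body[OF that]]
        by (intro compact_imp_bounded compact_continuous_image)
      then show ?thesis by (auto simp: bounded_iff)
    qed
    then obtain B where B: "\<And>K' x. K' \<in> T \<Longrightarrow> x \<in> K' \<Longrightarrow> norm (p K' x) \<le> B K'" by metis
    have "norm (v x) \<le> (\<Sum>K\<in>T. \<bar>B K\<bar>)" for x
      unfolding v_def
    proof (rule sum_norm_le)
      fix K' assume K': "K' \<in> T"
      show "norm (indicator (interior K') x *\<^sub>R p K' x) \<le> \<bar>B K'\<bar>"
        using B[OF K', of x] interior_subset[of K'] by (auto simp: indicator_def)
    qed
    then show thesis by (rule that)
  qed
  obtain R where R: "\<And>x. x \<in> \<Omega> \<Longrightarrow> norm x \<le> R"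
    using bounded_domain by (auto simp: bounded_iff)
  have R': "x \<notin> \<Omega>" if "R < norm x" for x using R[of x] that by auto
  have g'i: "integrable lebesgue g'"
    using L2_set_integrable[OF domain_sets bounded_domain L2g] by (simp add: set_integrable_def g'_def[abs_def])
  have H: "(LINT x|lebesgue. v x \<bullet> G x + g' x * \<phi> x) = 0" if \<phi>: "C1_with_gradient \<phi> G" for \<phi> G
  proof -
    have m: "\<phi> \<in> borel_measurable lebesgue" "G \<in> borel_measurable lebesgue"
      using C1_with_gradient_continuous[OF \<phi>, of UNIV]
      by (auto intro!: measurable_completion borel_measurable_continuous_onI)
    have b: "(\<lambda>x. indicator \<Omega> x *\<^sub>R \<beta> x) \<in> borel_measurable lebesgue"
      using L2\<beta> by (simp add: L2_def set_borel_measurable_def)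
    have vl: "v \<in> borel_measurable lebesgue" using vm by (intro measurable_completion) simp
    have gm: "g' \<in> borel_measurable lebesgue" using g'i by auto
    have "(LINT x|lebesgue. v x \<bullet> G x + g' x * \<phi> x) =
        (LINT x|lebesgue. (indicator \<Omega> x *\<^sub>R \<beta> x) \<bullet> G x + g' x * \<phi> x)"
    proof (rule integral_cong_AE)
      show "(\<lambda>x. v x \<bullet> G x + g' x * \<phi> x) \<in> borel_measurable lebesgue"
        using m vl gm by (intro borel_measurable_add borel_measurable_inner borel_measurable_times)
      show "(\<lambda>x. (indicator \<Omega> x *\<^sub>R \<beta> x) \<bullet> G x + g' x * \<phi> x) \<in> borel_measurable lebesgue"
        using m b gm by (intro borel_measurable_add borel_measurable_inner borel_measurable_times)
      show "AE x in lebesgue. v x \<bullet> G x + g' x * \<phi> x = (indicator \<Omega> x *\<^sub>R \<beta> x) \<bullet> G x + g' x * \<phi> x"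
        using AE_interior
      proof eventually_elim
        case (elim x)
        have "v x = indicator \<Omega> x *\<^sub>R \<beta> x"
        proof (cases "x \<in> \<Omega>")
          case True
          then obtain K' where "K' \<in> T" "x \<in> interior K'" using elim by blast
          then show ?thesis using True v_in pw_poly_repD(1)[OF rep] by simp
        qed (simp add: v\<Omega>)
        then show ?case by simp
      qed
    qed
    also have "\<dots> = (LINT x:\<Omega>|lebesgue. \<beta> x \<bullet> G x + g x * \<phi> x)"
      unfolding set_lebesgue_integral_def g'_def
      by (intro Bochner_Integration.integral_cong refl) (simp add: algebra_simps)
    finally show ?thesis using g0[OF \<phi>] by simp
  qed
  define \<sigma> where "\<sigma> F = (if F \<subseteq> frontier \<Omega> then 1 else if ori F = K then 0 else 1 :: real)" for F
  define \<gamma> where "\<gamma> F x = (if F \<subseteq> frontier \<Omega> then 0 else p (ori F) x \<bullet> outer_normal K F)" for F x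
  have e0: "(\<lambda>i. 1 / real (Suc i) * \<tau>) \<longlonglongrightarrow> 0" for \<tau>
    using tendsto_mult_left_zero[OF LIMSEQ_inverse_real_of_nat, of \<tau>] by (simp add: inverse_eq_divide)
  have right: "filterlim (\<lambda>i. 1 / real (Suc i) * \<tau>) (at_right 0) sequentially" if "0 < \<tau>" for \<tau>
    unfolding filterlim_at using e0 that by auto
  have "(LINT x|lebesgue. indicator (interior K) x * (v x \<bullet> \<Psi> x + g' x * \<psi> x)) =
    (\<Sum>F\<in>facets. LINT x|surface_measure F. \<gamma> F x * \<psi> x)"
  proof (rule normal_trace_identity[where R = R and V = V and \<sigma> = \<sigma>])
    show "v x = 0" if "R < norm x" for x using R'[OF that] by (rule v\<Omega>)
    show "g' x = 0" if "R < norm x" for x using R'[OF that] by (simp add: g'_def)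
    fix F assume F: "F facet_of K"
    have FT: "F \<in> mesh_faces T" by (rule mesh_facesI[OF K F])
    show "\<sigma> F = 0 \<or> \<sigma> F = 1" by (simp add: \<sigma>_def)
    show "\<gamma> F \<in> borel_measurable borel"
      unfolding \<gamma>_def using pw_poly_repD(5)[OF rep ori_face(1)[OF FT]]
      by (cases "F \<subseteq> frontier \<Omega>") (auto intro!: borel_measurable_continuous_onI continuous_intros)
    let ?n = "outer_normal K F" and ?P = "facet_proj F"
    show "AE y in lborel. generic F (?P y) \<longrightarrow> (\<forall>\<tau>. 0 < \<tau> + \<sigma> F \<and> \<tau> + \<sigma> F < 1 \<longrightarrow>
        (\<lambda>i. v (?P y - (1 / real (Suc i) * \<tau>) *\<^sub>R ?n) \<bullet> ?n) \<longlonglongrightarrow> \<gamma> F (?P y))"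
    proof (cases "F \<subseteq> frontier \<Omega>")
      case True
      show ?thesis
      proof (rule AE_I2, intro impI allI)
        fix y \<tau> assume gen: "generic F (?P y)" and \<tau>: "0 < \<tau> + \<sigma> F \<and> \<tau> + \<sigma> F < 1"
        \<comment> \<open>With shift 1 only \<open>\<tau>\<close> between -1 and 0 matter, that is,
          points displaced along the outer normal.\<close>
        then have "0 < - \<tau>" using True by (simp add: \<sigma>_def)
        from eventually_compose_filterlim[OF boundary_outward[OF K F True gen] right[OF this]]
        have "\<forall>\<^sub>F i in sequentially. v (?P y - (1 / real (Suc i) * \<tau>) *\<^sub>R ?n) \<bullet> ?n = 0"
          by eventually_elim (simp add: v\<Omega>)
        then show "(\<lambda>i. v (?P y - (1 / real (Suc i) * \<tau>) *\<^sub>R ?n) \<bullet> ?n) \<longlonglongrightarrow> \<gamma> F (?P y)"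
          using True by (simp add: \<gamma>_def tendsto_eventually)
      qed
    next
      case False
      define L where "L = ori F"
      have L: "L \<in> T" "F facet_of L" using ori_face[OF FT] by (simp_all add: L_def)
      interpret L: convex_body L by (rule body[OF L(1)])
      have limp: "(\<lambda>i. p L (x - (1 / real (Suc i) * \<tau>) *\<^sub>R n) \<bullet> ?n) \<longlonglongrightarrow> p L x \<bullet> ?n" for x \<tau> and n :: "real ^ 'd"
      proof -
        have "(\<lambda>i. x - (1 / real (Suc i) * \<tau>) *\<^sub>R n) \<longlonglongrightarrow> x - 0 *\<^sub>R n"
          by (intro tendsto_intros e0)
        moreover have "isCont (p L) x"
          using pw_poly_repD(5)[OF rep L(1), of UNIV] by (simp add: continuous_on_eq_continuous_at)
        ultimately show ?thesis by (intro tendsto_intros isCont_tendsto_compose[of x "p L"]) simp_all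
      qed
      have key: "(\<lambda>i. v (x - (1 / real (Suc i) * \<tau>) *\<^sub>R outer_normal L F) \<bullet> ?n) \<longlonglongrightarrow> p L x \<bullet> ?n"
        if gen: "L.generic F x" and \<tau>: "0 < \<tau>" for x \<tau>
      proof -
        from eventually_compose_filterlim[OF L.generic_inward[OF L(2) gen] right[OF \<tau>]]
        have "\<forall>\<^sub>F i in sequentially. p L (x - (1 / real (Suc i) * \<tau>) *\<^sub>R outer_normal L F) \<bullet> ?n =
            v (x - (1 / real (Suc i) * \<tau>) *\<^sub>R outer_normal L F) \<bullet> ?n"
          by eventually_elim (simp add: v_in[OF L(1)])
        then show ?thesis using limp by (rule Lim_transform_eventually[rotated])
      qed
      show ?thesis
      proof (cases "L = K")
        case True
        show ?thesis
        proof (rule AE_I2, intro impI allI)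
          fix y \<tau> assume gen: "generic F (?P y)" and \<tau>: "0 < \<tau> + \<sigma> F \<and> \<tau> + \<sigma> F < 1"
          have "0 < \<tau>" using \<tau> False True by (simp add: \<sigma>_def L_def)
          then show "(\<lambda>i. v (?P y - (1 / real (Suc i) * \<tau>) *\<^sub>R ?n) \<bullet> ?n) \<longlonglongrightarrow> \<gamma> F (?P y)"
            using key[of "?P y" \<tau>] gen False True by (simp add: \<gamma>_def L_def)
        qed
      next
        case ne: False
        note opp = opposite_normals[OF K F L ne[symmetric]]
        \<comment> \<open>Reversing both the normal and the offset describes the same hyperplane and
          hence the same projection.\<close>
        have proj: "hyperplane_proj (outer_normal L F) (facet_offset L F) y = ?P y" for y
          by (simp add: hyperplane_proj_def opp algebra_simps)
        show ?thesis
          using L.normal_trace_AE[OF L(2)]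
        proof eventually_elim
          case (elim y)
          show ?case
          proof (intro impI allI)
            fix \<tau> assume gen: "generic F (?P y)" and \<tau>: "0 < \<tau> + \<sigma> F \<and> \<tau> + \<sigma> F < 1"
            have "0 < - \<tau>" using \<tau> False ne by (simp add: \<sigma>_def L_def)
            moreover have "L.generic F (?P y)" using elim gen by (simp add: proj generic_def)
            ultimately show "(\<lambda>i. v (?P y - (1 / real (Suc i) * \<tau>) *\<^sub>R ?n) \<bullet> ?n) \<longlonglongrightarrow> \<gamma> F (?P y)"
              using key[of "?P y" "- \<tau>"] False by (simp add: \<gamma>_def L_def[symmetric] opp)
          qed
        qed
      qed
    qed
  qed (use vm V g'i H \<psi> in auto)
  also have "(\<Sum>F\<in>facets. LINT x|surface_measure F. \<gamma> F x * \<psi> x) =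
      (\<Sum>F | F facet_of K \<and> \<not> F \<subseteq> frontier \<Omega>. LINT x|surface_measure F. \<gamma> F x * \<psi> x)"
    by (rule sum.mono_neutral_right[OF finite_facets]) (auto simp: \<gamma>_def)
  also have "\<dots> = (\<Sum>F | F facet_of K \<and> \<not> F \<subseteq> frontier \<Omega>. (if ori F = K then 1 else -1) *
      (LINT x|surface_measure F. (p (ori F) x \<bullet> face_normal ori F) * \<psi> x))"
  proof (rule sum.cong[OF refl])
    fix F assume "F \<in> {F. F facet_of K \<and> \<not> F \<subseteq> frontier \<Omega>}"
    then have F: "F facet_of K" "\<not> F \<subseteq> frontier \<Omega>" by auto
    have FT: "F \<in> mesh_faces T" by (rule mesh_facesI[OF K F(1)])
    have "outer_normal K F = (if ori F = K then 1 else -1) *\<^sub>R face_normal ori F"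
      using opposite_normals(1)[OF ori_face[OF FT] K F(1)] by (auto simp: face_normal_def)
    then have eq: "\<gamma> F x * \<psi> x = (if ori F = K then 1 else -1) * ((p (ori F) x \<bullet> face_normal ori F) * \<psi> x)" for x
      using F(2) by (simp add: \<gamma>_def)
    show "(LINT x|surface_measure F. \<gamma> F x * \<psi> x) = (if ori F = K then 1 else -1) *
      (LINT x|surface_measure F. (p (ori F) x \<bullet> face_normal ori F) * \<psi> x)"
      unfolding eq by (rule integral_mult_right_zero)
  qed
  finally have main: "(LINT x|lebesgue. indicator (interior K) x * (v x \<bullet> \<Psi> x + g' x * \<psi> x)) =
    (\<Sum>F | F facet_of K \<and> \<not> F \<subseteq> frontier \<Omega>. (if ori F = K then 1 else -1) *
      (LINT x|surface_measure F. (p (ori F) x \<bullet> face_normal ori F) * \<psi> x))" .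
  have "(\<lambda>x. indicator (interior K) x * (v x \<bullet> \<Psi> x + g' x * \<psi> x)) =
      (\<lambda>x. indicator (interior K) x * (p K x \<bullet> \<Psi> x) + indicator (interior K) x * (g x * \<psi> x))"
    using v_in[OF K] interior_subset_domain[OF K] by (auto simp: g'_def indicator_def fun_eq_iff)
  moreover have "(LINT x|lebesgue. indicator (interior K) x * (p K x \<bullet> \<Psi> x) + indicator (interior K) x * (g x * \<psi> x)) =
      (LINT x|lebesgue. indicator (interior K) x * (p K x \<bullet> \<Psi> x)) +
      (LINT x|lebesgue. indicator (interior K) x * (g x * \<psi> x))"
  proof (rule Bochner_Integration.integral_add)
    show "integrable lebesgue (\<lambda>x. indicator (interior K) x * (p K x \<bullet> \<Psi> x))"
      by (intro integrable_interior_continuous K continuous_intros pw_poly_repD(5)[OF rep K]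
          C1_with_gradient_continuous[OF \<psi>])
    have "L2 (interior K) g" "L2 (interior K) \<psi>"
      by (rule L2_subset[OF L2g _ interior_subset_domain[OF K]], simp)
        (rule L2_interior_continuous[OF C1_with_gradient_continuous(1)[OF \<psi>]])
    from L2_inner_integrable[OF this]
    show "integrable lebesgue (\<lambda>x. indicator (interior K) x * (g x * \<psi> x))"
      by (simp add: set_integrable_def)
  qed
  \<comment> \<open>So far the divergence is the one from the trace condition; uniqueness on the
    open element transfers the identity to \<open>weak_div\<close>.\<close>
  ultimately show ?thesis
    using main weak_div_interior_unique[OF open_domain bounded_domain interior_subset_domain[OF K] g wd \<psi>]
    by simp
qed

end

section \<open>Matrix and counting inequalities for coercivity\<close>

lemma inner_transpose: "transpose A \<bullet> transpose B = (A :: real ^ 'd ^ 'd) \<bullet> B"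
  unfolding inner_vec_def transpose_def by simp (rule sum.swap)

lemma inner_mat_1: "(A :: real ^ 'd ^ 'd) \<bullet> mat 1 = trace A"
  by (simp add: inner_vec_def mat_def trace_def if_distrib cong: if_cong)

text \<open>Let D be \<open>dev_part A\<close> and t the trace of A. As D is symmetric, its products
  with A and with the transpose of A agree, so D : D = 2 D : A - (2/3) t tr D. The trace of D is 2 t
  (1 - d/3), which makes the last term (4/9) t^2 (3 - d); it is nonnegative precisely because d is
  at most 3.\<close>

lemma dev_part_coercive:
  fixes A :: "real ^ 'd ^ 'd"
  assumes "CARD('d) \<le> 3"
  shows "1 / 2 * (norm (dev_part A))\<^sup>2 \<le> dev_part A \<bullet> A"
proof -
  define D t where "D = dev_part A" and "t = trace A"
  have D: "D = A + transpose A - (2 / 3 * t) *\<^sub>R mat 1" by (simp add: D_def dev_part_def t_def)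
  have sym: "transpose D = D"
    unfolding D by (simp add: vec_eq_iff transpose_def mat_def)
  have tr: "trace D = 2 * t - 2 / 3 * t * real CARD('d)"
    unfolding D by (simp add: t_def trace_def transpose_def mat_def sum.distrib sum_subtractf
        sum_distrib_left[symmetric] algebra_simps)
  have "D \<bullet> transpose A = D \<bullet> A" using inner_transpose[of D A] by (simp add: sym)
  then have "D \<bullet> D = 2 * (D \<bullet> A) - 2 / 3 * t * trace D"
    by (subst (2) D) (simp add: inner_add_right inner_diff_right inner_mat_1)
  also have "2 / 3 * t * trace D = 4 / 9 * t\<^sup>2 * (3 - real CARD('d))"
    unfolding tr by (simp add: power2_eq_square algebra_simps)
  finally have "D \<bullet> D = 2 * (D \<bullet> A) - 4 / 9 * t\<^sup>2 * (3 - real CARD('d))" .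
  moreover have "0 \<le> 4 / 9 * t\<^sup>2 * (3 - real CARD('d))" using assms by simp
  ultimately show ?thesis by (simp add: D_def[symmetric] dot_square_norm)
qed

lemma norm_matrix_vector_le:
  fixes A :: "real ^ 'd ^ 'd"
  shows "norm (A *v x) \<le> norm A * norm x"
proof -
  have "norm (A *v x) \<le> L2_set (\<lambda>i. norm (A $ i) * norm x) UNIV"
    unfolding norm_vec_def[of "A *v x"]
    by (rule L2_set_mono) (simp_all add: matrix_vector_mul_component Cauchy_Schwarz_ineq2)
  also have "\<dots> = norm A * norm x"
    by (simp add: norm_vec_def[of A] L2_set_left_distrib)
  finally show ?thesis .
qed

lemma norm_matrix_power2: "(norm (A :: real ^ 'd ^ 'd))\<^sup>2 = (\<Sum>i\<in>UNIV. \<Sum>j\<in>UNIV. (A $ i $ j)\<^sup>2)"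
  unfolding power2_norm_eq_inner inner_vec_def by (simp add: power2_eq_square)

text \<open>The weight is split into a free parameter e and a length h. With h the diameter of a
  face, the first term fits the trace inequality and the second one the penalty term.\<close>

lemma Young_inner:
  fixes a b :: "'a::real_inner"
  assumes e: "0 < e" and h: "0 < h"
  shows "2 * (a \<bullet> b) \<le> e * h * (norm b)\<^sup>2 + 1 / (e * h) * (norm a)\<^sup>2"
proof -
  have "0 \<le> (sqrt (e * h) * norm b - norm a / sqrt (e * h))\<^sup>2" by simp
  also have "\<dots> = e * h * (norm b)\<^sup>2 + 1 / (e * h) * (norm a)\<^sup>2 - 2 * (norm a * norm b)"
    using e h by (simp add: power2_diff power_mult_distrib power_divide)
  finally show ?thesis using norm_cauchy_schwarz[of a b] by simp
qed

text \<open>Each facet is the convex hull of all vertices but one. The resulting uniform bound makes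
  the supremum in \<open>max_faces\<close> an actual upper bound.\<close>

lemma card_facets_simplex:
  fixes K :: "'a::euclidean_space set"
  assumes "int n simplex K"
  shows "card {F. F facet_of K} \<le> n + 1"
proof -
  obtain C where C: "\<not> affine_dependent C" "int (card C) = int n + 1" "K = convex hull C"
    using assms by (auto simp: simplex)
  have "finite C" using C(1) by (rule aff_independent_finite)
  have "{F. F facet_of K} \<subseteq> (\<lambda>u. convex hull (C - {u})) ` C"
    using facet_of_convex_hull_affine_independent[OF C(1)] C(3) by auto
  then have "card {F. F facet_of K} \<le> card C"
    using \<open>finite C\<close> by (meson card_image_le card_mono finite_imageI order_trans)
  then show ?thesis using C(2) by linarith
qed

section \<open>The convective form on the diagonal\<close>

context triangulated_domain
begin

text \<open>With this test function the convective integrand becomes a pure transport term,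
  \<open>\<beta>\<close> applied to the gradient of |w|^2/2, so that the flux balance of an element
  applies to it.\<close>

lemma C1_half_square:
  assumes rep: "pw_poly_rep m w p J" and K: "K \<in> T"
  shows "C1_with_gradient (\<lambda>x. 1 / 2 * (p K x \<bullet> p K x)) (\<lambda>x. transpose (J K x) *v p K x)"
  unfolding C1_with_gradient_def
proof
  show "\<forall>x. GDERIV (\<lambda>x. 1 / 2 * (p K x \<bullet> p K x)) x :> transpose (J K x) *v p K x"
  proof
    fix x
    have "((\<lambda>x. 1 / 2 * (p K x \<bullet> p K x)) has_derivative
        (\<lambda>h. 1 / 2 * (p K x \<bullet> (J K x *v h) + (J K x *v h) \<bullet> p K x))) (at x)"
      by (intro has_derivative_mult_right has_derivative_inner pw_poly_repD(3)[OF rep K])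
    also have "(\<lambda>h. 1 / 2 * (p K x \<bullet> (J K x *v h) + (J K x *v h) \<bullet> p K x)) =
        (\<lambda>h. h \<bullet> (transpose (J K x) *v p K x))"
      by (simp add: inner_commute dot_lmul_matrix[symmetric] fun_eq_iff)
    finally show "GDERIV (\<lambda>x. 1 / 2 * (p K x \<bullet> p K x)) x :> transpose (J K x) *v p K x"
      unfolding gderiv_def .
  qed
  have "continuous_on UNIV (\<lambda>x. p K x v* J K x)"
    unfolding vector_matrix_mult_def
    by (intro continuous_on_vec_lambda continuous_intros pw_poly_repD(5,6)[OF rep K])
  then show "continuous_on UNIV (\<lambda>x. transpose (J K x) *v p K x)" by simp
qed

lemma interior_facesD:
  assumes "F \<in> interior_faces \<Omega> T"
  shows "F \<in> mesh_faces T" "\<not> F \<subseteq> frontier \<Omega>" "ori F \<in> T" "F facet_of ori F"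
    "minus_element T ori F \<in> T" "F facet_of minus_element T ori F" "minus_element T ori F \<noteq> ori F"
    "{K \<in> T. F facet_of K} = {ori F, minus_element T ori F}" "F \<subseteq> ori F" "F \<subseteq> minus_element T ori F"
proof -
  show *: "F \<in> mesh_faces T" "\<not> F \<subseteq> frontier \<Omega>" using assms by (auto simp: interior_faces_def)
  show **: "{K \<in> T. F facet_of K} = {ori F, minus_element T ori F}" "minus_element T ori F \<noteq> ori F"
    using interior_face_elements[OF *] by auto
  show "ori F \<in> T" "F facet_of ori F" "minus_element T ori F \<in> T" "F facet_of minus_element T ori F"
    using **(1) by blast+
  then show "F \<subseteq> ori F" "F \<subseteq> minus_element T ori F" by (auto dest: facet_of_imp_subset)
qed

lemma finite_interior_faces: "finite (interior_faces \<Omega> T)"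
  using finite_faces by (rule finite_subset[rotated]) (auto simp: interior_faces_def)

lemma interior_traces:
  assumes "pw_poly_rep m w p J" "F \<in> interior_faces \<Omega> T" "x \<in> F"
  shows "jump \<Omega> T ori F w x = p (ori F) x - p (minus_element T ori F) x"
    "avg \<Omega> T ori F w x = (1 / 2) *\<^sub>R (p (ori F) x + p (minus_element T ori F) x)"
    "normal_component ori F w x = p (ori F) x \<bullet> face_normal ori F"
proof -
  note F = interior_facesD[OF assms(2)]
  have x: "x \<in> ori F" "x \<in> minus_element T ori F" using F(9,10) assms(3) by auto
  note tr = trace_from_rep(1)[OF assms(1) F(3) x(1)] trace_from_rep(1)[OF assms(1) F(5) x(2)]
  show "jump \<Omega> T ori F w x = p (ori F) x - p (minus_element T ori F) x"
    "avg \<Omega> T ori F w x = (1 / 2) *\<^sub>R (p (ori F) x + p (minus_element T ori F) x)"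
    "normal_component ori F w x = p (ori F) x \<bullet> face_normal ori F"
    using F(2) tr by (simp_all add: jump_def avg_def normal_component_def)
qed

text \<open>In the sum of the element balances each interior face occurs twice, with the same flux
  from its \<open>+\<close> side and opposite signs. What remains is this flux times the difference
  of |w|^2/2 across the face, which factors as jump times average.\<close>

lemma convection_volume:
  assumes \<beta>: "\<beta> \<in> H0_div \<Omega>" and rep\<beta>: "pw_poly_rep m \<beta> pb Jb" and rep: "pw_poly_rep m' w p J"
  shows "(LINT x:\<Omega>|lebesgue. (grad_h w x *v \<beta> x) \<bullet> w x)
     + 1 / 2 * (LINT x:\<Omega>|lebesgue. weak_div \<Omega> \<beta> x * (w x \<bullet> w x)) =
   (\<Sum>F\<in>interior_faces \<Omega> T. LINT x|surface_measure F.
          normal_component ori F \<beta> x * (jump \<Omega> T ori F w x \<bullet> avg \<Omega> T ori F w x))"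
proof -
  define \<psi> where "\<psi> K x = 1 / 2 * (p K x \<bullet> p K x)" for K x
  define \<Psi> where "\<Psi> K x = transpose (J K x) *v p K x" for K x
  have \<psi>: "C1_with_gradient (\<psi> K) (\<Psi> K)" if "K \<in> T" for K
    using C1_half_square[OF rep that] by (simp add: \<psi>_def[abs_def] \<Psi>_def[abs_def])
  obtain g where g: "is_weak_div \<Omega> \<beta> g" using \<beta> unfolding H0_div_def by blast
  have "is_weak_div \<Omega> \<beta> (weak_div \<Omega> \<beta>)"
    unfolding weak_div_def by (rule someI[of "is_weak_div \<Omega> \<beta>", OF g])
  then have L2wd: "L2 \<Omega> (weak_div \<Omega> \<beta>)" by (simp add: is_weak_div_def)
  have e1: "(\<lambda>x. indicator (interior K) x * ((grad_h w x *v \<beta> x) \<bullet> w x)) =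
      (\<lambda>x. indicator (interior K) x * (pb K x \<bullet> \<Psi> K x))" if "K \<in> T" for K
  proof (rule interior_integral_cong[OF that])
    fix x assume x: "x \<in> interior K"
    have "(J K x *v pb K x) \<bullet> p K x = (p K x v* J K x) \<bullet> pb K x"
      by (subst dot_lmul_matrix) (rule inner_commute)
    then show "(grad_h w x *v \<beta> x) \<bullet> w x = pb K x \<bullet> \<Psi> K x"
      using x that pw_poly_repD(1)[OF rep\<beta> that x] pw_poly_repD(1)[OF rep that x] grad_h_eq[OF rep that x]
      by (simp add: \<Psi>_def inner_commute)
  qed
  have e2: "(\<lambda>x. indicator (interior K) x * (weak_div \<Omega> \<beta> x * (w x \<bullet> w x))) =
      (\<lambda>x. 2 * (indicator (interior K) x * (weak_div \<Omega> \<beta> x * \<psi> K x)))" if "K \<in> T" for K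
    using pw_poly_repD(1)[OF rep that] by (auto simp: \<psi>_def indicator_def fun_eq_iff)
  have i1: "integrable lebesgue (\<lambda>x. indicator (interior K) x * ((grad_h w x *v \<beta> x) \<bullet> w x))" if "K \<in> T" for K
    unfolding e1[OF that]
    by (intro integrable_interior_continuous that continuous_intros pw_poly_repD(5)[OF rep\<beta> that]
        C1_with_gradient_continuous[OF \<psi>[OF that]])
  have i2: "integrable lebesgue (\<lambda>x. indicator (interior K) x * (weak_div \<Omega> \<beta> x * (w x \<bullet> w x)))" if "K \<in> T" for K
    unfolding e2[OF that]
  proof (rule integrable_mult_right)
    interpret convex_body K by (rule body[OF that])
    have "L2 (interior K) (weak_div \<Omega> \<beta>)"
      by (rule L2_subset[OF L2wd _ interior_subset_domain[OF that]]) simp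
    moreover have "L2 (interior K) (\<psi> K)"
      by (rule L2_interior_continuous[OF C1_with_gradient_continuous(1)[OF \<psi>[OF that]]])
    ultimately show "integrable lebesgue (\<lambda>x. indicator (interior K) x * (weak_div \<Omega> \<beta> x * \<psi> K x))"
      using L2_inner_integrable by (fastforce simp: set_integrable_def)
  qed
  define I where "I K F = (LINT x|surface_measure F. (pb (ori F) x \<bullet> face_normal ori F) * \<psi> K x)" for K F
  have "(LINT x:\<Omega>|lebesgue. (grad_h w x *v \<beta> x) \<bullet> w x)
     + 1 / 2 * (LINT x:\<Omega>|lebesgue. weak_div \<Omega> \<beta> x * (w x \<bullet> w x)) =
     (\<Sum>K\<in>T. (LINT x|lebesgue. indicator (interior K) x * (pb K x \<bullet> \<Psi> K x)) +
       (LINT x|lebesgue. indicator (interior K) x * (weak_div \<Omega> \<beta> x * \<psi> K x)))"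
    using domain_integral_split(2)[OF i1] domain_integral_split(2)[OF i2]
    by (simp add: e1 e2 sum.distrib sum_distrib_left)
  also have "\<dots> = (\<Sum>K\<in>T. \<Sum>F | F facet_of K \<and> \<not> F \<subseteq> frontier \<Omega>. (if ori F = K then 1 else -1) * I K F)"
    unfolding I_def by (rule sum.cong[OF refl], rule element_balance[OF _ \<beta> rep\<beta> \<psi>])
  also have "\<dots> = (\<Sum>K\<in>T. \<Sum>F\<in>interior_faces \<Omega> T. if F facet_of K then (if ori F = K then 1 else -1) * I K F else 0)"
  proof (rule sum.cong[OF refl])
    fix K assume K: "K \<in> T"
    have "{F. F facet_of K \<and> \<not> F \<subseteq> frontier \<Omega>} = {F \<in> interior_faces \<Omega> T. F facet_of K}"
      using K by (auto simp: interior_faces_def mesh_faces_def)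
    then show "(\<Sum>F | F facet_of K \<and> \<not> F \<subseteq> frontier \<Omega>. (if ori F = K then 1 else -1) * I K F) =
        (\<Sum>F\<in>interior_faces \<Omega> T. if F facet_of K then (if ori F = K then 1 else -1) * I K F else 0)"
      using finite_interior_faces by (simp add: sum.inter_filter)
  qed
  also have "\<dots> = (\<Sum>F\<in>interior_faces \<Omega> T. \<Sum>K\<in>T. if F facet_of K then (if ori F = K then 1 else -1) * I K F else 0)"
    by (rule sum.swap)
  also have "\<dots> = (\<Sum>F\<in>interior_faces \<Omega> T. LINT x|surface_measure F.
          normal_component ori F \<beta> x * (jump \<Omega> T ori F w x \<bullet> avg \<Omega> T ori F w x))"
  proof (rule sum.cong[OF refl])
    fix F assume F: "F \<in> interior_faces \<Omega> T"
    note f = interior_facesD[OF F]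
    have "(\<Sum>K\<in>T. if F facet_of K then (if ori F = K then 1 else -1) * I K F else 0) =
        (\<Sum>K\<in>{K \<in> T. F facet_of K}. (if ori F = K then 1 else -1) * I K F)"
      using finite_T by (simp add: sum.inter_filter)
    also have "\<dots> = I (ori F) F - I (minus_element T ori F) F"
      unfolding f(8) using f(7) by simp
    also have "\<dots> = (LINT x|surface_measure F. (pb (ori F) x \<bullet> face_normal ori F) * \<psi> (ori F) x -
        (pb (ori F) x \<bullet> face_normal ori F) * \<psi> (minus_element T ori F) x)"
      unfolding I_def using f(1,3,5)
      by (intro Bochner_Integration.integral_diff[symmetric] integrable_face continuous_intros
          pw_poly_repD(5)[OF rep\<beta>] C1_with_gradient_continuous[OF \<psi>])
    also have "\<dots> = (LINT x|surface_measure F.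
          normal_component ori F \<beta> x * (jump \<Omega> T ori F w x \<bullet> avg \<Omega> T ori F w x))"
    proof (rule face_integral_cong[OF f(1)])
      fix x assume x: "x \<in> F"
      have "\<psi> (ori F) x - \<psi> (minus_element T ori F) x = jump \<Omega> T ori F w x \<bullet> avg \<Omega> T ori F w x"
        unfolding interior_traces(1,2)[OF rep F x] \<psi>_def
        by (simp add: inner_add_right inner_diff_left inner_commute algebra_simps)
      then show "(pb (ori F) x \<bullet> face_normal ori F) * \<psi> (ori F) x -
        (pb (ori F) x \<bullet> face_normal ori F) * \<psi> (minus_element T ori F) x =
        normal_component ori F \<beta> x * (jump \<Omega> T ori F w x \<bullet> avg \<Omega> T ori F w x)"
        unfolding interior_traces(3)[OF rep\<beta> F x] by (simp add: right_diff_distrib[symmetric])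
    qed
    finally show "(\<Sum>K\<in>T. if F facet_of K then (if ori F = K then 1 else -1) * I K F else 0) =
      (LINT x|surface_measure F. normal_component ori F \<beta> x * (jump \<Omega> T ori F w x \<bullet> avg \<Omega> T ori F w x))" .
  qed
  finally show ?thesis .
qed

text \<open>The volume terms cancel the consistency sum over the faces, and only the upwind sum
  survives.\<close>

lemma c_form_diagonal:
  assumes \<beta>: "\<beta> \<in> H0_div \<Omega>" and rep\<beta>: "pw_poly_rep m \<beta> pb Jb" and rep: "pw_poly_rep m' w p J"
    and \<zeta>: "0 \<le> \<zeta>"
  shows "c_form \<Omega> T ori \<zeta> \<beta> w w = (upwind_seminorm \<Omega> T ori \<zeta> \<beta> w)\<^sup>2"
proof -
  have "0 \<le> \<zeta> * (\<Sum>F\<in>interior_faces \<Omega> T. LINT x|surface_measure F.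
      \<bar>normal_component ori F \<beta> x\<bar> * (norm (jump \<Omega> T ori F w x))\<^sup>2)"
    using \<zeta> by (intro mult_nonneg_nonneg sum_nonneg integral_nonneg_AE) auto
  then show ?thesis
    unfolding c_form_def upwind_seminorm_def convection_volume[OF \<beta> rep\<beta> rep]
    by (simp add: dot_square_norm)
qed

section \<open>Coercivity of the viscous form\<close>

lemma L2_norm_element_power2:
  assumes K: "K \<in> T" and q: "continuous_on UNIV (q :: real ^ 'd \<Rightarrow> real)"
  shows "(L2_norm K q)\<^sup>2 = (LINT x|lebesgue. indicator (interior K) x * (q x)\<^sup>2)"
proof -
  have "(L2_norm K q)\<^sup>2 = (LINT x:K|lebesgue. (q x)\<^sup>2)"
    unfolding L2_norm_power2 L2_inner_def by (simp add: power2_eq_square)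
  also have "\<dots> = (LINT x|lebesgue. indicator (interior K) x * (q x)\<^sup>2)"
    by (intro integral_interior_eq K continuous_intros q)
  finally show ?thesis .
qed

text \<open>The scalar inequality is squared and summed over the entries. Since the squared
  Frobenius norm is the sum of the squared entries, the constant does not grow with the dimension;
  \<open>diameter F \<le> diameter K\<close> then brings in the length used by the penalty.\<close>

lemma trace_inequality_matrix:
  assumes K: "K \<in> T" and F: "F facet_of K" and d: "CARD('d) \<ge> 2"
    and trace: "\<And>q. poly_deg_le m q \<Longrightarrow>
      sqrt (diameter K) * sqrt (LINT x|surface_measure F. (q x)\<^sup>2) \<le> C * L2_norm K q"
    and M: "\<And>i j. poly_deg_le m (\<lambda>x. M x $ i $ j)"
  shows "diameter F * (LINT x|surface_measure F. (norm (M x :: real ^ 'd ^ 'd))\<^sup>2) \<le>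
    C\<^sup>2 * (LINT x|lebesgue. indicator (interior K) x * (norm (M x))\<^sup>2)"
proof -
  note diam = facet_diameter_pos[OF body[OF K] F d]
  have FT: "F \<in> mesh_faces T" by (rule mesh_facesI[OF K F])
  note [continuous_intros] = poly_deg_le_continuous_on[OF M]
  have entry: "diameter K * (LINT x|surface_measure F. (M x $ i $ j)\<^sup>2) \<le>
      C\<^sup>2 * (LINT x|lebesgue. indicator (interior K) x * (M x $ i $ j)\<^sup>2)" for i j
  proof -
    let ?I = "LINT x|surface_measure F. (M x $ i $ j)\<^sup>2"
    have I: "0 \<le> ?I" by (intro integral_nonneg_AE) auto
    have "(sqrt (diameter K) * sqrt ?I)\<^sup>2 \<le> (C * L2_norm K (\<lambda>x. M x $ i $ j))\<^sup>2"
      using trace[OF M, of i j] diam I by (intro power_mono) auto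
    then show ?thesis
      using diam I L2_norm_element_power2[OF K poly_deg_le_continuous_on[OF M]]
      by (simp add: power_mult_distrib)
  qed
  have "(LINT x|surface_measure F. (norm (M x))\<^sup>2) = (\<Sum>i\<in>UNIV. \<Sum>j\<in>UNIV. LINT x|surface_measure F. (M x $ i $ j)\<^sup>2)"
    unfolding norm_matrix_power2
    by (subst Bochner_Integration.integral_sum, intro Bochner_Integration.integrable_sum integrable_face FT continuous_intros)
      (intro sum.cong refl Bochner_Integration.integral_sum integrable_face FT continuous_intros)
  moreover have "(LINT x|lebesgue. indicator (interior K) x * (norm (M x))\<^sup>2) =
      (\<Sum>i\<in>UNIV. \<Sum>j\<in>UNIV. LINT x|lebesgue. indicator (interior K) x * (M x $ i $ j)\<^sup>2)"
    unfolding norm_matrix_power2 sum_distrib_left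
    by (subst Bochner_Integration.integral_sum, intro Bochner_Integration.integrable_sum integrable_interior_continuous K continuous_intros)
      (intro sum.cong refl Bochner_Integration.integral_sum integrable_interior_continuous K continuous_intros)
  moreover have "diameter F * (LINT x|surface_measure F. (norm (M x))\<^sup>2) \<le>
      diameter K * (LINT x|surface_measure F. (norm (M x))\<^sup>2)"
    using diam(2) by (intro mult_right_mono integral_nonneg_AE) auto
  moreover have "(\<Sum>i\<in>UNIV. \<Sum>j\<in>UNIV. diameter K * (LINT x|surface_measure F. (M x $ i $ j)\<^sup>2)) \<le>
      (\<Sum>i\<in>UNIV. \<Sum>j\<in>UNIV. C\<^sup>2 * (LINT x|lebesgue. indicator (interior K) x * (M x $ i $ j)\<^sup>2))"
    by (intro sum_mono entry)
  ultimately show ?thesis by (simp add: sum_distrib_left)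
qed

lemma jump_rep:
  assumes rep: "pw_poly_rep m w p J" and F: "F \<in> mesh_faces T"
  defines "j \<equiv> (\<lambda>x. if F \<subseteq> frontier \<Omega> then p (ori F) x else p (ori F) x - p (minus_element T ori F) x)"
    and "a \<equiv> (\<lambda>x. if F \<subseteq> frontier \<Omega> then dev_part (J (ori F) x) else
      (1 / 2) *\<^sub>R (dev_part (J (ori F) x) + dev_part (J (minus_element T ori F) x)))"
  shows "\<And>x. x \<in> F \<Longrightarrow> jump \<Omega> T ori F w x = j x" "\<And>x. x \<in> F \<Longrightarrow> avg \<Omega> T ori F (sym_grad_h w) x = a x"
    "continuous_on UNIV j" "continuous_on UNIV a"
proof -
  note o = ori_face[OF F]
  have Fo: "F \<subseteq> ori F" using o(2) by (rule facet_of_imp_subset)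
  show "jump \<Omega> T ori F w x = j x" "avg \<Omega> T ori F (sym_grad_h w) x = a x" if x: "x \<in> F" for x
  proof -
    have xo: "x \<in> ori F" using x Fo by blast
    have "jump \<Omega> T ori F w x = j x \<and> avg \<Omega> T ori F (sym_grad_h w) x = a x"
    proof (cases "F \<subseteq> frontier \<Omega>")
      case True
      then show ?thesis using trace_from_rep[OF rep o(1) xo] by (simp add: jump_def avg_def j_def a_def)
    next
      case False
      then have "F \<in> interior_faces \<Omega> T" using F by (simp add: interior_faces_def)
      note f = interior_facesD[OF this]
      have "x \<in> minus_element T ori F" using f(10) x by blast
      then show ?thesis using False trace_from_rep[OF rep o(1) xo] trace_from_rep[OF rep f(5)]
        by (simp add: jump_def avg_def j_def a_def)
    qed
    then show "jump \<Omega> T ori F w x = j x" "avg \<Omega> T ori F (sym_grad_h w) x = a x" by auto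
  qed
  show "continuous_on UNIV j" "continuous_on UNIV a"
  proof -
    have "continuous_on UNIV j \<and> continuous_on UNIV a"
    proof (cases "F \<subseteq> frontier \<Omega>")
      case True
      then show ?thesis using pw_poly_repD(5,7)[OF rep o(1)] by (simp add: j_def a_def)
    next
      case False
      then have "F \<in> interior_faces \<Omega> T" using F by (simp add: interior_faces_def)
      note f = interior_facesD[OF this]
      show ?thesis using False pw_poly_repD(5,7)[OF rep o(1)] pw_poly_repD(5,7)[OF rep f(5)]
        by (auto simp: j_def a_def intro!: continuous_intros)
    qed
    then show "continuous_on UNIV j" "continuous_on UNIV a" by auto
  qed
qed

text \<open>The factor 1 on the right treats both kinds of faces alike: on a boundary face the
  average is the single trace, and on an interior face even half the sum would suffice.\<close>

lemma avg_norm_le: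
  assumes rep: "pw_poly_rep m w p J" and F: "F \<in> mesh_faces T" and x: "x \<in> F"
  shows "(norm (avg \<Omega> T ori F (sym_grad_h w) x))\<^sup>2 \<le>
    (\<Sum>K | K \<in> T \<and> F facet_of K. (norm (dev_part (J K x)))\<^sup>2)"
proof (cases "F \<subseteq> frontier \<Omega>")
  case True
  then show ?thesis using jump_rep(2)[OF rep F x] boundary_face_element[OF F] by simp
next
  case False
  then have "F \<in> interior_faces \<Omega> T" using F by (simp add: interior_faces_def)
  note f = interior_facesD[OF this]
  let ?A = "dev_part (J (ori F) x)" and ?B = "dev_part (J (minus_element T ori F) x)"
  have "norm ((1 / 2) *\<^sub>R (?A + ?B)) \<le> (norm ?A + norm ?B) / 2"
    using norm_triangle_ineq[of ?A ?B] by simp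
  then have "(norm ((1 / 2) *\<^sub>R (?A + ?B)))\<^sup>2 \<le> ((norm ?A + norm ?B) / 2)\<^sup>2" by (intro power_mono) auto
  also have "\<dots> \<le> (norm ?A)\<^sup>2 + (norm ?B)\<^sup>2"
  proof -
    have "((a + b) / 2)\<^sup>2 = (a\<^sup>2 + b\<^sup>2) / 2 - ((a - b) / 2)\<^sup>2" for a b :: real
      by (simp add: power2_eq_square field_simps)
    moreover have "(a\<^sup>2 + b\<^sup>2) / 2 - c\<^sup>2 \<le> a\<^sup>2 + b\<^sup>2" for a b c :: real
      using zero_le_power2[of a] zero_le_power2[of b] zero_le_power2[of c] by (simp add: field_simps)
    ultimately show ?thesis by simp
  qed
  finally show ?thesis
    using False jump_rep(2)[OF rep F x] f(7) unfolding f(8) by simp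
qed

text \<open>On the diagonal the two consistency sums coincide, so twice one of them has to be
  absorbed: its gradient share by the volume term, its jump share by the penalty. The parameter
  \<open>\<epsilon>\<close> balances the two shares.\<close>

lemma a_form_coercive:
  assumes d: "CARD('d) = 2 \<or> CARD('d) = 3" and rep: "pw_poly_rep m w p J"
    and trace: "\<And>K F q. K \<in> T \<Longrightarrow> F facet_of K \<Longrightarrow> poly_deg_le m q \<Longrightarrow>
      sqrt (diameter K) * sqrt (LINT x|surface_measure F. (q x)\<^sup>2) \<le> C * L2_norm K q"
    and N: "\<And>K. K \<in> T \<Longrightarrow> card {F. F facet_of K} \<le> N"
    and \<epsilon>: "0 < \<epsilon>"
  shows "(1 / 2 - \<epsilon> * (C\<^sup>2 * real N)) * (L2_norm \<Omega> (sym_grad_h w))\<^sup>2 +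
      (\<eta> - 1 / \<epsilon>) * (\<Sum>F\<in>mesh_faces T. 1 / diameter F *
            (LINT x|surface_measure F. (norm (jump \<Omega> T ori F w x))\<^sup>2)) \<le> a_form \<Omega> T ori \<eta> w w"
proof -
  have d2: "CARD('d) \<ge> 2" using d by auto
  define D where "D K x = dev_part (J K x)" for K x
  define E where "E K = (LINT x|lebesgue. indicator (interior K) x * (norm (D K x))\<^sup>2)" for K
  have Dc: "continuous_on A (D K)" if "K \<in> T" for K A
    using pw_poly_repD(7)[OF rep that] by (simp add: D_def[abs_def])
  have eqs: "(\<lambda>x. indicator (interior K) x * (sym_grad_h w x \<bullet> grad_h w x)) =
      (\<lambda>x. indicator (interior K) x * (D K x \<bullet> J K x))"
    "(\<lambda>x. indicator (interior K) x * (norm (sym_grad_h w x))\<^sup>2) =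
      (\<lambda>x. indicator (interior K) x * (norm (D K x))\<^sup>2)" if "K \<in> T" for K
    by (rule interior_integral_cong[OF that]; simp add: sym_grad_h_eq grad_h_eq[OF rep that] D_def)+
  have ints: "integrable lebesgue (\<lambda>x. indicator (interior K) x * (D K x \<bullet> J K x))"
    "integrable lebesgue (\<lambda>x. indicator (interior K) x * (norm (D K x))\<^sup>2)" if "K \<in> T" for K
    by (intro integrable_interior_continuous that continuous_intros Dc pw_poly_repD(6)[OF rep that])+
  have norm_eq: "(L2_norm \<Omega> (sym_grad_h w))\<^sup>2 = (\<Sum>K\<in>T. E K)"
  proof -
    have "(L2_norm \<Omega> (sym_grad_h w))\<^sup>2 = (LINT x:\<Omega>|lebesgue. (norm (sym_grad_h w x))\<^sup>2)"
      unfolding L2_norm_power2 L2_inner_def by (simp add: dot_square_norm)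
    also have "\<dots> = (\<Sum>K\<in>T. E K)"
      using domain_integral_split(2)[of "\<lambda>x. (norm (sym_grad_h w x))\<^sup>2"] eqs(2) ints(2) by (simp add: E_def)
    finally show ?thesis .
  qed
  have vol: "1 / 2 * (L2_norm \<Omega> (sym_grad_h w))\<^sup>2 \<le> (LINT x:\<Omega>|lebesgue. sym_grad_h w x \<bullet> grad_h w x)"
  proof -
    have "1 / 2 * (\<Sum>K\<in>T. E K) = (\<Sum>K\<in>T. LINT x|lebesgue. 1 / 2 * (indicator (interior K) x * (norm (D K x))\<^sup>2))"
      by (simp add: E_def sum_distrib_left)
    also have "\<dots> \<le> (\<Sum>K\<in>T. LINT x|lebesgue. indicator (interior K) x * (D K x \<bullet> J K x))"
    proof (intro sum_mono integral_mono)
      fix K x assume "K \<in> T"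
      have "CARD('d) \<le> 3" using d by auto
      from dev_part_coercive[OF this, of "J K x"]
      show "1 / 2 * (indicator (interior K) x * (norm (D K x))\<^sup>2) \<le> indicator (interior K) x * (D K x \<bullet> J K x)"
        by (simp add: D_def indicator_def)
    qed (use ints in auto)
    also have "\<dots> = (LINT x:\<Omega>|lebesgue. sym_grad_h w x \<bullet> grad_h w x)"
      using domain_integral_split(2)[of "\<lambda>x. sym_grad_h w x \<bullet> grad_h w x"] eqs(1) ints(1) by simp
    finally show ?thesis by (simp add: norm_eq)
  qed
  define X where "X F = (LINT x|surface_measure F.
      jump \<Omega> T ori F w x \<bullet> (avg \<Omega> T ori F (sym_grad_h w) x *v face_normal ori F))" for F
  define Y where "Y F = (LINT x|surface_measure F. (norm (jump \<Omega> T ori F w x))\<^sup>2)" for F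
  \<comment> \<open>Young's inequality weighted by the diameter of the face, after which the trace
    inequality moves the average from the face to the adjacent elements.\<close>
  have face: "2 * X F \<le> \<epsilon> * (\<Sum>K | K \<in> T \<and> F facet_of K. C\<^sup>2 * E K) + 1 / \<epsilon> * (1 / diameter F * Y F)"
    if F: "F \<in> mesh_faces T" for F
  proof -
    note o = ori_face[OF F] and r = jump_rep[OF rep F]
    define j where "j x = (if F \<subseteq> frontier \<Omega> then p (ori F) x else p (ori F) x - p (minus_element T ori F) x)" for x
    define a where "a x = (if F \<subseteq> frontier \<Omega> then dev_part (J (ori F) x) else
      (1 / 2) *\<^sub>R (dev_part (J (ori F) x) + dev_part (J (minus_element T ori F) x)))" for x
    note r = r[folded j_def a_def]
    define n where "n = face_normal ori F"
    have n: "norm n = 1"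
      using convex_body.facet_hyperplane(1)[OF body[OF o(1)] o(2)] by (simp add: n_def face_normal_def)
    have h: "0 < diameter F" using facet_diameter_pos(1)[OF body[OF o(1)] o(2) d2] .
    have XF: "X F = (LINT x|surface_measure F. j x \<bullet> (a x *v n))"
      unfolding X_def n_def using r(1,2) by (intro face_integral_cong[OF F]) simp
    have YF: "Y F = (LINT x|surface_measure F. (norm (j x))\<^sup>2)"
      unfolding Y_def using r(1) by (intro face_integral_cong[OF F]) simp
    have "continuous_on UNIV (\<lambda>x. a x *v n)"
      unfolding matrix_vector_mult_def by (intro continuous_on_vec_lambda continuous_intros r(4))
    then have i1: "integrable (surface_measure F) (\<lambda>x. 2 * (j x \<bullet> (a x *v n)))"
      by (intro integrable_face F continuous_intros r(3))
    have i2: "integrable (surface_measure F) (\<lambda>x. (norm (D K x))\<^sup>2)" if "K \<in> T" for K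
      using Dc[OF that] by (intro integrable_face F continuous_intros)
    have i3: "integrable (surface_measure F) (\<lambda>x. (norm (j x))\<^sup>2)"
      by (intro integrable_face F continuous_intros r(3))
    have "2 * X F = (LINT x|surface_measure F. 2 * (j x \<bullet> (a x *v n)))" by (simp add: XF)
    also have "\<dots> \<le> (LINT x|surface_measure F. \<epsilon> * (diameter F * (\<Sum>K | K \<in> T \<and> F facet_of K. (norm (D K x))\<^sup>2)) +
        1 / (\<epsilon> * diameter F) * (norm (j x))\<^sup>2)"
    proof (rule integral_mono[OF i1])
      show "integrable (surface_measure F) (\<lambda>x. \<epsilon> * (diameter F * (\<Sum>K | K \<in> T \<and> F facet_of K. (norm (D K x))\<^sup>2)) +
        1 / (\<epsilon> * diameter F) * (norm (j x))\<^sup>2)"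
        using i2 i3 by (intro Bochner_Integration.integrable_add integrable_mult_right Bochner_Integration.integrable_sum) auto
      fix x assume "x \<in> space (surface_measure F)"
      then have x: "x \<in> F" using space_surface[OF F] by simp
      have "norm (a x *v n) \<le> norm (a x)" using norm_matrix_vector_le[of "a x" n] n by simp
      then have "(norm (a x *v n))\<^sup>2 \<le> (norm (a x))\<^sup>2" by (intro power_mono) auto
      also have "\<dots> \<le> (\<Sum>K | K \<in> T \<and> F facet_of K. (norm (D K x))\<^sup>2)"
        using avg_norm_le[OF rep F x] r(2)[OF x] by (simp add: D_def)
      finally have "\<epsilon> * diameter F * (norm (a x *v n))\<^sup>2 \<le>
          \<epsilon> * diameter F * (\<Sum>K | K \<in> T \<and> F facet_of K. (norm (D K x))\<^sup>2)"
        using \<epsilon> h by (intro mult_left_mono) auto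
      with Young_inner[OF \<epsilon> h, of "j x" "a x *v n"]
      show "2 * (j x \<bullet> (a x *v n)) \<le> \<epsilon> * (diameter F * (\<Sum>K | K \<in> T \<and> F facet_of K. (norm (D K x))\<^sup>2)) +
        1 / (\<epsilon> * diameter F) * (norm (j x))\<^sup>2" by simp
    qed
    also have "\<dots> = \<epsilon> * (\<Sum>K | K \<in> T \<and> F facet_of K. diameter F * (LINT x|surface_measure F. (norm (D K x))\<^sup>2)) +
        1 / (\<epsilon> * diameter F) * Y F"
      unfolding YF using i2 i3
      by (subst Bochner_Integration.integral_add)
        (auto simp: Bochner_Integration.integral_sum sum_distrib_left
          intro!: integrable_mult_right Bochner_Integration.integrable_sum integrable_mult_left integrable_divide)
    also have "\<dots> \<le> \<epsilon> * (\<Sum>K | K \<in> T \<and> F facet_of K. C\<^sup>2 * E K) + 1 / (\<epsilon> * diameter F) * Y F"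
    proof (intro add_right_mono mult_left_mono sum_mono)
      fix K assume "K \<in> {K. K \<in> T \<and> F facet_of K}"
      then have K: "K \<in> T" "F facet_of K" by auto
      show "diameter F * (LINT x|surface_measure F. (norm (D K x))\<^sup>2) \<le> C\<^sup>2 * E K"
        unfolding E_def
        by (rule trace_inequality_matrix[OF K d2 trace[OF K]])
          (use pw_poly_repD(8)[OF rep K(1)] in \<open>simp_all add: D_def\<close>)
    qed (use \<epsilon> in simp)
    finally show ?thesis by simp
  qed
  have E0: "0 \<le> E K" for K unfolding E_def by (intro integral_nonneg_AE) auto
  \<comment> \<open>After exchanging the sums, every element is counted once for each of its facets,
    hence at most \<open>N\<close> times.\<close>
  have count: "(\<Sum>F\<in>mesh_faces T. \<Sum>K | K \<in> T \<and> F facet_of K. C\<^sup>2 * E K) \<le> C\<^sup>2 * real N * (\<Sum>K\<in>T. E K)"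
  proof -
    have "(\<Sum>F\<in>mesh_faces T. \<Sum>K | K \<in> T \<and> F facet_of K. C\<^sup>2 * E K) =
        (\<Sum>F\<in>mesh_faces T. \<Sum>K\<in>T. if F facet_of K then C\<^sup>2 * E K else 0)"
      by (rule sum.cong[OF refl], rule sum.inter_filter[OF finite_T])
    also have "\<dots> = (\<Sum>K\<in>T. \<Sum>F\<in>mesh_faces T. if F facet_of K then C\<^sup>2 * E K else 0)"
      by (rule sum.swap)
    also have "\<dots> = (\<Sum>K\<in>T. \<Sum>F | F \<in> mesh_faces T \<and> F facet_of K. C\<^sup>2 * E K)"
      by (rule sum.cong[OF refl], rule sum.inter_filter[OF finite_faces, symmetric])
    also have "\<dots> \<le> (\<Sum>K\<in>T. real N * (C\<^sup>2 * E K))"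
    proof (rule sum_mono)
      fix K assume K: "K \<in> T"
      have "{F. F \<in> mesh_faces T \<and> F facet_of K} = {F. F facet_of K}" using mesh_facesI[OF K] by auto
      then have "(\<Sum>F | F \<in> mesh_faces T \<and> F facet_of K. C\<^sup>2 * E K) = real (card {F. F facet_of K}) * (C\<^sup>2 * E K)"
        by simp
      also have "\<dots> \<le> real N * (C\<^sup>2 * E K)"
        using N[OF K] E0[of K] by (intro mult_right_mono) auto
      finally show "(\<Sum>F | F \<in> mesh_faces T \<and> F facet_of K. C\<^sup>2 * E K) \<le> real N * (C\<^sup>2 * E K)" .
    qed
    also have "\<dots> = C\<^sup>2 * real N * (\<Sum>K\<in>T. E K)"
      unfolding sum_distrib_left by (rule sum.cong) (simp_all add: mult_ac)
    finally show ?thesis .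
  qed
  have "(\<Sum>F\<in>mesh_faces T. 2 * X F) \<le>
      (\<Sum>F\<in>mesh_faces T. \<epsilon> * (\<Sum>K | K \<in> T \<and> F facet_of K. C\<^sup>2 * E K) + 1 / \<epsilon> * (1 / diameter F * Y F))"
    by (rule sum_mono) (rule face)
  also have "\<dots> = \<epsilon> * (\<Sum>F\<in>mesh_faces T. \<Sum>K | K \<in> T \<and> F facet_of K. C\<^sup>2 * E K) +
      1 / \<epsilon> * (\<Sum>F\<in>mesh_faces T. 1 / diameter F * Y F)"
    by (simp only: sum.distrib sum_distrib_left)
  also have "\<dots> \<le> \<epsilon> * (C\<^sup>2 * real N * (\<Sum>K\<in>T. E K)) + 1 / \<epsilon> * (\<Sum>F\<in>mesh_faces T. 1 / diameter F * Y F)"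
    using count \<epsilon> by (intro add_right_mono mult_left_mono) auto
  finally have faces: "2 * (\<Sum>F\<in>mesh_faces T. X F) \<le>
      \<epsilon> * (C\<^sup>2 * real N * (\<Sum>K\<in>T. E K)) + 1 / \<epsilon> * (\<Sum>F\<in>mesh_faces T. 1 / diameter F * Y F)"
    by (simp add: sum_distrib_left)
  have "a_form \<Omega> T ori \<eta> w w = (LINT x:\<Omega>|lebesgue. sym_grad_h w x \<bullet> grad_h w x) -
      2 * (\<Sum>F\<in>mesh_faces T. X F) + \<eta> * (\<Sum>F\<in>mesh_faces T. 1 / diameter F * Y F)"
  proof -
    have pen: "(\<Sum>F\<in>mesh_faces T. \<eta> / diameter F * (LINT x|surface_measure F.
          jump \<Omega> T ori F w x \<bullet> jump \<Omega> T ori F w x)) = \<eta> * (\<Sum>F\<in>mesh_faces T. 1 / diameter F * Y F)"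
      by (simp add: Y_def dot_square_norm sum_distrib_left)
    show ?thesis unfolding a_form_def X_def[symmetric] pen by simp
  qed
  with vol faces show ?thesis
    unfolding norm_eq Y_def[symmetric] by (simp only: left_diff_distrib mult.assoc)
qed

end

section \<open>Dependence on time and the energy inequality\<close>

text \<open>Dominated convergence: \<open>G\<close> is bounded on the compact product, and
  \<open>h\<close> confines the integral to \<open>F\<close>. The factor \<open>h\<close> allows the
  same statement to serve volume and face integrals.\<close>

lemma continuous_on_parameter_integral:
  fixes G :: "real \<Rightarrow> 'a::euclidean_space \<Rightarrow> real"
  assumes h: "integrable M h" "\<And>x. x \<in> space M \<Longrightarrow> h x \<noteq> 0 \<Longrightarrow> x \<in> F"
    and F: "compact F" and I: "compact I"
    and G: "continuous_on (I \<times> F) (\<lambda>(t, x). G t x)" "\<And>t. t \<in> I \<Longrightarrow> G t \<in> borel_measurable M"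
  shows "continuous_on I (\<lambda>t. LINT x|M. h x * G t x)"
proof (rule continuous_on_sequentiallyI)
  fix s t assume s: "\<forall>n. s n \<in> I" and t: "t \<in> I" "s \<longlonglongrightarrow> t"
  have "bounded ((\<lambda>(t, x). G t x) ` (I \<times> F))"
    by (intro compact_imp_bounded compact_continuous_image G(1) compact_Times I F)
  then obtain B where B: "\<And>t x. t \<in> I \<Longrightarrow> x \<in> F \<Longrightarrow> \<bar>G t x\<bar> \<le> B"
    unfolding bounded_iff by force
  show "(\<lambda>n. LINT x|M. h x * G (s n) x) \<longlonglongrightarrow> (LINT x|M. h x * G t x)"
  proof (rule integral_dominated_convergence[where w = "\<lambda>x. \<bar>h x\<bar> * B"])
    show "(\<lambda>x. h x * G t x) \<in> borel_measurable M" "(\<lambda>x. h x * G (s n) x) \<in> borel_measurable M" for n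
      using h(1) G(2) t(1) s by (auto intro!: borel_measurable_times)
    show "integrable M (\<lambda>x. \<bar>h x\<bar> * B)" using h(1) by simp
    show "AE x in M. (\<lambda>n. h x * G (s n) x) \<longlonglongrightarrow> h x * G t x"
    proof (rule AE_I2)
      fix x assume x: "x \<in> space M"
      show "(\<lambda>n. h x * G (s n) x) \<longlonglongrightarrow> h x * G t x"
      proof (cases "h x = 0")
        case False
        then have "x \<in> F" using h(2) x by blast
        have "continuous_on I (\<lambda>t. (\<lambda>(t, x). G t x) (t, x))"
          by (rule continuous_on_compose2[OF G(1)]) (use \<open>x \<in> F\<close> in \<open>auto intro!: continuous_intros\<close>)
        then have "continuous_on I (\<lambda>t. G t x)" by simp
        then have "(\<lambda>n. G (s n) x) \<longlonglongrightarrow> G t x"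
          using s t by (auto intro: continuous_on_tendsto_compose)
        then show ?thesis by (rule tendsto_mult_left)
      qed simp
    qed
    show "AE x in M. norm (h x * G (s n) x) \<le> \<bar>h x\<bar> * B" for n
    proof (rule AE_I2)
      fix x assume x: "x \<in> space M"
      show "norm (h x * G (s n) x) \<le> \<bar>h x\<bar> * B"
      proof (cases "h x = 0")
        case False
        then have "\<bar>G (s n) x\<bar> \<le> B" using h(2) x B s by blast
        then show ?thesis by (simp add: abs_mult mult_left_mono)
      qed simp
    qed
  qed
qed

context triangulated_domain
begin

lemma L2_interior:
  assumes "L2 \<Omega> v" "K \<in> T"
  shows "L2 (interior K) v" "L2_norm (interior K) v \<le> L2_norm \<Omega> v"
proof -
  show L: "L2 (interior K) v"
    by (rule L2_subset[OF assms(1) _ interior_subset_domain[OF assms(2)]]) simp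
  show "L2_norm (interior K) v \<le> L2_norm \<Omega> v"
    unfolding L2_norm_def set_lebesgue_integral_def
    using assms(1) L interior_subset_domain[OF assms(2)]
    by (intro real_sqrt_le_mono integral_mono) (auto simp: L2_def set_integrable_def indicator_def)
qed

text \<open>
  The coefficients with respect to the reproducing polynomials depend continuously on \<open>w\<close> in \<open>L\<^sup>2\<close>;
  this replaces the equivalence of norms on the finite element space.
\<close>

lemma continuous_pw_poly_rep:
  fixes u :: "real \<Rightarrow> real ^ 'd \<Rightarrow> real ^ 'd"
  assumes u: "\<And>t. t \<in> {t0..tn} \<Longrightarrow> L2 \<Omega> (u t)" "\<And>t i. t \<in> {t0..tn} \<Longrightarrow> pw_poly T m (\<lambda>x. u t x $ i)"
    and cont: "\<And>s. s \<in> {t0..tn} \<Longrightarrow>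
      ((\<lambda>t. L2_norm \<Omega> (\<lambda>x. u t x - u s x)) \<longlongrightarrow> 0) (at s within {t0..tn})"
  obtains P J where "\<And>t. t \<in> {t0..tn} \<Longrightarrow> pw_poly_rep m (u t) (P t) (J t)"
    "\<And>K A. K \<in> T \<Longrightarrow> continuous_on ({t0..tn} \<times> A) (\<lambda>(t, x). P t K x)"
    "\<And>K A. K \<in> T \<Longrightarrow> continuous_on ({t0..tn} \<times> A) (\<lambda>(t, x). dev_part (J t K x))"
proof -
  define basis where "basis K R \<longleftrightarrow> finite R \<and> (\<forall>q\<in>R. poly_deg_le m q) \<and>
      (\<forall>p x. poly_deg_le m p \<longrightarrow> x \<in> K \<longrightarrow> p x = (\<Sum>q\<in>R. L2_inner K p q * q x))"
    for K and R :: "(real ^ 'd \<Rightarrow> real) set"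
  have "\<exists>R. K \<in> T \<longrightarrow> basis K R" for K
  proof (cases "K \<in> T")
    case True
    interpret convex_body K by (rule body[OF True])
    have "K \<subseteq> closure (interior K)" using closure_interior by simp
    then show ?thesis
    proof (rule poly_deg_le_reproducing[OF compact, where m = m])
      fix R assume "finite R" "\<And>q. q \<in> R \<Longrightarrow> poly_deg_le m q"
        "\<And>p x. poly_deg_le m p \<Longrightarrow> x \<in> K \<Longrightarrow> p x = (\<Sum>q\<in>R. L2_inner K p q * q x)"
      then show ?thesis unfolding basis_def by blast
    qed
  qed simp
  then obtain R where "\<And>K. K \<in> T \<Longrightarrow> basis K (R K)" by metis
  then have R: "\<And>K. K \<in> T \<Longrightarrow> finite (R K)" "\<And>K q. K \<in> T \<Longrightarrow> q \<in> R K \<Longrightarrow> poly_deg_le m q"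
    "\<And>K p x. K \<in> T \<Longrightarrow> poly_deg_le m p \<Longrightarrow> x \<in> K \<Longrightarrow> p x = (\<Sum>q\<in>R K. L2_inner K p q * q x)"
    unfolding basis_def by blast+
  \<comment> \<open>One gradient is fixed for each basis polynomial, so that time enters
    \<open>J\<close> only through the coefficients.\<close>
  define G where "G q = (SOME G. (\<forall>x. GDERIV q x :> G x) \<and> (\<forall>i. poly_deg_le m (\<lambda>x. G x $ i)))"
    for q :: "real ^ 'd \<Rightarrow> real"
  have G: "GDERIV q x :> G q x" "poly_deg_le m (\<lambda>x. G q x $ i)" if "poly_deg_le m q" for q x i
    using someI_ex[OF poly_deg_le_gradient[OF that]] unfolding G_def by blast+
  define a where "a K i q t = L2_inner (interior K) (\<lambda>x. u t x $ i) q" for K i q t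
  define P where "P t K x = (\<chi> i. \<Sum>q\<in>R K. a K i q t * q x)" for t K x
  define J where "J t K x = (\<chi> i. \<chi> j. \<Sum>q\<in>R K. a K i q t * G q x $ j)" for t K x
  have L2q: "L2 (interior K) q" if "K \<in> T" "q \<in> R K" for K q
    by (rule convex_body.L2_interior_continuous[OF body[OF that(1)]
          poly_deg_le_continuous_on[OF R(2)[OF that]]])
  have rep: "pw_poly_rep m (u t) (P t) (J t)" if t: "t \<in> {t0..tn}" for t
    unfolding pw_poly_rep_def
  proof (intro ballI conjI allI)
    fix K assume K: "K \<in> T"
    interpret convex_body K by (rule body[OF K])
    fix x assume x: "x \<in> interior K"
    \<comment> \<open>The coefficients integrate over the open element, where \<open>u t\<close> is
      a polynomial; the reproducing formula integrates over \<open>K\<close>, which differs only by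
      a null set.\<close>
    have "u t x $ i = (\<Sum>q\<in>R K. a K i q t * q x)" for i
    proof -
      obtain p where p: "poly_deg_le m p" "\<And>y. y \<in> interior K \<Longrightarrow> u t y $ i = p y"
        using u(2)[OF t, of i] K unfolding pw_poly_def by blast
      have "L2_inner K p q = a K i q t" if q: "q \<in> R K" for q
      proof -
        have "L2_inner K p q = (LINT x|lebesgue. indicator (interior K) x * (p x * q x))"
          unfolding L2_inner_def inner_real_def
          by (intro integral_interior_eq K continuous_intros poly_deg_le_continuous_on[OF p(1)]
              poly_deg_le_continuous_on[OF R(2)[OF K q]])
        also have "\<dots> = a K i q t"
          unfolding a_def L2_inner_def set_lebesgue_integral_def
          by (intro Bochner_Integration.integral_cong refl) (simp add: p(2) indicator_def)
        finally show ?thesis .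
      qed
      moreover have "u t x $ i = (\<Sum>q\<in>R K. L2_inner K p q * q x)"
        using R(3)[OF K p(1), of x] p(2)[OF x] x interior_subset by auto
      ultimately show ?thesis by simp
    qed
    then show "u t x = P t K x" by (simp add: vec_eq_iff P_def)
  next
    fix K i assume K: "K \<in> T"
    show "poly_deg_le m (\<lambda>x. P t K x $ i)"
      unfolding P_def vec_lambda_beta by (intro poly_deg_le_sum poly_deg_le_cmult R(2)[OF K])
  next
    fix K x assume K: "K \<in> T"
    show "(P t K has_derivative (*v) (J t K x)) (at x)"
    proof (rule has_derivative_vec)
      fix i
      have "((\<lambda>x. \<Sum>q\<in>R K. a K i q t * q x) has_derivative (\<lambda>h. \<Sum>q\<in>R K. a K i q t * (h \<bullet> G q x))) (at x)"
        using G(1)[OF R(2)[OF K]] by (intro has_derivative_sum has_derivative_mult_right) (simp add: gderiv_def)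
      moreover have "(\<lambda>h. \<Sum>q\<in>R K. a K i q t * (h \<bullet> G q x)) = (\<lambda>h. h \<bullet> (J t K x $ i))"
        by (simp add: J_def inner_vec_def sum_distrib_left sum.swap[of _ UNIV] mult_ac fun_eq_iff)
      ultimately show "GDERIV (\<lambda>x. P t K x $ i) x :> J t K x $ i"
        by (simp add: gderiv_def P_def)
    qed
  next
    fix K i j assume K: "K \<in> T"
    show "poly_deg_le m (\<lambda>x. J t K x $ i $ j)"
      unfolding J_def vec_lambda_beta by (intro poly_deg_le_sum poly_deg_le_cmult G(2) R(2)[OF K])
  qed
  have a_cont: "continuous_on {t0..tn} (a K i q)" if K: "K \<in> T" "q \<in> R K" for K i q
    unfolding continuous_on_def
  proof (rule ballI)
    fix s assume s: "s \<in> {t0..tn}"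
    have "((\<lambda>t. a K i q t - a K i q s) \<longlongrightarrow> 0) (at s within {t0..tn})"
    proof (rule Lim_null_comparison)
      show "\<forall>\<^sub>F t in at s within {t0..tn}. norm (a K i q t - a K i q s) \<le>
          L2_norm \<Omega> (\<lambda>x. u t x - u s x) * L2_norm (interior K) q"
      proof -
        have "norm (a K i q t - a K i q s) \<le> L2_norm \<Omega> (\<lambda>x. u t x - u s x) * L2_norm (interior K) q"
          if t: "t \<in> {t0..tn}" for t
        proof -
          note L = L2_component(1)[OF L2_interior(1)[OF u(1) K(1)]]
          have "a K i q t - a K i q s = L2_inner (interior K) (\<lambda>x. u t x $ i - u s x $ i) q"
            unfolding a_def by (rule L2_inner_diff_left[OF L[OF t] L[OF s] L2q[OF K], symmetric])
          also have "\<bar>\<dots>\<bar> \<le> L2_norm (interior K) (\<lambda>x. u t x $ i - u s x $ i) * L2_norm (interior K) q"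
            by (intro L2_Cauchy_Schwarz L2_diff L t s L2q K)
          also have "\<dots> \<le> L2_norm \<Omega> (\<lambda>x. u t x - u s x) * L2_norm (interior K) q"
          proof (rule mult_right_mono)
            have d: "L2 \<Omega> (\<lambda>x. u t x - u s x)" by (intro L2_diff u t s)
            show "L2_norm (interior K) (\<lambda>x. u t x $ i - u s x $ i) \<le> L2_norm \<Omega> (\<lambda>x. u t x - u s x)"
              using L2_component(2)[OF L2_interior(1)[OF d K(1)], of i] L2_interior(2)[OF d K(1)] by simp
          qed simp
          finally show ?thesis by simp
        qed
        then show ?thesis by (auto simp: eventually_at intro!: exI[of _ 1])
      qed
      show "((\<lambda>t. L2_norm \<Omega> (\<lambda>x. u t x - u s x) * L2_norm (interior K) q) \<longlongrightarrow> 0) (at s within {t0..tn})"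
        by (rule tendsto_mult_left_zero[OF cont[OF s]])
    qed
    then show "(a K i q \<longlongrightarrow> a K i q s) (at s within {t0..tn})" by (rule LIM_zero_cancel)
  qed
  have joint: "continuous_on ({t0..tn} \<times> A) (\<lambda>(t, x). \<Sum>q\<in>R K. a K i q t * g q x)"
    if K: "K \<in> T" and g: "\<And>q. q \<in> R K \<Longrightarrow> continuous_on UNIV (g q)" for K i A and g :: "(real ^ 'd \<Rightarrow> real) \<Rightarrow> real ^ 'd \<Rightarrow> real"
    unfolding case_prod_unfold
  proof (intro continuous_intros)
    fix q assume q: "q \<in> R K"
    show "continuous_on ({t0..tn} \<times> A) (\<lambda>z. a K i q (fst z))"
      by (rule continuous_on_compose2[OF a_cont[OF K q]]) (auto intro!: continuous_intros)
    show "continuous_on ({t0..tn} \<times> A) (\<lambda>z. g q (snd z))"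
      by (rule continuous_on_compose2[OF g[OF q]]) (auto intro!: continuous_intros)
  qed
  show thesis
  proof (rule that[OF rep])
    fix K and A :: "(real ^ 'd) set" assume K: "K \<in> T"
    show "continuous_on ({t0..tn} \<times> A) (\<lambda>(t, x). P t K x)"
      using joint[OF K, of "\<lambda>q. q"] poly_deg_le_continuous_on[OF R(2)[OF K]]
      unfolding P_def case_prod_unfold by (intro continuous_on_vec_lambda) auto
    have Jc: "continuous_on ({t0..tn} \<times> A) (\<lambda>z. J (fst z) K (snd z) $ i $ j)" for i j
      using joint[OF K, of "\<lambda>q x. G q x $ j"] poly_deg_le_continuous_on[OF G(2)[OF R(2)[OF K]]]
      unfolding J_def case_prod_unfold by auto
    have "continuous_on ({t0..tn} \<times> A) (\<lambda>z. \<chi> i. \<chi> j. dev_part (J (fst z) K (snd z)) $ i $ j)"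
      unfolding dev_part_nth by (intro continuous_on_vec_lambda continuous_intros Jc)
    then show "continuous_on ({t0..tn} \<times> A) (\<lambda>(t, x). dev_part (J t K x))"
      by (simp add: case_prod_unfold vec_lambda_eta)
  qed
qed

lemma continuous_face_integral:
  fixes Q :: "real \<Rightarrow> real ^ 'd \<Rightarrow> real"
  assumes F: "F \<in> mesh_faces T" and Q: "\<And>A. continuous_on ({t0..tn} \<times> A) (\<lambda>(t, x). Q t x)"
  shows "continuous_on {t0..tn} (\<lambda>t. LINT x|surface_measure F. Q t x)"
proof -
  interpret S: hyperplane_piece F "outer_normal (ori F) F" "facet_offset (ori F) F"
    by (rule face_piece[OF ori_face[OF F]])
  have "continuous_on {t0..tn} (\<lambda>t. LINT x|surface_measure F. 1 * Q t x)"
  proof (rule continuous_on_parameter_integral[where F = F])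
    show "Q t \<in> borel_measurable (surface_measure F)" if t: "t \<in> {t0..tn}" for t
    proof -
      have "continuous_on UNIV (\<lambda>x. (\<lambda>(t, x). Q t x) (t, x))"
        by (rule continuous_on_compose2[OF Q[of UNIV]]) (use t in \<open>auto intro!: continuous_intros\<close>)
      then show ?thesis by (intro S.borel_measurable_surface borel_measurable_continuous_onI) simp
    qed
    show "integrable (surface_measure F) (\<lambda>x. 1 :: real)"
      using S.integrable_surface_continuous[of "\<lambda>x. 1 :: real"] by simp
  qed (use S.compact S.space_surface_measure Q in auto)
  then show ?thesis by simp
qed

text \<open>Supplies the integrability in time of the dissipation. Both quantities are rewritten as
  finite sums of integrals of polynomial data that depend continuously on time and space
  jointly.\<close>

lemma continuous_energy_norms:
  fixes u :: "real \<Rightarrow> real ^ 'd \<Rightarrow> real ^ 'd"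
  assumes u: "\<And>t. t \<in> {t0..tn} \<Longrightarrow> L2 \<Omega> (u t)" "\<And>t i. t \<in> {t0..tn} \<Longrightarrow> pw_poly T m (\<lambda>x. u t x $ i)"
    and cont: "\<And>s. s \<in> {t0..tn} \<Longrightarrow>
      ((\<lambda>t. L2_norm \<Omega> (\<lambda>x. u t x - u s x)) \<longlongrightarrow> 0) (at s within {t0..tn})"
    and \<zeta>: "0 \<le> \<zeta>"
  shows "continuous_on {t0..tn} (\<lambda>t. (sym_norm \<Omega> T ori (u t))\<^sup>2)"
    and "continuous_on {t0..tn} (\<lambda>t. (upwind_seminorm \<Omega> T ori \<zeta> (u t) (u t))\<^sup>2)"
proof -
  obtain P J where rep: "\<And>t. t \<in> {t0..tn} \<Longrightarrow> pw_poly_rep m (u t) (P t) (J t)" and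
    Pc: "\<And>K A. K \<in> T \<Longrightarrow> continuous_on ({t0..tn} \<times> A) (\<lambda>(t, x). P t K x)" and
    Jc: "\<And>K A. K \<in> T \<Longrightarrow> continuous_on ({t0..tn} \<times> A) (\<lambda>(t, x). dev_part (J t K x))"
    using continuous_pw_poly_rep[OF u cont] by metis
  note [continuous_intros] = Pc[unfolded case_prod_unfold] Jc[unfolded case_prod_unfold]
  define j where "j F t x = (if F \<subseteq> frontier \<Omega> then P t (ori F) x else P t (ori F) x - P t (minus_element T ori F) x)"
    for F t x
  have j: "jump \<Omega> T ori F (u t) x = j F t x" if "t \<in> {t0..tn}" "F \<in> mesh_faces T" "x \<in> F" for F t x
    using jump_rep(1)[OF rep[OF that(1)] that(2,3)] by (simp add: j_def)
  have jc: "continuous_on ({t0..tn} \<times> A) (\<lambda>z. j F (fst z) (snd z))" if F: "F \<in> mesh_faces T" for F A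
  proof (cases "F \<subseteq> frontier \<Omega>")
    case True
    then show ?thesis unfolding j_def using ori_face(1)[OF F] by (auto intro!: continuous_intros)
  next
    case False
    then have "F \<in> interior_faces \<Omega> T" using F by (simp add: interior_faces_def)
    from interior_facesD(3,5)[OF this] show ?thesis
      unfolding j_def using False by (auto intro!: continuous_intros)
  qed
  have "continuous_on {t0..tn} (\<lambda>t. (\<Sum>K\<in>T. LINT x|lebesgue. indicator (interior K) x * (norm (dev_part (J t K x)))\<^sup>2) +
      (\<Sum>F\<in>mesh_faces T. 1 / diameter F * (LINT x|surface_measure F. (norm (j F t x))\<^sup>2)))"
  proof (intro continuous_intros continuous_face_integral)
    fix K assume K: "K \<in> T"
    interpret convex_body K by (rule body[OF K])
    show "continuous_on {t0..tn} (\<lambda>t. LINT x|lebesgue. indicator (interior K) x * (norm (dev_part (J t K x)))\<^sup>2)"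
    proof (rule continuous_on_parameter_integral[where F = K and h = "indicator (interior K)"
          and G = "\<lambda>t x. (norm (dev_part (J t K x)))\<^sup>2"])
      show "integrable lebesgue (indicator (interior K) :: real ^ 'd \<Rightarrow> real)"
        using integrable_interior_continuous[OF K, of "\<lambda>x. 1"] by simp
      show "continuous_on ({t0..tn} \<times> K) (\<lambda>(t, x). (norm (dev_part (J t K x)))\<^sup>2)"
        unfolding case_prod_unfold by (intro continuous_intros K)
      show "(\<lambda>x. (norm (dev_part (J t K x)))\<^sup>2) \<in> borel_measurable lebesgue" if "t \<in> {t0..tn}" for t
        using pw_poly_repD(7)[OF rep[OF that] K]
        by (intro measurable_completion) (simp add: borel_measurable_continuous_onI continuous_intros)
      show "x \<in> K" if "indicator (interior K) x \<noteq> (0 :: real)" for x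
        using that interior_subset by (auto simp: indicator_def split: if_splits)
    qed (use compact in auto)
  next
    fix F and A :: "(real ^ 'd) set" assume F: "F \<in> mesh_faces T"
    show "continuous_on ({t0..tn} \<times> A) (\<lambda>(t, x). (norm (j F t x))\<^sup>2)"
      unfolding case_prod_unfold by (intro continuous_intros jc F)
  qed auto
  moreover have "(sym_norm \<Omega> T ori (u t))\<^sup>2 =
      (\<Sum>K\<in>T. LINT x|lebesgue. indicator (interior K) x * (norm (dev_part (J t K x)))\<^sup>2) +
      (\<Sum>F\<in>mesh_faces T. 1 / diameter F * (LINT x|surface_measure F. (norm (j F t x))\<^sup>2))"
    if t: "t \<in> {t0..tn}" for t
  proof -
    have eq: "(\<lambda>x. indicator (interior K) x * (norm (sym_grad_h (u t) x))\<^sup>2) =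
        (\<lambda>x. indicator (interior K) x * (norm (dev_part (J t K x)))\<^sup>2)" if "K \<in> T" for K
      by (rule interior_integral_cong[OF that]) (simp add: sym_grad_h_eq grad_h_eq[OF rep[OF t] that])
    have "integrable lebesgue (\<lambda>x. indicator (interior K) x * (norm (sym_grad_h (u t) x))\<^sup>2)" if "K \<in> T" for K
      unfolding eq[OF that]
      by (intro integrable_interior_continuous that continuous_intros pw_poly_repD(7)[OF rep[OF t] that])
    from domain_integral_split(2)[OF this]
    have n1: "(L2_norm \<Omega> (sym_grad_h (u t)))\<^sup>2 =
        (\<Sum>K\<in>T. LINT x|lebesgue. indicator (interior K) x * (norm (dev_part (J t K x)))\<^sup>2)"
      unfolding L2_norm_power2 L2_inner_def by (simp add: dot_square_norm eq)
    have n2: "(\<Sum>F\<in>mesh_faces T. 1 / diameter F * (LINT x|surface_measure F. (norm (jump \<Omega> T ori F (u t) x))\<^sup>2)) =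
        (\<Sum>F\<in>mesh_faces T. 1 / diameter F * (LINT x|surface_measure F. (norm (j F t x))\<^sup>2))"
      using j[OF t] by (intro sum.cong refl arg_cong2[where f = "(*)"] face_integral_cong) auto
    have n3: "0 \<le> (\<Sum>F\<in>mesh_faces T. 1 / diameter F *
        (LINT x|surface_measure F. (norm (jump \<Omega> T ori F (u t) x))\<^sup>2))"
    proof (intro sum_nonneg mult_nonneg_nonneg integral_nonneg_AE)
      fix F assume F: "F \<in> mesh_faces T"
      have "bounded F"
        using hyperplane_piece.compact[OF face_piece[OF ori_face[OF F]]] by (rule compact_imp_bounded)
      then show "0 \<le> 1 / diameter F" by (simp add: diameter_ge_0)
    qed auto
    show ?thesis
      unfolding sym_norm_def n1[symmetric] n2[symmetric]
      by (rule real_sqrt_pow2[OF add_nonneg_nonneg[OF zero_le_power2 n3]])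
  qed
  ultimately show "continuous_on {t0..tn} (\<lambda>t. (sym_norm \<Omega> T ori (u t))\<^sup>2)"
    by (simp cong: continuous_on_cong_simp)
  have "continuous_on {t0..tn} (\<lambda>t. \<zeta> * (\<Sum>F\<in>interior_faces \<Omega> T. LINT x|surface_measure F.
      \<bar>P t (ori F) x \<bullet> face_normal ori F\<bar> * (norm (j F t x))\<^sup>2))"
  proof (intro continuous_intros continuous_face_integral)
    fix F and A :: "(real ^ 'd) set" assume F: "F \<in> interior_faces \<Omega> T"
    note f = interior_facesD[OF F]
    show "F \<in> mesh_faces T" by (rule f(1))
    show "continuous_on ({t0..tn} \<times> A) (\<lambda>(t, x). \<bar>P t (ori F) x \<bullet> face_normal ori F\<bar> * (norm (j F t x))\<^sup>2)"
      unfolding case_prod_unfold by (intro continuous_intros jc f)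
  qed
  moreover have "(upwind_seminorm \<Omega> T ori \<zeta> (u t) (u t))\<^sup>2 =
      \<zeta> * (\<Sum>F\<in>interior_faces \<Omega> T. LINT x|surface_measure F.
      \<bar>P t (ori F) x \<bullet> face_normal ori F\<bar> * (norm (j F t x))\<^sup>2)" if t: "t \<in> {t0..tn}" for t
  proof -
    have eq: "(\<Sum>F\<in>interior_faces \<Omega> T. LINT x|surface_measure F.
       \<bar>normal_component ori F (u t) x\<bar> * (norm (jump \<Omega> T ori F (u t) x))\<^sup>2) =
      (\<Sum>F\<in>interior_faces \<Omega> T. LINT x|surface_measure F.
       \<bar>P t (ori F) x \<bullet> face_normal ori F\<bar> * (norm (j F t x))\<^sup>2)"
      using interior_traces(3)[OF rep[OF t]] j[OF t] interior_facesD(1)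
      by (intro sum.cong refl face_integral_cong) auto
    have "0 \<le> \<zeta> * (\<Sum>F\<in>interior_faces \<Omega> T. LINT x|surface_measure F.
       \<bar>P t (ori F) x \<bullet> face_normal ori F\<bar> * (norm (j F t x))\<^sup>2)"
      using \<zeta> by (intro mult_nonneg_nonneg sum_nonneg integral_nonneg_AE) auto
    then show ?thesis unfolding upwind_seminorm_def eq by simp
  qed
  ultimately show "continuous_on {t0..tn} (\<lambda>t. (upwind_seminorm \<Omega> T ori \<zeta> (u t) (u t))\<^sup>2)"
    by (simp cong: continuous_on_cong_simp)
qed

section \<open>Energy inequality on a single mesh\<close>

lemma semidiscrete_energy:
  fixes u f :: "real \<Rightarrow> real ^ 'd \<Rightarrow> real ^ 'd"
  assumes W: "velocity_space \<Omega> T m W" and \<zeta>: "0 \<le> \<zeta>" and \<nu>: "0 < \<nu>" and C: "0 \<le> C"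
    and coercive: "\<And>w. w \<in> W \<Longrightarrow> C * (sym_norm \<Omega> T ori w)\<^sup>2 \<le> a_form \<Omega> T ori \<eta> w w"
    and t: "t0 \<le> tn" and f: "L1_L2 {t0..tn} \<Omega> f"
    and sol: "semidiscrete_solution \<Omega> T ori W Q \<nu> \<eta> \<zeta> t0 tn f u0 p u"
  defines "R \<equiv> (\<lambda>s. (upwind_seminorm \<Omega> T ori \<zeta> (u s) (u s))\<^sup>2 + \<nu> * C * (sym_norm \<Omega> T ori (u s))\<^sup>2)"
  shows "set_integrable lebesgue {t0..tn} R"
    and "1 / 2 * (L2_norm \<Omega> (u tn))\<^sup>2 + (LINT s:{t0..tn}|lebesgue. R s) \<le>
      (L2_norm \<Omega> u0)\<^sup>2 + 3 / 2 * (L1_L2_norm {t0..tn} \<Omega> f)\<^sup>2"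
proof -
  have WH: "w \<in> H0_div \<Omega>" "L2 \<Omega> w" "pw_poly T m (\<lambda>x. w x $ i)" if "w \<in> W" for w i
    using W that by (auto simp: velocity_space_def H0_div_def)
  have uW: "u s \<in> W" if "s \<in> {t0..tn}" for s using sol that by (simp add: semidiscrete_solution_def)
  have u0: "u t0 = u0" and ac: "L2_absolutely_continuous \<Omega> t0 tn u"
    using sol by (auto simp: semidiscrete_solution_def)
  have ode: "AE t in lebesgue. t \<in> {t0<..<tn} \<longrightarrow>
        p t \<in> Q \<and> (\<forall>q\<in>Q. b_form \<Omega> (u t) q = 0) \<and>
        (\<exists>D\<in>W. has_L2_derivative \<Omega> u D t \<and>
           (\<forall>w\<in>W. L2_inner \<Omega> D w + c_form \<Omega> T ori \<zeta> (u t) (u t) w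
                   + \<nu> * a_form \<Omega> T ori \<eta> (u t) w - b_form \<Omega> w (p t)
                 = L2_inner \<Omega> (f t) w))"
    using sol by (simp add: semidiscrete_solution_def)
  have "continuous_on {t0..tn} (\<lambda>s. (sym_norm \<Omega> T ori (u s))\<^sup>2)"
    "continuous_on {t0..tn} (\<lambda>s. (upwind_seminorm \<Omega> T ori \<zeta> (u s) (u s))\<^sup>2)"
    using continuous_energy_norms[of t0 tn u m \<zeta>] WH uW L2_absolutely_continuous_tendsto[OF ac] \<zeta> by auto
  then have "continuous_on {t0..tn} R" unfolding R_def
    by (intro continuous_on_add continuous_on_mult_left)
  then show Ri: "set_integrable lebesgue {t0..tn} R"
    by (intro set_integrable_continuous_compact) auto
  have f': "AE t in lebesgue. t \<in> {t0..tn} \<longrightarrow> L2 \<Omega> (f t)"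
    "set_integrable lebesgue {t0..tn} (\<lambda>t. L2_norm \<Omega> (f t))"
    using f by (auto simp: L1_L2_def)
  have "AE t in lebesgue. t \<in> {t0<..<tn} \<longrightarrow>
      (\<exists>e. ((\<lambda>s. (L2_norm \<Omega> (u s))\<^sup>2) has_real_derivative 2 * e) (at t) \<and>
        e + R t \<le> L2_norm \<Omega> (f t) * L2_norm \<Omega> (u t))"
    using ode f'(1)
  proof eventually_elim
    case (elim t)
    show ?case
    proof
      assume t: "t \<in> {t0<..<tn}"
      then have ut: "u t \<in> W" and ft: "L2 \<Omega> (f t)" using uW elim(2) by auto
      obtain D where D: "D \<in> W" "has_L2_derivative \<Omega> u D t" and
        eq: "L2_inner \<Omega> D (u t) + c_form \<Omega> T ori \<zeta> (u t) (u t) (u t)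
                   + \<nu> * a_form \<Omega> T ori \<eta> (u t) (u t) - b_form \<Omega> (u t) (p t) = L2_inner \<Omega> (f t) (u t)"
        using elim(1) t ut by blast
      obtain P J where rep: "pw_poly_rep m (u t) P J"
        using pw_poly_rep_exists[of m "u t"] WH(3)[OF ut] by blast
      have "c_form \<Omega> T ori \<zeta> (u t) (u t) (u t) = (upwind_seminorm \<Omega> T ori \<zeta> (u t) (u t))\<^sup>2"
        by (rule c_form_diagonal[OF WH(1)[OF ut] rep rep \<zeta>])
      \<comment> \<open>The pressure \<open>p t\<close> lies in \<open>Q\<close> and is therefore an
        admissible test function for the divergence constraint.\<close>
      moreover have "b_form \<Omega> (u t) (p t) = 0" using elim(1) t by blast
      moreover have "\<nu> * (C * (sym_norm \<Omega> T ori (u t))\<^sup>2) \<le> \<nu> * a_form \<Omega> T ori \<eta> (u t) (u t)"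
        using coercive[OF ut] \<nu> by (intro mult_left_mono) auto
      moreover have "L2_inner \<Omega> (f t) (u t) \<le> L2_norm \<Omega> (f t) * L2_norm \<Omega> (u t)"
        using L2_Cauchy_Schwarz[OF ft WH(2)[OF ut]] by simp
      ultimately have "L2_inner \<Omega> D (u t) + R t \<le> L2_norm \<Omega> (f t) * L2_norm \<Omega> (u t)"
        using eq by (simp add: R_def)
      moreover have "((\<lambda>s. (L2_norm \<Omega> (u s))\<^sup>2) has_real_derivative 2 * L2_inner \<Omega> D (u t)) (at t)"
        by (rule has_L2_derivative_power2_norm[OF t _ WH(2)[OF D(1)] D(2)]) (rule WH(2)[OF uW])
      ultimately show "\<exists>e. ((\<lambda>s. (L2_norm \<Omega> (u s))\<^sup>2) has_real_derivative 2 * e) (at t) \<and>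
        e + R t \<le> L2_norm \<Omega> (f t) * L2_norm \<Omega> (u t)" by blast
    qed
  qed
  moreover have "abs_continuous t0 tn (\<lambda>s. L2_norm \<Omega> (u s))"
    by (rule L2_absolutely_continuous_norm[OF ac]) (rule WH(2)[OF uW])
  moreover have "0 \<le> R s" for s unfolding R_def using \<nu> C by simp
  ultimately show "1 / 2 * (L2_norm \<Omega> (u tn))\<^sup>2 + (LINT s:{t0..tn}|lebesgue. R s) \<le>
      (L2_norm \<Omega> u0)\<^sup>2 + 3 / 2 * (L1_L2_norm {t0..tn} \<Omega> f)\<^sup>2"
    unfolding L1_L2_norm_def u0[symmetric]
    using t f'(2) Ri by (intro energy_estimate) simp_all
qed

end

theorem theorem7p1:
  fixes \<Omega> :: "(real ^ 'd) set"
    and H :: "'h set"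
    and T :: "'h \<Rightarrow> (real ^ 'd) set set"
    and ori :: "'h \<Rightarrow> (real ^ 'd) set \<Rightarrow> (real ^ 'd) set"
    and W :: "'h \<Rightarrow> (real ^ 'd \<Rightarrow> real ^ 'd) set"
    and Q :: "'h \<Rightarrow> (real ^ 'd \<Rightarrow> real) set"
    and m :: nat
    and C\<^sub>t\<^sub>r \<eta> \<zeta> :: real
  assumes dim: "CARD('d) \<in> {2, 3}"
    and domain: "polyhedral_domain \<Omega>"
    and mesh: "\<And>h. h \<in> H \<Longrightarrow> simplicial_mesh \<Omega> (T h)"
    and regular: "shape_regular H T"
    and ori: "\<And>h. h \<in> H \<Longrightarrow> orientation (T h) (ori h)"
    and W: "\<And>h. h \<in> H \<Longrightarrow> velocity_space \<Omega> (T h) m (W h)"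
    and Q: "\<And>h. h \<in> H \<Longrightarrow> pressure_space \<Omega> (T h) (Q h)"
    and trace: "discrete_trace_inequality H T m C\<^sub>t\<^sub>r"
    and \<zeta>: "\<zeta> \<ge> 0"
    and \<eta>: "\<eta> > 2 * C\<^sub>t\<^sub>r\<^sup>2 * real (max_faces H T)"
  shows "\<exists>C>0.
    (\<forall>h\<in>H. \<forall>w\<in>W h. a_form \<Omega> (T h) (ori h) \<eta> w w \<ge> C * (sym_norm \<Omega> (T h) (ori h) w)\<^sup>2) \<and>
    (\<forall>h\<in>H. \<forall>\<nu> t\<^sub>0 t\<^sub>n f u\<^sub>0 p u.
       \<nu> > 0 \<longrightarrow> t\<^sub>0 \<le> t\<^sub>n \<longrightarrow> L1_L2 {t\<^sub>0..t\<^sub>n} \<Omega> f \<longrightarrow> u\<^sub>0 \<in> W h \<longrightarrow>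
       semidiscrete_solution \<Omega> (T h) (ori h) (W h) (Q h) \<nu> \<eta> \<zeta> t\<^sub>0 t\<^sub>n f u\<^sub>0 p u \<longrightarrow>
       set_integrable lebesgue {t\<^sub>0..t\<^sub>n}
         (\<lambda>s. (upwind_seminorm \<Omega> (T h) (ori h) \<zeta> (u s) (u s))\<^sup>2
              + \<nu> * C * (sym_norm \<Omega> (T h) (ori h) (u s))\<^sup>2) \<and>
       1 / 2 * (L2_norm \<Omega> (u t\<^sub>n))\<^sup>2
         + (LINT s:{t\<^sub>0..t\<^sub>n}|lebesgue.
              (upwind_seminorm \<Omega> (T h) (ori h) \<zeta> (u s) (u s))\<^sup>2
              + \<nu> * C * (sym_norm \<Omega> (T h) (ori h) (u s))\<^sup>2)
       \<le> (L2_norm \<Omega> u\<^sub>0)\<^sup>2 + 3 / 2 * (L1_L2_norm {t\<^sub>0..t\<^sub>n} \<Omega> f)\<^sup>2)"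
proof -
  define N where "N = max_faces H T"
  \<comment> \<open>Its reciprocal is the midpoint between the two sides of the assumption on
    \<open>\<eta>\<close>, which leaves both coefficients in the coercivity estimate
    positive.\<close>
  define \<epsilon> where "\<epsilon> = 2 / (\<eta> + 2 * C\<^sub>t\<^sub>r\<^sup>2 * real N)"
  \<comment> \<open>The smaller of the coefficients of the gradient part and the jump part. It
    depends only on \<open>\<eta>\<close>, \<open>C\<^sub>t\<^sub>r\<close> and the number of faces,
    hence not on the individual mesh.\<close>
  define C where "C = min (1 / 2 - \<epsilon> * (C\<^sub>t\<^sub>r\<^sup>2 * real N)) (\<eta> - 1 / \<epsilon>)"
  have N0: "0 \<le> C\<^sub>t\<^sub>r\<^sup>2 * real N" by simp
  have \<eta>N: "2 * (C\<^sub>t\<^sub>r\<^sup>2 * real N) < \<eta>" using \<eta> by (simp add: N_def mult.assoc)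
  have pos: "0 < \<eta> + 2 * C\<^sub>t\<^sub>r\<^sup>2 * real N" unfolding mult.assoc using N0 \<eta>N by linarith
  then have \<epsilon>: "0 < \<epsilon>" by (simp add: \<epsilon>_def)
  have "\<epsilon> * (C\<^sub>t\<^sub>r\<^sup>2 * real N) < 1 / 2" using \<eta>N pos by (simp add: \<epsilon>_def field_simps)
  moreover have "1 / \<epsilon> < \<eta>" using \<eta>N by (simp add: \<epsilon>_def)
  ultimately have C: "0 < C" by (simp add: C_def)
  have loc: "triangulated_domain \<Omega> (T h) (ori h)" if "h \<in> H" for h
    using domain mesh[OF that] ori[OF that] by unfold_locales
  have card: "card {F. F facet_of K} \<le> CARD('d) + 1" if "h \<in> H" "K \<in> T h" for h K
    using mesh[OF that(1)] that(2) by (intro card_facets_simplex) (simp add: simplicial_mesh_def)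
  have N: "card {F. F facet_of K} \<le> N" if "h \<in> H" "K \<in> T h" for h K
    unfolding N_def max_faces_def
  proof (rule cSup_upper)
    show "card {F. F facet_of K} \<in> {card {F. F facet_of K} | K. K \<in> (\<Union>h\<in>H. T h)}" using that by blast
    \<comment> \<open>The supremum bounds the face counts only because they are bounded, for
      simplices by d + 1.\<close>
    show "bdd_above {card {F. F facet_of K} | K. K \<in> (\<Union>h\<in>H. T h)}"
      unfolding bdd_above_def using card by (intro exI[of _ "CARD('d) + 1"]) auto
  qed
  have coercive: "C * (sym_norm \<Omega> (T h) (ori h) w)\<^sup>2 \<le> a_form \<Omega> (T h) (ori h) \<eta> w w"
    if h: "h \<in> H" and w: "w \<in> W h" for h w
  proof -
    interpret triangulated_domain \<Omega> "T h" "ori h" by (rule loc[OF h])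
    have d: "CARD('d) = 2 \<or> CARD('d) = 3" using dim by simp
    have "pw_poly (T h) m (\<lambda>x. w x $ i)" for i using W[OF h] w by (simp add: velocity_space_def)
    then obtain P J where rep: "pw_poly_rep m w P J" by (rule pw_poly_rep_exists)
    define A where "A = (L2_norm \<Omega> (sym_grad_h w))\<^sup>2"
    define B where "B = (\<Sum>F\<in>mesh_faces (T h). 1 / diameter F *
            (LINT x|surface_measure F. (norm (jump \<Omega> (T h) (ori h) F w x))\<^sup>2))"
    have A: "0 \<le> A" by (simp add: A_def)
    have B: "0 \<le> B"
      unfolding B_def
    proof (intro sum_nonneg mult_nonneg_nonneg integral_nonneg_AE)
      fix F assume F: "F \<in> mesh_faces (T h)"
      have "0 < diameter F"
        using facet_diameter_pos(1)[OF body[OF ori_face(1)[OF F]] ori_face(2)[OF F]] d by auto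
      then show "0 \<le> 1 / diameter F" by simp
    qed auto
    have "(sym_norm \<Omega> (T h) (ori h) w)\<^sup>2 = A + B"
      unfolding sym_norm_def A_def[symmetric] B_def[symmetric] using A B by simp
    then have "C * (sym_norm \<Omega> (T h) (ori h) w)\<^sup>2 = C * A + C * B" by (simp add: distrib_left)
    also have "\<dots> \<le> (1 / 2 - \<epsilon> * (C\<^sub>t\<^sub>r\<^sup>2 * real N)) * A + (\<eta> - 1 / \<epsilon>) * B"
      using A B by (intro add_mono mult_right_mono) (simp_all add: C_def)
    also have "\<dots> \<le> a_form \<Omega> (T h) (ori h) \<eta> w w"
      unfolding A_def B_def
    proof (rule a_form_coercive[OF d rep _ N[OF h] \<epsilon>])
      fix K F and q :: "real ^ 'd \<Rightarrow> real"
      assume "K \<in> T h" "F facet_of K" "poly_deg_le m q"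
      then show "sqrt (diameter K) * sqrt (LINT x|surface_measure F. (q x)\<^sup>2) \<le> C\<^sub>t\<^sub>r * L2_norm K q"
        using trace h unfolding discrete_trace_inequality_def by blast
    qed
    finally show ?thesis .
  qed
  show ?thesis
  proof (intro exI[of _ C] conjI ballI allI impI C)
    fix h w assume "h \<in> H" "w \<in> W h"
    then show "C * (sym_norm \<Omega> (T h) (ori h) w)\<^sup>2 \<le> a_form \<Omega> (T h) (ori h) \<eta> w w" by (rule coercive)
  next
    fix h \<nu> t\<^sub>0 t\<^sub>n f u\<^sub>0 p u
    assume h: "h \<in> H" and \<nu>: "\<nu> > 0" and t: "t\<^sub>0 \<le> t\<^sub>n" and f: "L1_L2 {t\<^sub>0..t\<^sub>n} \<Omega> f"
      and sol: "semidiscrete_solution \<Omega> (T h) (ori h) (W h) (Q h) \<nu> \<eta> \<zeta> t\<^sub>0 t\<^sub>n f u\<^sub>0 p u"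
    interpret triangulated_domain \<Omega> "T h" "ori h" by (rule loc[OF h])
    note energy = semidiscrete_energy[OF W[OF h] \<zeta> \<nu> less_imp_le[OF C] coercive[OF h] t f sol]
    show "set_integrable lebesgue {t\<^sub>0..t\<^sub>n}
         (\<lambda>s. (upwind_seminorm \<Omega> (T h) (ori h) \<zeta> (u s) (u s))\<^sup>2
              + \<nu> * C * (sym_norm \<Omega> (T h) (ori h) (u s))\<^sup>2)"
      by (rule energy(1))
    show "1 / 2 * (L2_norm \<Omega> (u t\<^sub>n))\<^sup>2
         + (LINT s:{t\<^sub>0..t\<^sub>n}|lebesgue.
              (upwind_seminorm \<Omega> (T h) (ori h) \<zeta> (u s) (u s))\<^sup>2
              + \<nu> * C * (sym_norm \<Omega> (T h) (ori h) (u s))\<^sup>2)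
       \<le> (L2_norm \<Omega> u\<^sub>0)\<^sup>2 + 3 / 2 * (L1_L2_norm {t\<^sub>0..t\<^sub>n} \<Omega> f)\<^sup>2"
      by (rule energy(2))
  qed
qed

end
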